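(* Let $\mathcal G$ and $\mathcal H$ be groupoids, let $\mathcal R\subseteq\mathcal G^0$ be open and $\mathcal G$-invariant, and let $\mathcal X\colon\mathcal G\leftarrow\mathcal G$ be a groupoid correspondence that is regular on $\mathcal R$. Let $\mathcal M$ be the groupoid model of $(\mathcal G,\mathcal X,\mathcal R)$. Consider a triple of continuous maps $$\varrho\colon\mathcal H^0\to\mathcal G^0,\qquad \mu_{\mathcal G}\colon\mathcal G\times_{s,\mathcal G^0,\varrho}\mathcal H^0\to\mathcal H,\qquad \mu_{\mathcal X}\colon\mathcal X\times_{s,\mathcal G^0,\varrho}\mathcal H^0\to\mathcal H$$ such that $\mu_{\mathcal X}$ is open and $$s(\mu_{\mathcal G}(g,\omega))=\omega,\quad s(\mu_{\mathcal X}(x,\omega))=\omega,\quad \varrho(r(\mu_{\mathcal G}(g,\omega)))=r(g),\quad \varrho(r(\mu_{\mathcal X}(x,\omega)))=r(x)$$ for all $g\in\mathcal G$, $x\in\mathcal X$, $\omega\in\mathcal H^0$ with $s(g)=\varrho(\omega)$ and $s(x)=\varrho(\omega)$, respectively. Define multiplication maps $\mathcal G\times_{s,\mathcal G^0,\varrho r}\mathcal H\to\mathcal H$ and $\mathcal X\times_{s,\mathcal G^0,\varrho r}\mathcal H\to\mathcal H$ by $g\cdot h:=\mu_{\mathcal G}(g,r(h))\cdot h$ and $x\cdot h:=\mu_{\mathcal X}(x,r(h))\cdot h$. These data define an actor $\mathcal M\to\mathcal H$ (that is, these multiplication maps with anchor map $\varrho\circ r\colon \mathcal H\to\mathcal G^0$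 form a $(\mathcal G,\mathcal X,\mathcal R)$-action on $\mathcal H$ whose associated $\mathcal M$-action commutes with the right translation action of $\mathcal H$) if and only if the following conditions hold: (1) $g_1\cdot(g_2\cdot h)=(g_1\cdot g_2)\cdot h$, $g\cdot(x\cdot h)=(g\cdot x)\cdot h$, and $x\cdot(g\cdot h)=(x\cdot g)\cdot h$ whenever $g_1,g_2,g\in\mathcal G$, $x\in\mathcal X$, $h\in\mathcal H$ and these triples are composable; (2) $1_{\varrho(\omega)}\cdot\omega=\omega$ for all $\omega\in\mathcal H^0$, where $1_{\varrho(\omega)}$ is the unit arrow in $\mathcal G$ and $\omega$ is identified with its unit arrow in $\mathcal H$; (3) if $x_1\cdot y_1=x_2\cdot y_2$ for $x_1,x_2\in\mathcal X$, $y_1,y_2\in\mathcal H$ for which these products are defined, then there is $g\in\mathcal G$ with $x_2=x_1\cdot g$ and $y_1=g\cdot y_2$; (4) the image of $r\circ\mu_{\mathcal X}$ contains $\varrho^{-1}(\mathcal R)$; (5) if $K\subseteq\mathcal X/\mathcal G$ is compact, then the set of all $r(x\cdot h)\in\mathcal H^0$ with $x\in\mathcal X$, $h\in\mathcal H$, $[x]\in K$, $s(x)=\varrho(r(h))$ is closed in $\mathcal H^0$. Any actor $\mathcal M\to\mathcal H$ is of this form for a unique triple of maps $(\varrho,\mu_{\mathcal G},\mu_{\mathcal X})$. The actor is proper if and only if $\varrho\colon\mathcal H^0\to\mathcal G^0$ is a proper map. In that case, condition (5) is redundant.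
   Context: Groupoids are étale and locally compact with Hausdorff object space (the arrow space may be non-Hausdorff). $\mathcal H^0$ is the object space, $r,s$ are range and source. Anchor maps of left actions are denoted $r$, of right actions $s$; all products $x\cdot y$ are defined if $s(x)=r(y)$. Groupoid correspondence $\mathcal X\colon\mathcal G\leftarrow\mathcal G$: a topological space $\mathcal X$ with commuting actions of $\mathcal G$ on the left and on the right such that the right action is free and proper and the right anchor map $s\colon\mathcal X\to\mathcal G^0$ is a local homeomorphism. The left anchor map induces $r_*\colon\mathcal X/\mathcal G\to\mathcal G^0$ on the orbit space of the right action; $[x]$ denotes the class of $x$. The correspondence is regular on $\mathcal R$ if the restriction $r_*^{-1}(\mathcal R)\to\mathcal R$ is proper and surjective. Action of $(\mathcal G,\mathcal X,\mathcal R)$ on a topological space $Y$: a groupoid action of $\mathcal G$ on $Y$ (with anchor map $r\colon Y\to\mathcal G^0$) and a continuous open map $\mathcal X\times_{s,\mathcal G^0,r}Y\to Y$, $(x,y)\mapsto x\cdot y$, such that (i) $r(x\cdot y)=r(x)$ and $g\cdot(x\cdot y)=(g\cdot x)\cdot y$ whenever $s(g)=r(x)$, $s(x)=r(y)$; (ii) if $s(x)=r(y)$, $s(x')=r(y')$, then $x\cdot y=x'\cdot y'$ if and only if there is $g\in\mathcal G$ with $x'=x\cdot g$ and $y=g\cdot y'$; (iii) $r^{-1}(\mathcal R)\subseteq Y$ is contained in $\mathcal X\cdot Y:=\{x\cdot y\}$; (iv) if $K\subseteq\mathcal X/\mathcal G$ is compact, then the set of all $x\cdot y$ with $[x]\in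 K$, $s(x)=r(y)$ is closed in $Y$. A continuous map $\varphi\colon Y_1\to Y_2$ between two such spaces is $(\mathcal G,\mathcal X)$-equivariant if it is $\mathcal G$-equivariant, $\varphi(x\cdot y)=x\cdot\varphi(y)$ whenever $s(x)=r(y)$, and $\varphi^{-1}(\mathcal X\cdot Y_2)=\mathcal X\cdot Y_1$. Groupoid model of $(\mathcal G,\mathcal X,\mathcal R)$: an étale groupoid $\mathcal M$ with, for every topological space $Y$, a bijection between $(\mathcal G,\mathcal X,\mathcal R)$-actions and $\mathcal M$-actions on $Y$, natural in the sense that a continuous map between two spaces is $(\mathcal G,\mathcal X)$-equivariant if and only if it is $\mathcal M$-equivariant for the associated $\mathcal M$-actions. It is known to exist and to be unique up to canonical isomorphism. Actor $\mathcal M\to\mathcal H$: an action of $\mathcal M$ on the arrow space of $\mathcal H$ that commutes with the right translation action of $\mathcal H$. It is proper if the map $\mathcal H/\mathcal H\cong\mathcal H^0\to\mathcal M^0$ induced by the anchor map $\mathcal H\to\mathcal M^0$ is proper. *)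

theory Defs
  imports "HOL-Analysis.Analysis"
begin

section \<open>Topological preliminaries\<close>

definition local_homeomorphism :: "'a topology \<Rightarrow> 'b topology \<Rightarrow> ('a \<Rightarrow> 'b) \<Rightarrow> bool" where
  "local_homeomorphism A B f \<longleftrightarrow>
     (\<forall>x \<in> topspace A. \<exists>U. openin A U \<and> x \<in> U \<and> openin B (f ` U) \<and>
        homeomorphic_map (subtopology A U) (subtopology B (f ` U)) f)"

definition fibre_product :: "'a topology \<Rightarrow> ('a \<Rightarrow> 'c) \<Rightarrow> ('b \<Rightarrow> 'c) \<Rightarrow> 'b topology \<Rightarrow> ('a \<times> 'b) topology" where
  "fibre_product A p q B = subtopology (prod_topology A B) {(a, b). p a = q b}"

definition quotient_topology :: "'a topology \<Rightarrow> ('a \<Rightarrow> 'b) \<Rightarrow> 'b topology" where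
  "quotient_topology A q =
     topology (\<lambda>U. U \<subseteq> q ` topspace A \<and> openin A {x \<in> topspace A. q x \<in> U})"

lemma openin_quotient_topology:
  "openin (quotient_topology A q) U \<longleftrightarrow> U \<subseteq> q ` topspace A \<and> openin A {x \<in> topspace A. q x \<in> U}"
proof -
  have "istopology (\<lambda>U. U \<subseteq> q ` topspace A \<and> openin A {x \<in> topspace A. q x \<in> U})"
    unfolding istopology_def
  proof (rule conjI; intro allI impI conjI; (elim conjE)?)
    fix S T assume *: "openin A {x \<in> topspace A. q x \<in> S}" "openin A {x \<in> topspace A. q x \<in> T}"
    have "{x \<in> topspace A. q x \<in> S \<inter> T} = {x \<in> topspace A. q x \<in> S} \<inter> {x \<in> topspace A. q x \<in> T}"
      by auto
    with * show "openin A {x \<in> topspace A. q x \<in> S \<inter> T}" by (simp add: openin_Int)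
  next
    fix \<K> assume *: "\<forall>K\<in>\<K>. K \<subseteq> q ` topspace A \<and> openin A {x \<in> topspace A. q x \<in> K}"
    have "{x \<in> topspace A. q x \<in> \<Union>\<K>} = (\<Union>K\<in>\<K>. {x \<in> topspace A. q x \<in> K})" by auto
    with * show "openin A {x \<in> topspace A. q x \<in> \<Union>\<K>}" by (simp add: openin_clauses(3) image_iff)
    show "\<Union>\<K> \<subseteq> q ` topspace A" using * by blast
  qed auto
  then show ?thesis by (simp add: quotient_topology_def topology_inverse')
qed

lemma quotient_map_quotient_topology: "quotient_map A (quotient_topology A q) q"
proof -
  have "{x \<in> topspace A. q x \<in> q ` topspace A} = topspace A" by auto
  then have "openin (quotient_topology A q) (q ` topspace A)"
    by (simp add: openin_quotient_topology)
  then have "topspace (quotient_topology A q) = q ` topspace A"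
    by (meson openin_quotient_topology openin_subset openin_topspace subset_antisym)
  then show ?thesis by (simp add: quotient_map_def openin_quotient_topology)
qed


section \<open>Groupoids\<close>

text \<open>Objects are identified with their unit arrows, so that range and source map arrows to arrows;
  the space of objects is the set of units with the subspace topology (in any topological groupoid,
  the unit map is a homeomorphism onto this subspace).\<close>

record 'g tgroupoid =
  arrows :: "'g topology"
  src :: "'g \<Rightarrow> 'g"
  rng :: "'g \<Rightarrow> 'g"
  gcomp :: "'g \<Rightarrow> 'g \<Rightarrow> 'g"
  ginv :: "'g \<Rightarrow> 'g"

definition units :: "'g tgroupoid \<Rightarrow> 'g set" where
  "units G = {u \<in> topspace (arrows G). src G u = u}"

definition objects :: "'g tgroupoid \<Rightarrow> 'g topology" where
  "objects G = subtopology (arrows G) (units G)"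

text \<open>The arrow space may be non-Hausdorff.  It is locally compact because the source map is a
  local homeomorphism to the locally compact object space.\<close>

locale etale_groupoid =
  fixes G :: "'g tgroupoid"
  assumes src_unit: "g \<in> topspace (arrows G) \<Longrightarrow> src G g \<in> units G"
    and rng_unit: "g \<in> topspace (arrows G) \<Longrightarrow> rng G g \<in> units G"
    and rng_of_unit: "u \<in> units G \<Longrightarrow> rng G u = u"
    and comp_closed: "\<lbrakk>g \<in> topspace (arrows G); h \<in> topspace (arrows G); src G g = rng G h\<rbrakk>
      \<Longrightarrow> gcomp G g h \<in> topspace (arrows G)"
    and src_comp: "\<lbrakk>g \<in> topspace (arrows G); h \<in> topspace (arrows G); src G g = rng G h\<rbrakk>
      \<Longrightarrow> src G (gcomp G g h) = src G h"
    and rng_comp: "\<lbrakk>g \<in> topspace (arrows G); h \<in> topspace (arrows G); src G g = rng G h\<rbrakk>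
      \<Longrightarrow> rng G (gcomp G g h) = rng G g"
    and comp_assoc: "\<lbrakk>g \<in> topspace (arrows G); h \<in> topspace (arrows G); k \<in> topspace (arrows G);
        src G g = rng G h; src G h = rng G k\<rbrakk>
      \<Longrightarrow> gcomp G (gcomp G g h) k = gcomp G g (gcomp G h k)"
    and left_unit: "g \<in> topspace (arrows G) \<Longrightarrow> gcomp G (rng G g) g = g"
    and right_unit: "g \<in> topspace (arrows G) \<Longrightarrow> gcomp G g (src G g) = g"
    and ginv_closed: "g \<in> topspace (arrows G) \<Longrightarrow> ginv G g \<in> topspace (arrows G)"
    and src_ginv: "g \<in> topspace (arrows G) \<Longrightarrow> src G (ginv G g) = rng G g"
    and rng_ginv: "g \<in> topspace (arrows G) \<Longrightarrow> rng G (ginv G g) = src G g"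
    and ginv_left: "g \<in> topspace (arrows G) \<Longrightarrow> gcomp G (ginv G g) g = src G g"
    and ginv_right: "g \<in> topspace (arrows G) \<Longrightarrow> gcomp G g (ginv G g) = rng G g"
    and continuous_comp: "continuous_map (fibre_product (arrows G) (src G) (rng G) (arrows G))
      (arrows G) (\<lambda>(g, h). gcomp G g h)"
    and continuous_ginv: "continuous_map (arrows G) (arrows G) (ginv G)"
    and etale_src: "local_homeomorphism (arrows G) (objects G) (src G)"
    and etale_rng: "local_homeomorphism (arrows G) (objects G) (rng G)"
    and Hausdorff_objects: "Hausdorff_space (objects G)"
    and locally_compact_objects: "locally_compact_space (objects G)"

definition invariant_set :: "'g tgroupoid \<Rightarrow> 'g set \<Rightarrow> bool" where
  "invariant_set G R \<longleftrightarrow> (\<forall>g \<in> topspace (arrows G). src G g \<in> R \<longleftrightarrow> rng G g \<in> R)"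


section \<open>Actions\<close>

locale left_action =
  fixes G :: "'g tgroupoid" and Y :: "'y topology"
    and a :: "'y \<Rightarrow> 'g" and m :: "'g \<times> 'y \<Rightarrow> 'y"
  assumes continuous_anchor: "continuous_map Y (objects G) a"
    and continuous_act: "continuous_map (fibre_product (arrows G) (src G) a Y) Y m"
    and anchor_act: "\<lbrakk>g \<in> topspace (arrows G); y \<in> topspace Y; src G g = a y\<rbrakk>
      \<Longrightarrow> a (m (g, y)) = rng G g"
    and act_act: "\<lbrakk>g \<in> topspace (arrows G); h \<in> topspace (arrows G); y \<in> topspace Y;
        src G g = rng G h; src G h = a y\<rbrakk>
      \<Longrightarrow> m (g, m (h, y)) = m (gcomp G g h, y)"
    and unit_act: "y \<in> topspace Y \<Longrightarrow> m (a y, y) = y"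

locale right_action =
  fixes G :: "'g tgroupoid" and Y :: "'y topology"
    and a :: "'y \<Rightarrow> 'g" and m :: "'y \<times> 'g \<Rightarrow> 'y"
  assumes continuous_anchor: "continuous_map Y (objects G) a"
    and continuous_act: "continuous_map (fibre_product Y a (rng G) (arrows G)) Y m"
    and anchor_act: "\<lbrakk>y \<in> topspace Y; g \<in> topspace (arrows G); a y = rng G g\<rbrakk>
      \<Longrightarrow> a (m (y, g)) = src G g"
    and act_act: "\<lbrakk>y \<in> topspace Y; g \<in> topspace (arrows G); h \<in> topspace (arrows G);
        a y = rng G g; src G g = rng G h\<rbrakk>
      \<Longrightarrow> m (m (y, g), h) = m (y, gcomp G g h)"
    and unit_act: "y \<in> topspace Y \<Longrightarrow> m (y, a y) = y"

definition commuting_actions :: "'g tgroupoid \<Rightarrow> 'h tgroupoid \<Rightarrow> 'y topology \<Rightarrow>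
    ('y \<Rightarrow> 'g) \<Rightarrow> ('g \<times> 'y \<Rightarrow> 'y) \<Rightarrow> ('y \<Rightarrow> 'h) \<Rightarrow> ('y \<times> 'h \<Rightarrow> 'y) \<Rightarrow> bool" where
  "commuting_actions G H Y a m b n \<longleftrightarrow>
     (\<forall>y \<in> topspace Y. \<forall>h \<in> topspace (arrows H). b y = rng H h \<longrightarrow> a (n (y, h)) = a y) \<and>
     (\<forall>g \<in> topspace (arrows G). \<forall>y \<in> topspace Y. src G g = a y \<longrightarrow> b (m (g, y)) = b y) \<and>
     (\<forall>g \<in> topspace (arrows G). \<forall>y \<in> topspace Y. \<forall>h \<in> topspace (arrows H).
        src G g = a y \<and> b y = rng H h \<longrightarrow> n (m (g, y), h) = m (g, n (y, h)))"

text \<open>Actions as a set: two actions count as equal if they agree on their domains of definition, so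
  the structure maps are normalised to be extensional.\<close>

definition groupoid_actions ::
    "'m tgroupoid \<Rightarrow> 'y topology \<Rightarrow> (('y \<Rightarrow> 'm) \<times> ('m \<times> 'y \<Rightarrow> 'y)) set" where
  "groupoid_actions M Y = {(a, m). left_action M Y a m \<and> a \<in> extensional (topspace Y) \<and>
     m \<in> extensional (topspace (fibre_product (arrows M) (src M) a Y))}"

definition groupoid_equivariant :: "'m tgroupoid \<Rightarrow> 'y topology \<Rightarrow>
    ('y \<Rightarrow> 'm) \<times> ('m \<times> 'y \<Rightarrow> 'y) \<Rightarrow> ('z \<Rightarrow> 'm) \<times> ('m \<times> 'z \<Rightarrow> 'z) \<Rightarrow> ('y \<Rightarrow> 'z) \<Rightarrow> bool" where
  "groupoid_equivariant M Y = (\<lambda>(a, m) (b, n) \<phi>.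
     (\<forall>y \<in> topspace Y. b (\<phi> y) = a y) \<and>
     (\<forall>g \<in> topspace (arrows M). \<forall>y \<in> topspace Y. src M g = a y \<longrightarrow> \<phi> (m (g, y)) = n (g, \<phi> y)))"


section \<open>Groupoid correspondences\<close>

record ('g, 'x) correspondence =
  cspace :: "'x topology"
  lanchor :: "'x \<Rightarrow> 'g"
  lact :: "'g \<times> 'x \<Rightarrow> 'x"
  ranchor :: "'x \<Rightarrow> 'g"
  ract :: "'x \<times> 'g \<Rightarrow> 'x"

locale groupoid_correspondence =
  fixes G :: "'g tgroupoid" and X :: "('g, 'x) correspondence"
  assumes left: "left_action G (cspace X) (lanchor X) (lact X)"
    and right: "right_action G (cspace X) (ranchor X) (ract X)"
    and commuting: "commuting_actions G G (cspace X) (lanchor X) (lact X) (ranchor X) (ract X)"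
    and free: "\<lbrakk>x \<in> topspace (cspace X); g \<in> topspace (arrows G); ranchor X x = rng G g;
        ract X (x, g) = x\<rbrakk> \<Longrightarrow> g \<in> units G"
    and proper: "proper_map (fibre_product (cspace X) (ranchor X) (rng G) (arrows G))
      (prod_topology (cspace X) (cspace X)) (\<lambda>(x, g). (ract X (x, g), x))"
    and etale_ranchor: "local_homeomorphism (cspace X) (objects G) (ranchor X)"

definition orbit_of :: "'g tgroupoid \<Rightarrow> ('g, 'x) correspondence \<Rightarrow> 'x \<Rightarrow> 'x set" where
  "orbit_of G X x = {ract X (x, g) |g. g \<in> topspace (arrows G) \<and> ranchor X x = rng G g}"

definition orbit_space :: "'g tgroupoid \<Rightarrow> ('g, 'x) correspondence \<Rightarrow> 'x set topology" where
  "orbit_space G X = quotient_topology (cspace X) (orbit_of G X)"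

text \<open>The map \<open>X/G \<rightarrow> G\<^sup>0\<close> induced by the left anchor map, which is constant on orbits.\<close>

definition orbit_lanchor :: "('g, 'x) correspondence \<Rightarrow> 'x set \<Rightarrow> 'g" where
  "orbit_lanchor X C = the_elem (lanchor X ` C)"

definition regular_on :: "'g tgroupoid \<Rightarrow> ('g, 'x) correspondence \<Rightarrow> 'g set \<Rightarrow> bool" where
  "regular_on G X R \<longleftrightarrow>
     (let P = {C \<in> topspace (orbit_space G X). orbit_lanchor X C \<in> R} in
        proper_map (subtopology (orbit_space G X) P) (subtopology (objects G) R) (orbit_lanchor X) \<and>
        orbit_lanchor X ` P = R)"


section \<open>Actions of a correspondence\<close>

definition corr_domain :: "('g, 'x) correspondence \<Rightarrow> ('y \<Rightarrow> 'g) \<Rightarrow> 'y topology \<Rightarrow> ('x \<times> 'y) topology" where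
  "corr_domain X a Y = fibre_product (cspace X) (ranchor X) a Y"

locale corr_action =
  fixes G :: "'g tgroupoid" and X :: "('g, 'x) correspondence" and R :: "'g set"
    and Y :: "'y topology"
    and a :: "'y \<Rightarrow> 'g" and m :: "'g \<times> 'y \<Rightarrow> 'y" and n :: "'x \<times> 'y \<Rightarrow> 'y"
  assumes groupoid_act: "left_action G Y a m"
    and continuous_mult: "continuous_map (corr_domain X a Y) Y n"
    and open_mult: "open_map (corr_domain X a Y) Y n"
    and anchor_mult: "\<lbrakk>x \<in> topspace (cspace X); y \<in> topspace Y; ranchor X x = a y\<rbrakk>
      \<Longrightarrow> a (n (x, y)) = lanchor X x"
    and act_mult: "\<lbrakk>g \<in> topspace (arrows G); x \<in> topspace (cspace X); y \<in> topspace Y;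
        src G g = lanchor X x; ranchor X x = a y\<rbrakk>
      \<Longrightarrow> m (g, n (x, y)) = n (lact X (g, x), y)"
    and mult_eq_iff: "\<lbrakk>x \<in> topspace (cspace X); y \<in> topspace Y; ranchor X x = a y;
        x' \<in> topspace (cspace X); y' \<in> topspace Y; ranchor X x' = a y'\<rbrakk>
      \<Longrightarrow> n (x, y) = n (x', y') \<longleftrightarrow>
        (\<exists>g \<in> topspace (arrows G). rng G g = ranchor X x \<and> src G g = a y' \<and>
           x' = ract X (x, g) \<and> y = m (g, y'))"
    and covers: "{y \<in> topspace Y. a y \<in> R} \<subseteq> n ` topspace (corr_domain X a Y)"
    and closed: "compactin (orbit_space G X) K \<Longrightarrow>
      closedin Y {n (x, y) |x y. (x, y) \<in> topspace (corr_domain X a Y) \<and> orbit_of G X x \<in> K}"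

type_synonym ('g, 'x, 'y) corr_act = "('y \<Rightarrow> 'g) \<times> ('g \<times> 'y \<Rightarrow> 'y) \<times> ('x \<times> 'y \<Rightarrow> 'y)"

definition corr_actions :: "'g tgroupoid \<Rightarrow> ('g, 'x) correspondence \<Rightarrow> 'g set \<Rightarrow> 'y topology \<Rightarrow>
    ('g, 'x, 'y) corr_act set" where
  "corr_actions G X R Y = {(a, m, n). corr_action G X R Y a m n \<and> a \<in> extensional (topspace Y) \<and>
     m \<in> extensional (topspace (fibre_product (arrows G) (src G) a Y)) \<and>
     n \<in> extensional (topspace (corr_domain X a Y))}"

definition corr_equivariant :: "'g tgroupoid \<Rightarrow> ('g, 'x) correspondence \<Rightarrow> 'y topology \<Rightarrow> 'z topology \<Rightarrow>
    ('g, 'x, 'y) corr_act \<Rightarrow> ('g, 'x, 'z) corr_act \<Rightarrow> ('y \<Rightarrow> 'z) \<Rightarrow> bool" where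
  "corr_equivariant G X Y Z = (\<lambda>(a, m, n) (b, m', n') \<phi>.
     groupoid_equivariant G Y (a, m) (b, m') \<phi> \<and>
     (\<forall>x \<in> topspace (cspace X). \<forall>y \<in> topspace Y. ranchor X x = a y \<longrightarrow> \<phi> (n (x, y)) = n' (x, \<phi> y)) \<and>
     {y \<in> topspace Y. \<phi> y \<in> n' ` topspace (corr_domain X b Z)} = n ` topspace (corr_domain X a Y))"


section \<open>Groupoid models\<close>

type_synonym ('g, 'x, 'm, 'y) act_bij =
  "'y topology \<Rightarrow> ('g, 'x, 'y) corr_act \<Rightarrow> ('y \<Rightarrow> 'm) \<times> ('m \<times> 'y \<Rightarrow> 'y)"

definition action_bijections :: "'g tgroupoid \<Rightarrow> ('g, 'x) correspondence \<Rightarrow> 'g set \<Rightarrow> 'm tgroupoid \<Rightarrow>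
    ('g, 'x, 'm, 'y) act_bij \<Rightarrow> bool" where
  "action_bijections G X R M \<Phi> \<longleftrightarrow>
     (\<forall>Y. bij_betw (\<Phi> Y) (corr_actions G X R Y) (groupoid_actions M Y))"

definition natural_bijections :: "'g tgroupoid \<Rightarrow> ('g, 'x) correspondence \<Rightarrow> 'g set \<Rightarrow> 'm tgroupoid \<Rightarrow>
    ('g, 'x, 'm, 'y) act_bij \<Rightarrow> ('g, 'x, 'm, 'z) act_bij \<Rightarrow> bool" where
  "natural_bijections G X R M \<Phi> \<Psi> \<longleftrightarrow>
     (\<forall>Y Z. \<forall>\<alpha> \<in> corr_actions G X R Y. \<forall>\<beta> \<in> corr_actions G X R Z. \<forall>\<phi>. continuous_map Y Z \<phi> \<longrightarrow>
        (corr_equivariant G X Y Z \<alpha> \<beta> \<phi> \<longleftrightarrow> groupoid_equivariant M Y (\<Phi> Y \<alpha>) (\<Psi> Z \<beta>) \<phi>))"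

text \<open>A groupoid model comes with bijections for all topological spaces.  A HOL formula
  cannot quantify over types, so the bijections are given on all topologies on two types:
  \<open>\<Phi>\<close> on the type \<open>'y\<close> of the space of interest and \<open>\<Psi>\<close> on an auxiliary type \<open>'z\<close>, to be chosen
  large enough for auxiliary spaces such as the object space of the model.  Naturality is required
  within and across both types.  As a hypothesis this is weaker than the same condition on all
  spaces.\<close>

definition groupoid_model :: "'g tgroupoid \<Rightarrow> ('g, 'x) correspondence \<Rightarrow> 'g set \<Rightarrow> 'm tgroupoid \<Rightarrow>
    ('g, 'x, 'm, 'y) act_bij \<Rightarrow> ('g, 'x, 'm, 'z) act_bij \<Rightarrow> bool" where
  "groupoid_model G X R M \<Phi> \<Psi> \<longleftrightarrow>
     etale_groupoid M \<and>
     action_bijections G X R M \<Phi> \<and> action_bijections G X R M \<Psi> \<and>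
     natural_bijections G X R M \<Phi> \<Phi> \<and> natural_bijections G X R M \<Phi> \<Psi> \<and>
     natural_bijections G X R M \<Psi> \<Phi> \<and> natural_bijections G X R M \<Psi> \<Psi>"

text \<open>The auxiliary type: it has room for spaces of (equivalence classes of) filters, characters or
  finite and infinite paths built from the given data.\<close>

type_synonym ('g, 'x, 'm, 'h) universe = "('g + 'x + 'm + 'h) list set set"


section \<open>Actors\<close>

definition actors :: "'m tgroupoid \<Rightarrow> 'h tgroupoid \<Rightarrow> (('h \<Rightarrow> 'm) \<times> ('m \<times> 'h \<Rightarrow> 'h)) set" where
  "actors M H = {(a, m) \<in> groupoid_actions M (arrows H).
     commuting_actions M H (arrows H) a m (src H) (\<lambda>(h, k). gcomp H h k)}"

text \<open>The homeomorphism \<open>H/H \<cong> H\<^sup>0\<close> sends the orbit of a unit to that unit, so the map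
  \<open>H\<^sup>0 \<rightarrow> M\<^sup>0\<close> induced by the anchor map is its restriction to units.\<close>

definition proper_actor :: "'m tgroupoid \<Rightarrow> 'h tgroupoid \<Rightarrow> ('h \<Rightarrow> 'm) \<times> ('m \<times> 'h \<Rightarrow> 'h) \<Rightarrow> bool" where
  "proper_actor M H \<beta> \<longleftrightarrow> \<beta> \<in> actors M H \<and> proper_map (objects H) (objects M) (fst \<beta>)"

locale actor_data =
  fixes G :: "'g tgroupoid" and X :: "('g, 'x) correspondence" and H :: "'h tgroupoid"
    and \<rho> :: "'h \<Rightarrow> 'g" and \<mu>G :: "'g \<times> 'h \<Rightarrow> 'h" and \<mu>X :: "'x \<times> 'h \<Rightarrow> 'h"
  assumes continuous_rho: "continuous_map (objects H) (objects G) \<rho>"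
    and continuous_muG: "continuous_map (fibre_product (arrows G) (src G) \<rho> (objects H)) (arrows H) \<mu>G"
    and continuous_muX: "continuous_map (corr_domain X \<rho> (objects H)) (arrows H) \<mu>X"
    and open_muX: "open_map (corr_domain X \<rho> (objects H)) (arrows H) \<mu>X"
    and src_muG: "\<lbrakk>g \<in> topspace (arrows G); \<omega> \<in> units H; src G g = \<rho> \<omega>\<rbrakk>
      \<Longrightarrow> src H (\<mu>G (g, \<omega>)) = \<omega>"
    and src_muX: "\<lbrakk>x \<in> topspace (cspace X); \<omega> \<in> units H; ranchor X x = \<rho> \<omega>\<rbrakk>
      \<Longrightarrow> src H (\<mu>X (x, \<omega>)) = \<omega>"
    and rng_muG: "\<lbrakk>g \<in> topspace (arrows G); \<omega> \<in> units H; src G g = \<rho> \<omega>\<rbrakk>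
      \<Longrightarrow> \<rho> (rng H (\<mu>G (g, \<omega>))) = rng G g"
    and rng_muX: "\<lbrakk>x \<in> topspace (cspace X); \<omega> \<in> units H; ranchor X x = \<rho> \<omega>\<rbrakk>
      \<Longrightarrow> \<rho> (rng H (\<mu>X (x, \<omega>))) = lanchor X x"

definition actor_mult :: "'h tgroupoid \<Rightarrow> ('z \<times> 'h \<Rightarrow> 'h) \<Rightarrow> 'z \<Rightarrow> 'h \<Rightarrow> 'h" where
  "actor_mult H \<mu> z h = gcomp H (\<mu> (z, rng H h)) h"

definition induced_action :: "'g tgroupoid \<Rightarrow> ('g, 'x) correspondence \<Rightarrow> 'h tgroupoid \<Rightarrow>
    ('h \<Rightarrow> 'g) \<Rightarrow> ('g \<times> 'h \<Rightarrow> 'h) \<Rightarrow> ('x \<times> 'h \<Rightarrow> 'h) \<Rightarrow> ('g, 'x, 'h) corr_act" where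
  "induced_action G X H \<rho> \<mu>G \<mu>X =
     (restrict (\<rho> \<circ> rng H) (topspace (arrows H)),
      restrict (\<lambda>(g, h). actor_mult H \<mu>G g h)
        (topspace (fibre_product (arrows G) (src G) (\<rho> \<circ> rng H) (arrows H))),
      restrict (\<lambda>(x, h). actor_mult H \<mu>X x h) (topspace (corr_domain X (\<rho> \<circ> rng H) (arrows H))))"

definition defines_actor :: "'g tgroupoid \<Rightarrow> ('g, 'x) correspondence \<Rightarrow> 'g set \<Rightarrow> 'm tgroupoid \<Rightarrow>
    ('g, 'x, 'm, 'h) act_bij \<Rightarrow> 'h tgroupoid \<Rightarrow>
    ('h \<Rightarrow> 'g) \<Rightarrow> ('g \<times> 'h \<Rightarrow> 'h) \<Rightarrow> ('x \<times> 'h \<Rightarrow> 'h) \<Rightarrow> bool" where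
  "defines_actor G X R M \<Phi> H \<rho> \<mu>G \<mu>X \<longleftrightarrow>
     induced_action G X H \<rho> \<mu>G \<mu>X \<in> corr_actions G X R (arrows H) \<and>
     \<Phi> (arrows H) (induced_action G X H \<rho> \<mu>G \<mu>X) \<in> actors M H"

definition actor_associative :: "'g tgroupoid \<Rightarrow> ('g, 'x) correspondence \<Rightarrow> 'h tgroupoid \<Rightarrow>
    ('h \<Rightarrow> 'g) \<Rightarrow> ('g \<times> 'h \<Rightarrow> 'h) \<Rightarrow> ('x \<times> 'h \<Rightarrow> 'h) \<Rightarrow> bool" where
  "actor_associative G X H \<rho> \<mu>G \<mu>X \<longleftrightarrow>
     (\<forall>g\<^sub>1 \<in> topspace (arrows G). \<forall>g\<^sub>2 \<in> topspace (arrows G). \<forall>h \<in> topspace (arrows H).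
        src G g\<^sub>1 = rng G g\<^sub>2 \<and> src G g\<^sub>2 = \<rho> (rng H h) \<longrightarrow>
        actor_mult H \<mu>G g\<^sub>1 (actor_mult H \<mu>G g\<^sub>2 h) = actor_mult H \<mu>G (gcomp G g\<^sub>1 g\<^sub>2) h) \<and>
     (\<forall>g \<in> topspace (arrows G). \<forall>x \<in> topspace (cspace X). \<forall>h \<in> topspace (arrows H).
        src G g = lanchor X x \<and> ranchor X x = \<rho> (rng H h) \<longrightarrow>
        actor_mult H \<mu>G g (actor_mult H \<mu>X x h) = actor_mult H \<mu>X (lact X (g, x)) h) \<and>
     (\<forall>x \<in> topspace (cspace X). \<forall>g \<in> topspace (arrows G). \<forall>h \<in> topspace (arrows H).
        ranchor X x = rng G g \<and> src G g = \<rho> (rng H h) \<longrightarrow>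
        actor_mult H \<mu>X x (actor_mult H \<mu>G g h) = actor_mult H \<mu>X (ract X (x, g)) h)"

definition actor_unital :: "'h tgroupoid \<Rightarrow> ('h \<Rightarrow> 'g) \<Rightarrow> ('g \<times> 'h \<Rightarrow> 'h) \<Rightarrow> bool" where
  "actor_unital H \<rho> \<mu>G \<longleftrightarrow> (\<forall>\<omega> \<in> units H. actor_mult H \<mu>G (\<rho> \<omega>) \<omega> = \<omega>)"

definition actor_cancellative :: "'g tgroupoid \<Rightarrow> ('g, 'x) correspondence \<Rightarrow> 'h tgroupoid \<Rightarrow>
    ('h \<Rightarrow> 'g) \<Rightarrow> ('g \<times> 'h \<Rightarrow> 'h) \<Rightarrow> ('x \<times> 'h \<Rightarrow> 'h) \<Rightarrow> bool" where
  "actor_cancellative G X H \<rho> \<mu>G \<mu>X \<longleftrightarrow>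
     (\<forall>x\<^sub>1 \<in> topspace (cspace X). \<forall>x\<^sub>2 \<in> topspace (cspace X).
      \<forall>y\<^sub>1 \<in> topspace (arrows H). \<forall>y\<^sub>2 \<in> topspace (arrows H).
        ranchor X x\<^sub>1 = \<rho> (rng H y\<^sub>1) \<and> ranchor X x\<^sub>2 = \<rho> (rng H y\<^sub>2) \<and>
        actor_mult H \<mu>X x\<^sub>1 y\<^sub>1 = actor_mult H \<mu>X x\<^sub>2 y\<^sub>2 \<longrightarrow>
        (\<exists>g \<in> topspace (arrows G). rng G g = ranchor X x\<^sub>1 \<and> src G g = \<rho> (rng H y\<^sub>2) \<and>
           x\<^sub>2 = ract X (x\<^sub>1, g) \<and> y\<^sub>1 = actor_mult H \<mu>G g y\<^sub>2))"

definition actor_covering :: "('g, 'x) correspondence \<Rightarrow> 'g set \<Rightarrow> 'h tgroupoid \<Rightarrow>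
    ('h \<Rightarrow> 'g) \<Rightarrow> ('x \<times> 'h \<Rightarrow> 'h) \<Rightarrow> bool" where
  "actor_covering X R H \<rho> \<mu>X \<longleftrightarrow>
     {\<omega> \<in> units H. \<rho> \<omega> \<in> R} \<subseteq> (rng H \<circ> \<mu>X) ` topspace (corr_domain X \<rho> (objects H))"

definition actor_closed :: "'g tgroupoid \<Rightarrow> ('g, 'x) correspondence \<Rightarrow> 'h tgroupoid \<Rightarrow>
    ('h \<Rightarrow> 'g) \<Rightarrow> ('x \<times> 'h \<Rightarrow> 'h) \<Rightarrow> bool" where
  "actor_closed G X H \<rho> \<mu>X \<longleftrightarrow>
     (\<forall>K. compactin (orbit_space G X) K \<longrightarrow>
        closedin (objects H) {rng H (actor_mult H \<mu>X x h) |x h.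
          x \<in> topspace (cspace X) \<and> h \<in> topspace (arrows H) \<and>
          orbit_of G X x \<in> K \<and> ranchor X x = \<rho> (rng H h)})"

end

theory Submission
  imports Defs
begin

text \<open>Write \<open>H\<^sub>v\<close> for the fibre of the source map of \<open>H\<close> over \<open>v\<close>.  Right translation by
  \<open>u \<in> H\<close> is an equivariant map \<open>H\<^sub>v \<rightarrow> H\<close> for \<open>v = r(u)\<close> with respect to one of the two kinds of
  actions exactly if it is so for the other kind, by naturality.  So an \<open>M\<close>-action on \<open>H\<close> commutes
  with right translations if and only if the corresponding \<open>(G, X, R)\<close>-action does, and the latter
  is determined by its restriction to units.

  The statement on proper actors rests on the properness of \<open>M\<^sup>0 \<rightarrow> G\<^sup>0\<close>.  The space
  \<open>M\<^sup>0\<close> carries the terminal \<open>(G, X, R)\<close>-action.  On the set of points of any action there is a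
  coarsest topology for which it still is an action.  For \<open>M\<^sup>0\<close> this is the original topology,
  because the discrete topology also gives an action and admits only one equivariant map to
  \<open>M\<^sup>0\<close>.  In the coarsest topology, the preimages of compact subsets of \<open>G\<^sup>0\<close> are compact provided
  all finite paths that end outside \<open>R\<close> and all infinite paths are realised by points; these points are
  images of a discrete action on the set of paths.\<close>

section \<open>Fibre products and local homeomorphisms\<close>

text \<open>The obstacle is that \<open>M\<close> is known only through its natural bijections, with
  no formula for its arrows or objects, so each statement about \<open>M\<close> is turned into one
  about equivariant maps. For properness, let \<open>f\<close> be the anchor map H^0 -> M^0 of the
  actor and \<open>r\<close> the map M^0 -> G^0. Then \<rho> is \<open>r\<close> after
  \<open>f\<close>; once \<open>r\<close> is proper, \<rho> is proper exactly if \<open>f\<close>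
  is. Compactness over a compact subset of G^0 is proved in the coarse topology and carried to M^0
  by the identity map. That map is continuous because terminality supplies some continuous
  equivariant map, which can only be the identity on points. The coarse topology is built as an
  increasing union of levels. Control of a product \<open>n (x, y)\<close> at one level takes
  control of \<open>y\<close> only one level lower, so a basic neighbourhood of a point given by an
  infinite path depends on finitely many letters. This is what makes a path of successive letters a
  cluster point.\<close>

lemma topspace_fibre_product:
  "topspace (fibre_product A p q B) = {(a, b). a \<in> topspace A \<and> b \<in> topspace B \<and> p a = q b}"
  by (auto simp: fibre_product_def)

lemma topspace_corr_domain:
  "topspace (corr_domain X a Y) =
     {(x, y). x \<in> topspace (cspace X) \<and> y \<in> topspace Y \<and> ranchor X x = a y}"
  by (auto simp: corr_domain_def topspace_fibre_product)

lemma openin_fibre_product_iff: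
  "openin (fibre_product A p q B) S \<longleftrightarrow>
     S \<subseteq> topspace (fibre_product A p q B) \<and>
     (\<forall>a b. (a, b) \<in> S \<longrightarrow> (\<exists>V W. openin A V \<and> openin B W \<and> a \<in> V \<and> b \<in> W \<and>
        {(a', b'). a' \<in> V \<and> b' \<in> W \<and> p a' = q b'} \<subseteq> S))"
  (is "?L \<longleftrightarrow> ?R")
proof
  assume ?L
  then obtain T where T: "openin (prod_topology A B) T" "S = T \<inter> {(a, b). p a = q b}"
    by (auto simp: fibre_product_def openin_subtopology)
  show ?R
  proof (intro conjI allI impI)
    show "S \<subseteq> topspace (fibre_product A p q B)" using \<open>?L\<close> by (rule openin_subset)
    fix a b assume "(a, b) \<in> S"
    then have "(a, b) \<in> T" using T by auto
    from T(1)[unfolded openin_prod_topology_alt, rule_format, OF this]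
    obtain V W where "openin A V" "openin B W" "a \<in> V" "b \<in> W" "V \<times> W \<subseteq> T"
      by metis
    moreover have "{(a', b'). a' \<in> V \<and> b' \<in> W \<and> p a' = q b'} \<subseteq> S"
      unfolding T(2) using \<open>V \<times> W \<subseteq> T\<close> by blast
    ultimately show "\<exists>V W. openin A V \<and> openin B W \<and> a \<in> V \<and> b \<in> W \<and>
        {(a', b'). a' \<in> V \<and> b' \<in> W \<and> p a' = q b'} \<subseteq> S"
      by blast
  qed
next
  assume R: ?R
  define P where "P = {(V, W). openin A V \<and> openin B W \<and>
        {(a', b'). a' \<in> V \<and> b' \<in> W \<and> p a' = q b'} \<subseteq> S}"
  have "openin (prod_topology A B) (\<Union>(V, W)\<in>P. V \<times> W)"
    by (rule openin_Union) (auto simp: P_def openin_prod_Times_iff)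
  moreover have "S = (\<Union>(V, W)\<in>P. V \<times> W) \<inter> {(a, b). p a = q b}"
  proof
    show "S \<subseteq> (\<Union>(V, W)\<in>P. V \<times> W) \<inter> {(a, b). p a = q b}"
    proof clarify
      fix a b assume ab: "(a, b) \<in> S"
      then obtain V W where "(V, W) \<in> P" "a \<in> V" "b \<in> W" using R unfolding P_def by blast
      moreover have "p a = q b" using R ab by (auto simp: topspace_fibre_product)
      ultimately show "(a, b) \<in> (\<Union>(V, W)\<in>P. V \<times> W) \<inter> {(a, b). p a = q b}" by auto
    qed
  qed (auto simp: P_def)
  ultimately show ?L unfolding fibre_product_def openin_subtopology by blast
qed

lemma openin_fibre_product_preimageI:
  assumes "\<And>a b. \<lbrakk>a \<in> topspace A; b \<in> topspace B; p a = q b; f (a, b) \<in> U\<rbrakk> \<Longrightarrow>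
      \<exists>V W. openin A V \<and> openin B W \<and> a \<in> V \<and> b \<in> W \<and>
        (\<forall>a' b'. a' \<in> V \<longrightarrow> b' \<in> W \<longrightarrow> p a' = q b' \<longrightarrow> f (a', b') \<in> U)"
  shows "openin (fibre_product A p q B) {x \<in> topspace (fibre_product A p q B). f x \<in> U}"
  unfolding openin_fibre_product_iff
proof (intro conjI allI impI)
  fix a b assume "(a, b) \<in> {x \<in> topspace (fibre_product A p q B). f x \<in> U}"
  then obtain V W where VW: "openin A V" "openin B W" "a \<in> V" "b \<in> W"
    "\<forall>a' b'. a' \<in> V \<longrightarrow> b' \<in> W \<longrightarrow> p a' = q b' \<longrightarrow> f (a', b') \<in> U"
    using assms[of a b] by (auto simp: topspace_fibre_product)
  moreover have "V \<subseteq> topspace A" "W \<subseteq> topspace B"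
    using openin_subset[OF VW(1)] openin_subset[OF VW(2)] by auto
  ultimately show "\<exists>V W. openin A V \<and> openin B W \<and> a \<in> V \<and> b \<in> W \<and>
      {(a', b'). a' \<in> V \<and> b' \<in> W \<and> p a' = q b'} \<subseteq> {x \<in> topspace (fibre_product A p q B). f x \<in> U}"
    by (intro exI[of _ V] exI[of _ W]) (auto simp: topspace_fibre_product)
qed auto

lemma continuous_map_fibre_productI:
  assumes "\<And>a b. \<lbrakk>a \<in> topspace A; b \<in> topspace B; p a = q b\<rbrakk> \<Longrightarrow> f (a, b) \<in> topspace C"
    and "\<And>a b U. \<lbrakk>a \<in> topspace A; b \<in> topspace B; p a = q b; openin C U; f (a, b) \<in> U\<rbrakk> \<Longrightarrow>
      \<exists>V W. openin A V \<and> openin B W \<and> a \<in> V \<and> b \<in> W \<and>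
        (\<forall>a' b'. a' \<in> V \<longrightarrow> b' \<in> W \<longrightarrow> p a' = q b' \<longrightarrow> f (a', b') \<in> U)"
  shows "continuous_map (fibre_product A p q B) C f"
  unfolding continuous_map_def
proof (intro conjI allI impI)
  show "f \<in> topspace (fibre_product A p q B) \<rightarrow> topspace C"
    using assms(1) by (auto simp: topspace_fibre_product)
qed (rule openin_fibre_product_preimageI, rule assms(2))

lemma continuous_map_fibre_productD:
  assumes "continuous_map (fibre_product A p q B) C f"
    and "a \<in> topspace A" "b \<in> topspace B" "p a = q b" "openin C U" "f (a, b) \<in> U"
  obtains V W where "openin A V" "openin B W" "a \<in> V" "b \<in> W"
    "\<And>a' b'. \<lbrakk>a' \<in> V; b' \<in> W; p a' = q b'\<rbrakk> \<Longrightarrow> f (a', b') \<in> U"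
proof -
  have "openin (fibre_product A p q B) {x \<in> topspace (fibre_product A p q B). f x \<in> U}"
    using assms by (simp add: continuous_map_def)
  moreover have "(a, b) \<in> {x \<in> topspace (fibre_product A p q B). f x \<in> U}"
    using assms by (simp add: topspace_fibre_product)
  ultimately obtain V W where VW: "openin A V" "openin B W" "a \<in> V" "b \<in> W"
      "{(a', b'). a' \<in> V \<and> b' \<in> W \<and> p a' = q b'} \<subseteq> {x \<in> topspace (fibre_product A p q B). f x \<in> U}"
    unfolding openin_fibre_product_iff by blast
  show thesis
  proof (rule that[OF VW(1-4)])
    fix a' b' assume "a' \<in> V" "b' \<in> W" "p a' = q b'"
    then show "f (a', b') \<in> U" using VW(5) by blast
  qed
qed

text \<open>A subbasis suffices on the target side. This form suits \<open>refine\<close>, whose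
  topology is given by generators.\<close>

lemma continuous_map_fibre_product_generatedI:
  assumes "\<And>a b. \<lbrakk>a \<in> topspace A; b \<in> topspace B; p a = q b\<rbrakk> \<Longrightarrow> f (a, b) \<in> \<Union>\<S>"
    and "\<And>a b U. \<lbrakk>a \<in> topspace A; b \<in> topspace B; p a = q b; U \<in> \<S>; f (a, b) \<in> U\<rbrakk> \<Longrightarrow>
      \<exists>V W. openin A V \<and> openin B W \<and> a \<in> V \<and> b \<in> W \<and>
        (\<forall>a' b'. a' \<in> V \<longrightarrow> b' \<in> W \<longrightarrow> p a' = q b' \<longrightarrow> f (a', b') \<in> U)"
  shows "continuous_map (fibre_product A p q B) (topology_generated_by \<S>) f"
proof (rule continuous_on_generated_topo)
  show "f ` topspace (fibre_product A p q B) \<subseteq> \<Union>\<S>"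
    using assms(1) by (auto simp: topspace_fibre_product)
  fix U assume "U \<in> \<S>"
  then have "openin (fibre_product A p q B) {x \<in> topspace (fibre_product A p q B). f x \<in> U}"
    by (intro openin_fibre_product_preimageI assms(2))
  moreover have "{x \<in> topspace (fibre_product A p q B). f x \<in> U} = f -` U \<inter> topspace (fibre_product A p q B)"
    by auto
  ultimately show "openin (fibre_product A p q B) (f -` U \<inter> topspace (fibre_product A p q B))" by simp
qed

text \<open>Images commute with unions, so boxes suffice. For a multiplication map the image of a
  box is the product set of its sides, and openness is used in this form later.\<close>

lemma open_map_fibre_product_iff:
  "open_map (fibre_product A p q B) C f \<longleftrightarrow>
     (\<forall>V W. openin A V \<longrightarrow> openin B W \<longrightarrow> openin C {f (a, b) |a b. a \<in> V \<and> b \<in> W \<and> p a = q b})"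
  (is "?L \<longleftrightarrow> ?R")
proof
  assume L: ?L
  show ?R
  proof (intro allI impI)
    fix V W assume VW: "openin A V" "openin B W"
    have "openin (fibre_product A p q B) {(a, b). a \<in> V \<and> b \<in> W \<and> p a = q b}" (is "openin _ ?S")
      unfolding openin_fibre_product_iff
      using VW openin_subset[OF VW(1)] openin_subset[OF VW(2)]
      by (auto simp: topspace_fibre_product intro!: exI[of _ V] exI[of _ W])
    then have "openin C (f ` ?S)" using L unfolding open_map_def by (elim allE impE)
    moreover have "f ` ?S = {f (a, b) |a b. a \<in> V \<and> b \<in> W \<and> p a = q b}" by auto
    ultimately show "openin C {f (a, b) |a b. a \<in> V \<and> b \<in> W \<and> p a = q b}"
      by (rule back_subst)
  qed
next
  assume R: ?R
  show ?L unfolding open_map_def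
  proof (intro allI impI)
    fix S assume S: "openin (fibre_product A p q B) S"
    show "openin C (f ` S)"
    proof (subst openin_subopen, intro ballI)
      fix c assume "c \<in> f ` S"
      then obtain a b where ab: "(a, b) \<in> S" "c = f (a, b)" by auto
      then obtain V W where VW: "openin A V" "openin B W" "a \<in> V" "b \<in> W"
        "{(a', b'). a' \<in> V \<and> b' \<in> W \<and> p a' = q b'} \<subseteq> S"
        using S unfolding openin_fibre_product_iff by blast
      have "p a = q b" using S ab openin_subset by (fastforce simp: topspace_fibre_product)
      then have "c \<in> {f (a, b) |a b. a \<in> V \<and> b \<in> W \<and> p a = q b}" using VW ab by blast
      moreover have "{f (a, b) |a b. a \<in> V \<and> b \<in> W \<and> p a = q b} \<subseteq> f ` S" using VW(5)
        by (auto intro!: imageI)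
      ultimately show "\<exists>T. openin C T \<and> c \<in> T \<and> T \<subseteq> f ` S"
        using R[rule_format, OF VW(1,2)] by (intro exI conjI)
    qed
  qed
qed

text \<open>Members of \<open>groupoid_actions\<close> and \<open>corr_actions\<close> have
  extensional anchor maps, so restricted anchors turn up in the domains of the multiplication
  maps.\<close>

lemma fibre_product_restrict:
  "fibre_product A p (restrict q (topspace B)) B = fibre_product A p q B"
proof -
  have "topspace (prod_topology A B) \<inter> {(a, b). p a = restrict q (topspace B) b} =
        topspace (prod_topology A B) \<inter> {(a, b). p a = q b}" by auto
  then show ?thesis unfolding fibre_product_def by (metis subtopology_restrict)
qed

lemma fibre_product_cong:
  assumes "\<And>b. b \<in> topspace B \<Longrightarrow> q b = q' b"
  shows "fibre_product A p q B = fibre_product A p q' B"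
proof -
  have "restrict q (topspace B) = restrict q' (topspace B)" using assms by (auto simp: restrict_def)
  then show ?thesis by (metis fibre_product_restrict)
qed

section \<open>Local homeomorphisms, separation and compactness\<close>

lemma local_homeomorphism_nhds:
  assumes f: "local_homeomorphism A B f" and x: "x \<in> topspace A"
  obtains U where "openin A U" "x \<in> U" "openin B (f ` U)" "inj_on f U"
    "homeomorphic_map (subtopology A U) (subtopology B (f ` U)) f"
proof -
  obtain U where U: "openin A U" "x \<in> U" "openin B (f ` U)"
    "homeomorphic_map (subtopology A U) (subtopology B (f ` U)) f"
    using assms unfolding local_homeomorphism_def by blast
  moreover have "topspace (subtopology A U) = U" using U openin_subset by fastforce
  ultimately show thesis using that unfolding homeomorphic_map_def by metis
qed

lemma local_homeomorphism_continuous: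
  assumes f: "local_homeomorphism A B f"
  shows "continuous_map A B f"
  unfolding continuous_map_def
proof (intro conjI allI impI)
  show "f \<in> topspace A \<rightarrow> topspace B"
  proof
    fix x assume "x \<in> topspace A"
    then obtain U where "openin A U" "x \<in> U" "openin B (f ` U)" using local_homeomorphism_nhds[OF f] by metis
    then show "f x \<in> topspace B" using openin_subset by fastforce
  qed
  fix W assume W: "openin B W"
  show "openin A {x \<in> topspace A. f x \<in> W}"
  proof (subst openin_subopen, intro ballI)
    fix x assume x: "x \<in> {x \<in> topspace A. f x \<in> W}"
    then obtain U where U: "openin A U" "x \<in> U"
      "homeomorphic_map (subtopology A U) (subtopology B (f ` U)) f"
      using local_homeomorphism_nhds[OF f] by (metis (no_types, lifting) mem_Collect_eq)
    have "continuous_map (subtopology A U) B f"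
      using U(3) homeomorphic_imp_continuous_map continuous_map_into_fulltopology by blast
    then have "openin (subtopology A U) {x \<in> topspace (subtopology A U). f x \<in> W}"
      using W by (simp add: continuous_map_def)
    then have "openin A {x \<in> topspace (subtopology A U). f x \<in> W}"
      using U(1) openin_trans_full by blast
    then show "\<exists>T. openin A T \<and> x \<in> T \<and> T \<subseteq> {x \<in> topspace A. f x \<in> W}"
      using x U by (intro exI[of _ "{x \<in> topspace (subtopology A U). f x \<in> W}"]) auto
  qed
qed

lemma local_homeomorphism_open:
  assumes f: "local_homeomorphism A B f"
  shows "open_map A B f"
  unfolding open_map_def
proof (intro allI impI)
  fix V assume V: "openin A V"
  show "openin B (f ` V)"
  proof (subst openin_subopen, intro ballI)
    fix y assume "y \<in> f ` V"
    then obtain x where x: "x \<in> V" "y = f x" by auto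
    then have "x \<in> topspace A" using V openin_subset by blast
    then obtain U where U: "openin A U" "x \<in> U" "openin B (f ` U)"
      "homeomorphic_map (subtopology A U) (subtopology B (f ` U)) f"
      using local_homeomorphism_nhds[OF f] by metis
    have "openin (subtopology A U) (U \<inter> V)" using V by (simp add: openin_subtopology_Int2)
    then have "openin (subtopology B (f ` U)) (f ` (U \<inter> V))"
      using U(4) homeomorphic_imp_open_map unfolding open_map_def by blast
    then have "openin B (f ` (U \<inter> V))" using U(3) openin_trans_full by blast
    then show "\<exists>T. openin B T \<and> y \<in> T \<and> T \<subseteq> f ` V"
      using x U by (intro exI[of _ "f ` (U \<inter> V)"]) auto
  qed
qed

text \<open>Near each point \<open>A\<close> is a copy of an open piece of the locally compact
  Hausdorff space \<open>B\<close>. Distinct points of \<open>A\<close> may still be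
  inseparable.\<close>

lemma local_homeomorphism_locally_compact:
  assumes f: "local_homeomorphism A B f" and B: "Hausdorff_space B" "locally_compact_space B"
  shows "locally_compact_space A"
  unfolding locally_compact_space_def
proof
  fix x assume x: "x \<in> topspace A"
  obtain U where U: "openin A U" "x \<in> U" "openin B (f ` U)"
      "homeomorphic_map (subtopology A U) (subtopology B (f ` U)) f"
    using local_homeomorphism_nhds[OF f x] by metis
  have "locally_compact_space (subtopology A U)"
    using U B locally_compact_space_open_subset homeomorphic_locally_compact_space
      homeomorphic_map_imp_homeomorphic_space by blast
  moreover have "x \<in> topspace (subtopology A U)" using x U by simp
  ultimately obtain V K where "openin (subtopology A U) V" "compactin (subtopology A U) K" "x \<in> V" "V \<subseteq> K"
    unfolding locally_compact_space_def by blast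
  then show "\<exists>V K. openin A V \<and> compactin A K \<and> x \<in> V \<and> V \<subseteq> K"
    using U(1) openin_trans_full compactin_subtopology by metis
qed

lemma Hausdorff_separate:
  assumes "Hausdorff_space B" "x \<in> topspace B" "y \<in> topspace B" "x \<noteq> y"
  obtains U V where "openin B U" "openin B V" "x \<in> U" "y \<in> V" "U \<inter> V = {}"
proof -
  have "\<exists>U V. openin B U \<and> openin B V \<and> x \<in> U \<and> y \<in> V \<and> disjnt U V"
    using assms unfolding Hausdorff_space_def by simp
  then show thesis using that unfolding disjnt_def by metis
qed

text \<open>Arrow spaces may be non-Hausdorff, so only the common target is assumed to be Hausdorff.\<close>

lemma compactin_fibre_product:
  assumes C: "Hausdorff_space C" and p: "continuous_map A C p" and q: "continuous_map B C q"
    and K: "compactin A K" and L: "compactin B L"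
  shows "compactin (fibre_product A p q B) {(a, b). a \<in> K \<and> b \<in> L \<and> p a = q b}"
proof -
  have KL: "compactin (prod_topology A B) (K \<times> L)" using K L by (simp add: compactin_Times)
  have "closedin (prod_topology A B) {z \<in> topspace (prod_topology A B). (p \<circ> fst) z = (q \<circ> snd) z}"
    using C by (rule closedin_continuous_maps_eq)
      (use p q continuous_map_compose continuous_map_fst continuous_map_snd in blast)+
  then have "compactin (prod_topology A B)
      ({z \<in> topspace (prod_topology A B). (p \<circ> fst) z = (q \<circ> snd) z} \<inter> (K \<times> L))"
    using KL closed_Int_compactin by blast
  moreover have "{z \<in> topspace (prod_topology A B). (p \<circ> fst) z = (q \<circ> snd) z} \<inter> (K \<times> L) =
      {(a, b). a \<in> K \<and> b \<in> L \<and> p a = q b}"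
    using compactin_subset_topspace[OF K] compactin_subset_topspace[OF L] by auto
  ultimately show ?thesis unfolding fibre_product_def by (auto simp: compactin_subtopology)
qed


section \<open>Etale groupoids and correspondences\<close>

context etale_groupoid
begin

lemma topspace_objects [simp]: "topspace (objects G) = units G"
  by (auto simp: objects_def units_def)

lemma unitI: "\<lbrakk>g \<in> topspace (arrows G); src G g = g\<rbrakk> \<Longrightarrow> g \<in> units G"
  by (simp add: units_def)

lemma units_arrow: "u \<in> units G \<Longrightarrow> u \<in> topspace (arrows G)"
  by (simp add: units_def)

lemma src_of_unit: "u \<in> units G \<Longrightarrow> src G u = u"
  by (simp add: units_def)

lemma continuous_src: "continuous_map (arrows G) (objects G) (src G)"
  and continuous_rng: "continuous_map (arrows G) (objects G) (rng G)"
  and open_src: "open_map (arrows G) (objects G) (src G)"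
  and open_rng: "open_map (arrows G) (objects G) (rng G)"
  using etale_src etale_rng local_homeomorphism_continuous local_homeomorphism_open by blast+

lemmas [simp] = units_arrow src_of_unit

text \<open>Where \<open>src\<close> is injective on an open set \<open>U\<close>, an arrow in
  \<open>U\<close> whose source also lies in \<open>U\<close> equals its source, because both have
  the same image under \<open>src\<close>.\<close>

lemma openin_units: "openin (arrows G) (units G)"
proof (subst openin_subopen, intro ballI)
  fix u assume u: "u \<in> units G"
  obtain U where U: "openin (arrows G) U" "u \<in> U" "inj_on (src G) U"
    using local_homeomorphism_nhds[OF etale_src] u units_arrow by metis
  define W where "W = {g \<in> topspace (arrows G). src G g \<in> units G \<inter> U}"
  have "openin (objects G) (units G \<inter> U)"
    using U(1) by (simp add: objects_def openin_subtopology_Int2)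
  then have "openin (arrows G) W"
    using continuous_src unfolding continuous_map_def W_def by blast
  then have "openin (arrows G) (U \<inter> W)" using U(1) by blast
  moreover have "u \<in> U \<inter> W" using u U by (simp add: W_def)
  moreover have "U \<inter> W \<subseteq> units G"
  proof
    fix g assume g: "g \<in> U \<inter> W"
    then have "src G (src G g) = src G g" "src G g \<in> U" by (auto simp: W_def)
    then have "src G g = g" using U(3) g by (auto dest: inj_onD)
    then show "g \<in> units G" using g by (auto simp: W_def intro: unitI)
  qed
  ultimately show "\<exists>T. openin (arrows G) T \<and> u \<in> T \<and> T \<subseteq> units G" by blast
qed

lemma openin_objects_iff: "openin (objects G) U \<longleftrightarrow> openin (arrows G) U \<and> U \<subseteq> units G"
  unfolding objects_def using openin_units openin_open_subtopology by blast

lemma continuous_map_from_objects: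
  "continuous_map (arrows G) Z f \<Longrightarrow> continuous_map (objects G) Z f"
  unfolding objects_def by (rule continuous_map_from_subtopology)

lemma cancel_left':
  assumes "g \<in> topspace (arrows G)" "h \<in> topspace (arrows G)" "rng G g = rng G h"
  shows "gcomp G g (gcomp G (ginv G g) h) = h"
  using assms
  by (metis comp_assoc ginv_closed ginv_right left_unit rng_ginv src_ginv)

lemma cancel_right:
  assumes "g \<in> topspace (arrows G)" "h \<in> topspace (arrows G)" "src G g = rng G h"
  shows "gcomp G (gcomp G g h) (ginv G h) = g"
  using assms
  by (metis comp_assoc ginv_closed ginv_right right_unit rng_ginv)

lemma cancel_right':
  assumes "g \<in> topspace (arrows G)" "h \<in> topspace (arrows G)" "src G g = src G h"
  shows "gcomp G (gcomp G g (ginv G h)) h = g"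
  using assms
  by (metis comp_assoc ginv_closed ginv_left right_unit rng_ginv src_ginv)

lemma right_translation_continuous:
  assumes "u \<in> topspace (arrows G)"
  shows "continuous_map (subtopology (arrows G) {g. src G g = rng G u}) (arrows G) (\<lambda>g. gcomp G g u)"
proof -
  have "continuous_map (subtopology (arrows G) {g. src G g = rng G u})
      (fibre_product (arrows G) (src G) (rng G) (arrows G)) (\<lambda>g. (g, u))"
    unfolding fibre_product_def using assms
    by (intro continuous_map_into_subtopology)
      (auto simp: continuous_map_pairwise o_def intro: continuous_map_from_subtopology)
  from continuous_map_compose[OF this continuous_comp] show ?thesis by (simp add: o_def)
qed

end

context left_action
begin

lemma anchor_in: "y \<in> topspace Y \<Longrightarrow> a y \<in> topspace (objects G)"
  using continuous_anchor by (auto simp: continuous_map_def)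

lemma act_in: "\<lbrakk>g \<in> topspace (arrows G); y \<in> topspace Y; src G g = a y\<rbrakk> \<Longrightarrow> m (g, y) \<in> topspace Y"
  using continuous_act by (auto simp: continuous_map_def topspace_fibre_product)

end

context right_action
begin

lemma anchor_in: "y \<in> topspace Y \<Longrightarrow> a y \<in> topspace (objects G)"
  using continuous_anchor by (auto simp: continuous_map_def)

lemma act_in: "\<lbrakk>y \<in> topspace Y; g \<in> topspace (arrows G); a y = rng G g\<rbrakk> \<Longrightarrow> m (y, g) \<in> topspace Y"
  using continuous_act by (auto simp: continuous_map_def topspace_fibre_product)

end

locale correspondence_setting = etale_groupoid G + groupoid_correspondence G X
  for G :: "'g tgroupoid" and X :: "('g, 'x) correspondence"
begin

sublocale L: left_action G "cspace X" "lanchor X" "lact X" by (rule left)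

sublocale Rt: right_action G "cspace X" "ranchor X" "ract X" by (rule right)

abbreviation "GA \<equiv> topspace (arrows G)"
abbreviation "XS \<equiv> topspace (cspace X)"

lemma lanchor_unit [simp]: "x \<in> XS \<Longrightarrow> lanchor X x \<in> units G"
  and ranchor_unit [simp]: "x \<in> XS \<Longrightarrow> ranchor X x \<in> units G"
  using L.anchor_in Rt.anchor_in by auto

lemma lanchor_ract [simp]:
  "\<lbrakk>x \<in> XS; g \<in> GA; ranchor X x = rng G g\<rbrakk> \<Longrightarrow> lanchor X (ract X (x, g)) = lanchor X x"
  and ranchor_lact [simp]:
  "\<lbrakk>g \<in> GA; x \<in> XS; src G g = lanchor X x\<rbrakk> \<Longrightarrow> ranchor X (lact X (g, x)) = ranchor X x"
  and ract_lact: "\<lbrakk>g \<in> GA; x \<in> XS; h \<in> GA; src G g = lanchor X x; ranchor X x = rng G h\<rbrakk> \<Longrightarrow>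
    ract X (lact X (g, x), h) = lact X (g, ract X (x, h))"
  using commuting unfolding commuting_actions_def by simp_all

lemma ract_inv:
  assumes "x \<in> XS" "g \<in> GA" "ranchor X x = rng G g"
  shows "ract X (ract X (x, g), ginv G g) = x"
  using assms Rt.act_act[of x g "ginv G g"] Rt.unit_act[of x]
  by (simp add: ginv_closed rng_ginv ginv_right)

text \<open>The arrow \<open>gcomp G g (ginv G h)\<close> fixes \<open>x\<close>, so freeness makes
  it a unit.\<close>

lemma ract_cancel:
  assumes "x \<in> XS" "g \<in> GA" "h \<in> GA" "ranchor X x = rng G g" "ranchor X x = rng G h"
    and eq: "ract X (x, g) = ract X (x, h)"
  shows "g = h"
proof -
  have src: "src G g = src G h"
    using assms Rt.anchor_act[of x g] Rt.anchor_act[of x h] by simp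
  have c: "gcomp G g (ginv G h) \<in> GA" "rng G (gcomp G g (ginv G h)) = rng G g"
    "src G (gcomp G g (ginv G h)) = rng G h"
    using assms src by (simp_all add: comp_closed ginv_closed rng_ginv rng_comp src_comp src_ginv)
  have "ract X (x, gcomp G g (ginv G h)) = ract X (ract X (x, g), ginv G h)"
    using assms src Rt.act_act[of x g "ginv G h"] by (simp add: ginv_closed rng_ginv)
  also have "\<dots> = x" using assms eq ract_inv[of x h] by simp
  finally have "gcomp G g (ginv G h) \<in> units G" using assms c free by simp
  then have "gcomp G g (ginv G h) = rng G h" using c src_of_unit by metis
  then have "gcomp G (gcomp G g (ginv G h)) h = h" using assms left_unit[of h] by simp
  then show ?thesis using cancel_right'[of g h] assms src by simp
qed

section \<open>The orbit space of the right action\<close>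

lemma orbit_of_self: "x \<in> XS \<Longrightarrow> x \<in> orbit_of G X x"
  unfolding orbit_of_def
  by (auto simp: rng_of_unit Rt.unit_act intro!: exI[of _ "ranchor X x"])

lemma orbit_of_ract [simp]:
  assumes "x \<in> XS" "g \<in> GA" "ranchor X x = rng G g"
  shows "orbit_of G X (ract X (x, g)) = orbit_of G X x"
proof (intro subset_antisym subsetI)
  fix z assume "z \<in> orbit_of G X (ract X (x, g))"
  then obtain h where h: "h \<in> GA" "src G g = rng G h" "z = ract X (ract X (x, g), h)"
    using assms Rt.anchor_act[of x g] by (auto simp: orbit_of_def)
  then have "z = ract X (x, gcomp G g h)" using assms Rt.act_act by simp
  then show "z \<in> orbit_of G X x" unfolding orbit_of_def
    using h assms by (auto simp: comp_closed rng_comp)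
next
  fix z assume "z \<in> orbit_of G X x"
  then obtain h where h: "h \<in> GA" "ranchor X x = rng G h" "z = ract X (x, h)"
    by (auto simp: orbit_of_def)
  have "z = ract X (ract X (x, g), gcomp G (ginv G g) h)"
    using assms h cancel_left'[of g h] Rt.act_act[of x g "gcomp G (ginv G g) h"]
    by (simp add: comp_closed ginv_closed src_ginv rng_comp rng_ginv)
  moreover have "gcomp G (ginv G g) h \<in> GA" "rng G (gcomp G (ginv G g) h) = src G g"
    using assms h by (simp_all add: comp_closed ginv_closed src_ginv rng_comp rng_ginv)
  ultimately show "z \<in> orbit_of G X (ract X (x, g))"
    using assms Rt.anchor_act[of x g] by (auto simp: orbit_of_def)
qed

lemma orbit_of_eq_iff:
  assumes "x \<in> XS" "y \<in> XS"
  shows "orbit_of G X x = orbit_of G X y \<longleftrightarrow> (\<exists>g\<in>GA. ranchor X x = rng G g \<and> y = ract X (x, g))"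
proof
  assume "orbit_of G X x = orbit_of G X y"
  then have "y \<in> orbit_of G X x" using orbit_of_self assms by simp
  then show "\<exists>g\<in>GA. ranchor X x = rng G g \<and> y = ract X (x, g)" by (auto simp: orbit_of_def)
qed (use assms in auto)

lemma orbit_lanchor_orbit_of [simp]:
  assumes "x \<in> XS"
  shows "orbit_lanchor X (orbit_of G X x) = lanchor X x"
proof -
  have "lanchor X ` orbit_of G X x = {lanchor X x}"
    using assms orbit_of_self[OF assms] by (auto simp: orbit_of_def)
  then show ?thesis by (simp add: orbit_lanchor_def)
qed

lemma continuous_orbit_of: "continuous_map (cspace X) (orbit_space G X) (orbit_of G X)"
  unfolding orbit_space_def
  using quotient_imp_continuous_map quotient_map_quotient_topology by blast

lemma topspace_orbit_space: "topspace (orbit_space G X) = orbit_of G X ` XS"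
  unfolding orbit_space_def
  using quotient_imp_surjective_map[OF quotient_map_quotient_topology] by (rule sym)

text \<open>The range map is open, so each \<open>x'\<close> near \<open>x\<close> is again
  composable with some arrow near \<open>g\<close>. Moving \<open>x\<close> by \<open>g\<close> into
  \<open>V\<close> can thus be done on a whole neighbourhood, with arrows close to
  \<open>g\<close>.\<close>

lemma ract_local:
  assumes x: "x \<in> XS" "g \<in> GA" "ranchor X x = rng G g"
    and V: "openin (cspace X) V" "ract X (x, g) \<in> V" and N: "openin (arrows G) N" "g \<in> N"
  obtains W where "openin (cspace X) W" "x \<in> W"
    "\<And>x'. x' \<in> W \<Longrightarrow> \<exists>g'\<in>N. ranchor X x' = rng G g' \<and> ract X (x', g') \<in> V"
proof -
  obtain W N' where W: "openin (cspace X) W" "openin (arrows G) N'" "x \<in> W" "g \<in> N'"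
    "\<And>x' g'. \<lbrakk>x' \<in> W; g' \<in> N'; ranchor X x' = rng G g'\<rbrakk> \<Longrightarrow> ract X (x', g') \<in> V"
    using continuous_map_fibre_productD[OF Rt.continuous_act x V] by metis
  define W' where "W' = W \<inter> {x' \<in> XS. ranchor X x' \<in> rng G ` (N \<inter> N')}"
  have "openin (arrows G) (N \<inter> N')" using N W by blast
  then have "openin (objects G) (rng G ` (N \<inter> N'))" using open_rng unfolding open_map_def by blast
  then have "openin (cspace X) {x' \<in> XS. ranchor X x' \<in> rng G ` (N \<inter> N')}"
    using Rt.continuous_anchor unfolding continuous_map_def by blast
  then have "openin (cspace X) W'" using W unfolding W'_def by blast
  moreover have "x \<in> W'" using x W N by (auto simp: W'_def)
  moreover have "\<exists>g'\<in>N. ranchor X x' = rng G g' \<and> ract X (x', g') \<in> V" if "x' \<in> W'" for x'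
    using that W(5) by (auto simp: W'_def)
  ultimately show thesis using that by blast
qed

lemma open_orbit_of: "open_map (cspace X) (orbit_space G X) (orbit_of G X)"
  unfolding open_map_def
proof (intro allI impI)
  fix U assume U: "openin (cspace X) U"
  have UX: "U \<subseteq> XS" using U openin_subset by blast
  have "openin (cspace X) {x \<in> XS. orbit_of G X x \<in> orbit_of G X ` U}"
  proof (subst openin_subopen, intro ballI)
    fix x assume "x \<in> {x \<in> XS. orbit_of G X x \<in> orbit_of G X ` U}"
    then obtain u where u: "x \<in> XS" "u \<in> U" "orbit_of G X x = orbit_of G X u" by auto
    then obtain g where g: "g \<in> GA" "ranchor X x = rng G g" "u = ract X (x, g)"
      using orbit_of_eq_iff[of x u] UX by blast
    have N: "openin (arrows G) GA" by simp
    obtain W where W: "openin (cspace X) W" "x \<in> W"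
      "\<And>x'. x' \<in> W \<Longrightarrow> \<exists>g'\<in>GA. ranchor X x' = rng G g' \<and> ract X (x', g') \<in> U"
      using ract_local[OF u(1) g(1,2) U _ N g(1)] u(2) g(3) by metis
    have "W \<subseteq> {x \<in> XS. orbit_of G X x \<in> orbit_of G X ` U}"
    proof
      fix x' assume x': "x' \<in> W"
      then have X': "x' \<in> XS" using W(1) openin_subset by blast
      obtain g' where "g' \<in> GA" "ranchor X x' = rng G g'" "ract X (x', g') \<in> U" using W(3)[OF x'] by blast
      then have "orbit_of G X x' \<in> orbit_of G X ` U" using X' orbit_of_ract by (metis imageI)
      then show "x' \<in> {x \<in> XS. orbit_of G X x \<in> orbit_of G X ` U}" using X' by simp
    qed
    then show "\<exists>T. openin (cspace X) T \<and> x \<in> T \<and> T \<subseteq> {x \<in> XS. orbit_of G X x \<in> orbit_of G X ` U}"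
      using W(1,2) by blast
  qed
  then show "openin (orbit_space G X) (orbit_of G X ` U)"
    unfolding orbit_space_def openin_quotient_topology using UX by blast
qed

text \<open>Properness of the action makes the orbit equivalence relation closed.\<close>

lemma Hausdorff_orbit_space: "Hausdorff_space (orbit_space G X)"
  unfolding Hausdorff_space_def
proof (intro allI impI, elim conjE)
  fix C D assume CD: "C \<in> topspace (orbit_space G X)" "D \<in> topspace (orbit_space G X)" "C \<noteq> D"
  then obtain x y where xy: "x \<in> XS" "y \<in> XS" "C = orbit_of G X x" "D = orbit_of G X y"
    by (auto simp: topspace_orbit_space)
  define E where "E = (\<lambda>(x, g). (ract X (x, g), x)) ` topspace (fibre_product (cspace X) (ranchor X) (rng G) (arrows G))"
  have "closedin (prod_topology (cspace X) (cspace X)) E"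
    using proper_imp_closed_map[OF proper] unfolding E_def closed_map_def by blast
  then have op: "openin (prod_topology (cspace X) (cspace X)) (XS \<times> XS - E)"
    unfolding closedin_def by simp
  have E_iff: "(v, u) \<in> E \<longleftrightarrow> u \<in> XS \<and> (\<exists>g\<in>GA. ranchor X u = rng G g \<and> v = ract X (u, g))" for u v
    by (auto simp: E_def topspace_fibre_product image_iff)
  have "(y, x) \<notin> E" using CD(3) xy orbit_of_eq_iff[of x y] by (auto simp: E_iff)
  then have yx: "(y, x) \<in> XS \<times> XS - E" using xy by simp
  from op[unfolded openin_prod_topology_alt, rule_format, OF this]
  obtain V U where VU: "openin (cspace X) V" "openin (cspace X) U" "y \<in> V" "x \<in> U"
    "V \<times> U \<subseteq> XS \<times> XS - E" by metis
  have "orbit_of G X ` U \<inter> orbit_of G X ` V = {}"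
  proof (rule ccontr)
    assume "orbit_of G X ` U \<inter> orbit_of G X ` V \<noteq> {}"
    then obtain u v where uv: "u \<in> U" "v \<in> V" "orbit_of G X u = orbit_of G X v" by blast
    then have "u \<in> XS" "v \<in> XS" using VU openin_subset by blast+
    then have "(v, u) \<in> E" using uv orbit_of_eq_iff[of u v] by (auto simp: E_iff)
    then show False using uv VU(5) by blast
  qed
  then show "\<exists>U V. openin (orbit_space G X) U \<and> openin (orbit_space G X) V \<and> C \<in> U \<and> D \<in> V \<and> disjnt U V"
    using VU open_orbit_of xy unfolding open_map_def disjnt_def
    by (intro exI[of _ "orbit_of G X ` U"] exI[of _ "orbit_of G X ` V"]) auto
qed

lemma locally_compact_cspace: "locally_compact_space (cspace X)"
  using local_homeomorphism_locally_compact etale_ranchor Hausdorff_objects locally_compact_objects by blast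

text \<open>The orbit space is Hausdorff, so compact sets of orbits are closed there. The compact
  set \<open>L\<close> itself need not be closed in the possibly non-Hausdorff space
  \<open>cspace X\<close>.\<close>

lemma closedin_saturation:
  assumes "compactin (cspace X) L"
  shows "closedin (cspace X) {x \<in> XS. orbit_of G X x \<in> orbit_of G X ` L}"
proof -
  have "closedin (orbit_space G X) (orbit_of G X ` L)"
    using assms image_compactin continuous_orbit_of compactin_imp_closedin Hausdorff_orbit_space by blast
  then show ?thesis using continuous_orbit_of closedin_continuous_map_preimage by blast
qed

text \<open>Since \<open>orbit_of\<close> is open and \<open>cspace X\<close> is locally compact,
  images of open sets with compact hulls cover \<open>K\<close>; finitely many suffice. This lets
  compact subsets of \<open>cspace X\<close> replace compact sets of orbits.\<close>

lemma compact_orbits_lift: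
  assumes K: "compactin (orbit_space G X) K"
  obtains L where "compactin (cspace X) L" "orbit_of G X ` L = K"
proof -
  define \<U> where "\<U> = {orbit_of G X ` U |U. openin (cspace X) U \<and> (\<exists>L. compactin (cspace X) L \<and> U \<subseteq> L)}"
  have op: "\<forall>W\<in>\<U>. openin (orbit_space G X) W"
    using open_orbit_of unfolding open_map_def \<U>_def by blast
  have cov: "K \<subseteq> \<Union>\<U>"
  proof
    fix C assume "C \<in> K"
    then obtain x where x: "x \<in> XS" "C = orbit_of G X x"
      using compactin_subset_topspace[OF K] by (auto simp: topspace_orbit_space)
    then obtain U L where "openin (cspace X) U" "compactin (cspace X) L" "x \<in> U" "U \<subseteq> L"
      using locally_compact_cspace unfolding locally_compact_space_def by blast
    then show "C \<in> \<Union>\<U>" unfolding \<U>_def using x(2) by blast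
  qed
  obtain \<F> where F: "finite \<F>" "\<F> \<subseteq> \<U>" "K \<subseteq> \<Union>\<F>"
    using K op cov unfolding compactin_def by meson
  have "\<forall>W\<in>\<F>. \<exists>L. compactin (cspace X) L \<and> W \<subseteq> orbit_of G X ` L"
    using F(2) unfolding \<U>_def by fast
  then obtain l where l: "\<And>W. W \<in> \<F> \<Longrightarrow> compactin (cspace X) (l W) \<and> W \<subseteq> orbit_of G X ` l W"
    by metis
  \<comment> \<open>Intersecting with the preimage of \<open>K\<close> cuts the image down to
    \<open>K\<close>. The result stays compact because \<open>K\<close> is closed in the Hausdorff
    orbit space.\<close>
  define L where "L = {x \<in> XS. orbit_of G X x \<in> K} \<inter> (\<Union>W\<in>\<F>. l W)"
  have "compactin (cspace X) (\<Union>W\<in>\<F>. l W)" using F(1) l by (intro compactin_Union) auto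
  moreover have "closedin (cspace X) {x \<in> XS. orbit_of G X x \<in> K}"
    using K compactin_imp_closedin Hausdorff_orbit_space continuous_orbit_of closedin_continuous_map_preimage by blast
  ultimately have "compactin (cspace X) L" unfolding L_def using closed_Int_compactin by blast
  moreover have "orbit_of G X ` L = K"
  proof
    show "K \<subseteq> orbit_of G X ` L"
    proof
      fix C assume C: "C \<in> K"
      then obtain W where W: "W \<in> \<F>" "C \<in> W" using F(3) by blast
      then obtain x where x: "x \<in> l W" "C = orbit_of G X x" using l by blast
      have "x \<in> XS" using x(1) l[OF W(1)] compactin_subset_topspace by blast
      then have "x \<in> L" using x C W by (auto simp: L_def)
      then show "C \<in> orbit_of G X ` L" using x(2) by blast
    qed
  qed (auto simp: L_def)
  ultimately show thesis using that by blast
qed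

end

section \<open>Actions on sets and their coarsest topology\<close>

text \<open>The algebraic part of an action. No topology on \<open>Y\<close> is fixed, so that
  several topologies on the same set of points can be compared.\<close>

locale set_action = correspondence_setting G X
  for G :: "'g tgroupoid" and X :: "('g, 'x) correspondence" +
  fixes R :: "'g set" and Y :: "'y set"
    and a :: "'y \<Rightarrow> 'g" and m :: "'g \<times> 'y \<Rightarrow> 'y" and n :: "'x \<times> 'y \<Rightarrow> 'y"
  assumes anchor_unit: "y \<in> Y \<Longrightarrow> a y \<in> units G"
    and act_in: "\<lbrakk>g \<in> GA; y \<in> Y; src G g = a y\<rbrakk> \<Longrightarrow> m (g, y) \<in> Y"
    and anchor_act: "\<lbrakk>g \<in> GA; y \<in> Y; src G g = a y\<rbrakk> \<Longrightarrow> a (m (g, y)) = rng G g"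
    and act_act: "\<lbrakk>g \<in> GA; h \<in> GA; y \<in> Y; src G g = rng G h; src G h = a y\<rbrakk>
      \<Longrightarrow> m (g, m (h, y)) = m (gcomp G g h, y)"
    and unit_act: "y \<in> Y \<Longrightarrow> m (a y, y) = y"
    and mult_in: "\<lbrakk>x \<in> XS; y \<in> Y; ranchor X x = a y\<rbrakk> \<Longrightarrow> n (x, y) \<in> Y"
    and anchor_mult: "\<lbrakk>x \<in> XS; y \<in> Y; ranchor X x = a y\<rbrakk> \<Longrightarrow> a (n (x, y)) = lanchor X x"
    and act_mult: "\<lbrakk>g \<in> GA; x \<in> XS; y \<in> Y; src G g = lanchor X x; ranchor X x = a y\<rbrakk>
      \<Longrightarrow> m (g, n (x, y)) = n (lact X (g, x), y)"
    and mult_eq_iff: "\<lbrakk>x \<in> XS; y \<in> Y; ranchor X x = a y; x' \<in> XS; y' \<in> Y; ranchor X x' = a y'\<rbrakk>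
      \<Longrightarrow> n (x, y) = n (x', y') \<longleftrightarrow>
        (\<exists>g \<in> GA. rng G g = ranchor X x \<and> src G g = a y' \<and> x' = ract X (x, g) \<and> y = m (g, y'))"
    and covers: "\<lbrakk>y \<in> Y; a y \<in> R\<rbrakk> \<Longrightarrow> \<exists>x\<in>XS. \<exists>y'\<in>Y. ranchor X x = a y' \<and> y = n (x, y')"
begin

definition mul :: "'x set \<Rightarrow> 'y set \<Rightarrow> 'y set" where
  "mul V W = {n (x, y) |x y. x \<in> V \<and> y \<in> W \<and> ranchor X x = a y}"

lemma mulI: "\<lbrakk>x \<in> V; y \<in> W; ranchor X x = a y\<rbrakk> \<Longrightarrow> n (x, y) \<in> mul V W"
  by (auto simp: mul_def)

lemma mulE:
  assumes "z \<in> mul V W"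
  obtains x y where "x \<in> V" "y \<in> W" "ranchor X x = a y" "z = n (x, y)"
  using assms by (auto simp: mul_def)

lemma mul_mono: "\<lbrakk>V \<subseteq> V'; W \<subseteq> W'\<rbrakk> \<Longrightarrow> mul V W \<subseteq> mul V' W'"
  by (auto simp: mul_def)

lemma mul_subset: "\<lbrakk>V \<subseteq> XS; W \<subseteq> Y\<rbrakk> \<Longrightarrow> mul V W \<subseteq> Y"
  by (auto simp: mul_def intro!: mult_in)

text \<open>This law is absent from the axioms; it is \<open>mult_eq_iff\<close> with
  \<open>g\<close> itself as the witness.\<close>

lemma mult_ract:
  assumes "x \<in> XS" "g \<in> GA" "y \<in> Y" "ranchor X x = rng G g" "src G g = a y"
  shows "n (ract X (x, g), y) = n (x, m (g, y))"
proof -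
  have "n (x, m (g, y)) = n (ract X (x, g), y)"
    using assms mult_eq_iff[of x "m (g, y)" "ract X (x, g)" y]
    by (auto simp: act_in anchor_act Rt.act_in Rt.anchor_act)
  then show ?thesis ..
qed

lemma act_inv: "\<lbrakk>g \<in> GA; y \<in> Y; src G g = a y\<rbrakk> \<Longrightarrow> m (ginv G g, m (g, y)) = y"
  using act_act[of "ginv G g" g y] unit_act[of y] by (simp add: ginv_closed src_ginv ginv_left)

lemma act_inv': "\<lbrakk>g \<in> GA; y \<in> Y; rng G g = a y\<rbrakk> \<Longrightarrow> m (g, m (ginv G g, y)) = y"
  using act_act[of g "ginv G g" y] unit_act[of y] by (simp add: ginv_closed src_ginv rng_ginv ginv_right)

lemma mult_shift:
  assumes "x \<in> XS" "g \<in> GA" "y \<in> Y" "ranchor X x = rng G g" "ranchor X x = a y"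
  shows "n (x, y) = n (ract X (x, g), m (ginv G g, y))"
  using assms mult_ract[of x g "m (ginv G g, y)"]
  by (simp add: act_in anchor_act ginv_closed src_ginv rng_ginv act_inv')

lemma mul_orbits:
  assumes L: "L \<subseteq> XS" and K: "orbit_of G X ` L = K"
  shows "{n (x, y) |x y. x \<in> XS \<and> y \<in> Y \<and> ranchor X x = a y \<and> orbit_of G X x \<in> K} = mul L Y"
proof (intro subset_antisym subsetI)
  fix z assume "z \<in> {n (x, y) |x y. x \<in> XS \<and> y \<in> Y \<and> ranchor X x = a y \<and> orbit_of G X x \<in> K}"
  then obtain x y where z: "z = n (x, y)" "x \<in> XS" "y \<in> Y" "ranchor X x = a y" "orbit_of G X x \<in> K"
    by blast
  then obtain l where l: "l \<in> L" "orbit_of G X x = orbit_of G X l" using K by auto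
  then obtain g where g: "g \<in> GA" "ranchor X x = rng G g" "l = ract X (x, g)"
    using orbit_of_eq_iff[of x l] z L by blast
  have "z = n (l, m (ginv G g, y))" using z g mult_shift by simp
  moreover have "m (ginv G g, y) \<in> Y" "ranchor X l = a (m (ginv G g, y))"
    using z g by (simp_all add: act_in anchor_act ginv_closed src_ginv rng_ginv Rt.anchor_act)
  ultimately show "z \<in> mul L Y" using l(1) mulI by blast
next
  fix z assume "z \<in> mul L Y"
  then show "z \<in> {n (x, y) |x y. x \<in> XS \<and> y \<in> Y \<and> ranchor X x = a y \<and> orbit_of G X x \<in> K}"
    using L K by (auto elim!: mulE)
qed

text \<open>By \<open>compact_orbits_lift\<close> and \<open>mul_orbits\<close>, the closedness
  condition over compact sets of orbits becomes closedness of \<open>mul L Y\<close> for compact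
  \<open>L\<close>.\<close>

lemma corr_actionI:
  assumes T: "topspace T = Y"
    and "continuous_map T (objects G) a"
    and "continuous_map (fibre_product (arrows G) (src G) a T) T m"
    and "continuous_map (corr_domain X a T) T n"
    and op: "\<And>V W. \<lbrakk>openin (cspace X) V; openin T W\<rbrakk> \<Longrightarrow> openin T (mul V W)"
    and cl: "\<And>L. compactin (cspace X) L \<Longrightarrow> closedin T (mul L Y)"
  shows "corr_action G X R T a m n"
proof (rule corr_action.intro)
  show "left_action G T a m"
    by (rule left_action.intro) (use assms anchor_act act_act unit_act in simp_all)
  show "open_map (corr_domain X a T) T n"
    unfolding corr_domain_def open_map_fibre_product_iff using op unfolding mul_def by blast
  show "{y \<in> topspace T. a y \<in> R} \<subseteq> n ` topspace (corr_domain X a T)"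
    using covers T by (fastforce simp: topspace_corr_domain)
  fix K assume "compactin (orbit_space G X) K"
  then obtain L where L: "compactin (cspace X) L" "orbit_of G X ` L = K" by (rule compact_orbits_lift)
  have "L \<subseteq> XS" using L(1) compactin_subset_topspace by blast
  then have "mul L Y = {n (x, y) |x y. x \<in> XS \<and> y \<in> Y \<and> ranchor X x = a y \<and> orbit_of G X x \<in> K}"
    using L(2) by (rule mul_orbits[symmetric])
  also have "\<dots> = {n (x, y) |x y. (x, y) \<in> topspace (corr_domain X a T) \<and> orbit_of G X x \<in> K}"
    using T by (auto simp: topspace_corr_domain)
  finally show "closedin T {n (x, y) |x y. (x, y) \<in> topspace (corr_domain X a T) \<and> orbit_of G X x \<in> K}"
    using cl[OF L(1)] by simp
qed (use assms anchor_mult act_mult mult_eq_iff in \<open>simp_all\<close>)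

text \<open>The maps \<open>src\<close> and \<open>ranchor\<close> are locally injective. For fixed
  \<open>y\<close>, a small neighbourhood of \<open>g\<close> or \<open>x\<close> therefore contains
  no other element composable with \<open>y\<close>, and this gives continuity of both
  multiplications.\<close>

lemma corr_action_discrete: "corr_action G X R (discrete_topology Y) a m n"
proof (rule corr_actionI)
  show "continuous_map (discrete_topology Y) (objects G) a"
    using anchor_unit by (auto simp: continuous_map_def)
  show "continuous_map (fibre_product (arrows G) (src G) a (discrete_topology Y)) (discrete_topology Y) m"
  proof (rule continuous_map_fibre_productI)
    fix g y U
    assume gy: "g \<in> GA" "y \<in> topspace (discrete_topology Y)" "src G g = a y" "m (g, y) \<in> U"
    obtain V where V: "openin (arrows G) V" "g \<in> V" "inj_on (src G) V"
      using local_homeomorphism_nhds[OF etale_src gy(1)] by metis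
    have eq: "g' = g" if "g' \<in> V" "src G g' = a y" for g'
      using V that gy(3) by (metis inj_onD)
    show "\<exists>V W. openin (arrows G) V \<and> openin (discrete_topology Y) W \<and> g \<in> V \<and> y \<in> W \<and>
        (\<forall>g' y'. g' \<in> V \<longrightarrow> y' \<in> W \<longrightarrow> src G g' = a y' \<longrightarrow> m (g', y') \<in> U)"
    proof (intro exI[of _ V] exI[of _ "{y}"] conjI allI impI)
      fix g' y' assume "g' \<in> V" "y' \<in> {y}" "src G g' = a y'"
      then have "y' = y" "g' = g" using eq[of g'] by simp_all
      then show "m (g', y') \<in> U" using gy(4) by simp
    qed (use V gy in simp_all)
  qed (simp add: act_in)
  show "continuous_map (corr_domain X a (discrete_topology Y)) (discrete_topology Y) n"
    unfolding corr_domain_def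
  proof (rule continuous_map_fibre_productI)
    fix x y U
    assume xy: "x \<in> XS" "y \<in> topspace (discrete_topology Y)" "ranchor X x = a y" "n (x, y) \<in> U"
    obtain V where V: "openin (cspace X) V" "x \<in> V" "inj_on (ranchor X) V"
      using local_homeomorphism_nhds[OF etale_ranchor xy(1)] by metis
    have eq: "x' = x" if "x' \<in> V" "ranchor X x' = a y" for x'
      using V that xy(3) by (metis inj_onD)
    show "\<exists>V W. openin (cspace X) V \<and> openin (discrete_topology Y) W \<and> x \<in> V \<and> y \<in> W \<and>
        (\<forall>x' y'. x' \<in> V \<longrightarrow> y' \<in> W \<longrightarrow> ranchor X x' = a y' \<longrightarrow> n (x', y') \<in> U)"
    proof (intro exI[of _ V] exI[of _ "{y}"] conjI allI impI)
      fix x' y' assume "x' \<in> V" "y' \<in> {y}" "ranchor X x' = a y'"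
      then have "y' = y" "x' = x" using eq[of x'] by simp_all
      then show "n (x', y') \<in> U" using xy(4) by simp
    qed (use V xy in simp_all)
  qed (simp add: mult_in)
next
  fix V W assume "openin (cspace X) V" "openin (discrete_topology Y) W"
  then show "openin (discrete_topology Y) (mul V W)"
    using mul_subset openin_subset by (metis openin_discrete_topology)
next
  fix L assume "compactin (cspace X) L"
  then have "mul L Y \<subseteq> Y" using mul_subset compactin_subset_topspace by blast
  then show "closedin (discrete_topology Y) (mul L Y)" by (simp add: closedin_def)
qed simp

section \<open>The topology generated by the sets that the axioms force to be open\<close>

definition refine_basis :: "'y topology \<Rightarrow> 'y set set" where
  "refine_basis T = {{y \<in> Y. a y \<in> U} |U. openin (objects G) U} \<union>
     {Y - mul L Y |L. compactin (cspace X) L} \<union>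
     {mul V W |V W. openin (cspace X) V \<and> openin T W}"

definition refine :: "'y topology \<Rightarrow> 'y topology" where
  "refine T = topology_generated_by (refine_basis T)"

text \<open>Level 0 makes only the anchor map continuous. Each round adds the sets
  \<open>mul V W\<close> with \<open>W\<close> open at the previous level, as required by
  \<open>open_mult\<close>, and the complements of \<open>mul L Y\<close>, as required by
  \<open>closed\<close>. The rounds are iterated because products of newly open sets must be open as
  well.\<close>

primrec level :: "nat \<Rightarrow> 'y topology" where
  "level 0 = pullback_topology Y a (objects G)"
| "level (Suc k) = refine (level k)"

definition coarsest :: "'y topology" where
  "coarsest = topology_generated_by (\<Union>k. {W. openin (level k) W})"

lemma Union_refine_basis:
  assumes "topspace T = Y"
  shows "\<Union>(refine_basis T) = Y"
proof
  show "\<Union>(refine_basis T) \<subseteq> Y"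
  proof (intro Union_least)
    fix S assume "S \<in> refine_basis T"
    then consider "S \<subseteq> Y" | V W where "S = mul V W" "openin (cspace X) V" "openin T W"
      unfolding refine_basis_def by blast
    then show "S \<subseteq> Y"
    proof cases
      case 2
      then show ?thesis using mul_subset openin_subset assms by metis
    qed
  qed
  have "{y \<in> Y. a y \<in> units G} \<in> refine_basis T"
    unfolding refine_basis_def using openin_topspace[of "objects G"] by auto
  moreover have "{y \<in> Y. a y \<in> units G} = Y" using anchor_unit by blast
  ultimately show "Y \<subseteq> \<Union>(refine_basis T)" by (metis Union_upper)
qed

lemma topspace_refine: "topspace T = Y \<Longrightarrow> topspace (refine T) = Y"
  using Union_refine_basis by (simp add: refine_def)

lemma refine_anchor:
  assumes T: "topspace T = Y"
  shows "continuous_map (refine T) (objects G) a"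
  unfolding continuous_map_def
proof (intro conjI allI impI)
  show "a \<in> topspace (refine T) \<rightarrow> topspace (objects G)"
    using T topspace_refine anchor_unit by simp
  fix U assume "openin (objects G) U"
  then have "{y \<in> Y. a y \<in> U} \<in> refine_basis T" unfolding refine_basis_def by blast
  then have "openin (refine T) {y \<in> Y. a y \<in> U}" unfolding refine_def by (rule topology_generated_by_Basis)
  then show "openin (refine T) {y \<in> topspace (refine T). a y \<in> U}" using T topspace_refine by simp
qed

lemma openin_refine_mul:
  "\<lbrakk>openin (cspace X) V; openin T W\<rbrakk> \<Longrightarrow> openin (refine T) (mul V W)"
  unfolding refine_def by (rule topology_generated_by_Basis) (auto simp: refine_basis_def)

lemma openin_refine_compl:
  "compactin (cspace X) L \<Longrightarrow> openin (refine T) (Y - mul L Y)"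
  unfolding refine_def by (rule topology_generated_by_Basis) (auto simp: refine_basis_def)

lemma openin_anchor_preimage:
  "\<lbrakk>topspace T = Y; continuous_map T (objects G) a; openin (objects G) U\<rbrakk> \<Longrightarrow> openin T {y \<in> Y. a y \<in> U}"
  unfolding continuous_map_def by metis

text \<open>Equal products have first factors in the same orbit, by
  \<open>mult_eq_iff\<close>.\<close>

lemma not_in_mul_compact:
  assumes L: "compactin (cspace X) L" and x: "x \<in> XS" "orbit_of G X x \<notin> orbit_of G X ` L"
    "y \<in> Y" "ranchor X x = a y"
  shows "n (x, y) \<notin> mul L Y"
proof
  assume "n (x, y) \<in> mul L Y"
  then obtain l w where lw: "l \<in> L" "w \<in> Y" "ranchor X l = a w" "n (x, y) = n (l, w)" by (auto elim!: mulE)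
  moreover have lX: "l \<in> XS" using L lw(1) compactin_subset_topspace by blast
  ultimately obtain g where "g \<in> GA" "rng G g = ranchor X x" "l = ract X (x, g)"
    using x mult_eq_iff[of x y l w] by blast
  then have "orbit_of G X x = orbit_of G X l" using x(1) by simp
  then show False using x(2) lw(1) by blast
qed

text \<open>The target carries the finer level although \<open>y\<close> is controlled only in
  \<open>T\<close>: each generator of \<open>refine T\<close> pulls back to a condition on
  \<open>x\<close> together with at most a \<open>T\<close>-open condition on
  \<open>y\<close>.\<close>

lemma refine_mult:
  assumes T: "topspace T = Y" and anc: "continuous_map T (objects G) a"
    and act: "continuous_map (fibre_product (arrows G) (src G) a T) T m"
  shows "continuous_map (corr_domain X a T) (refine T) n"
  unfolding corr_domain_def refine_def
proof (rule continuous_map_fibre_product_generatedI)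
  fix x y assume "x \<in> XS" "y \<in> topspace T" "ranchor X x = a y"
  then show "n (x, y) \<in> \<Union>(refine_basis T)" using T Union_refine_basis mult_in by simp
next
  fix x y S assume xy: "x \<in> XS" "y \<in> topspace T" "ranchor X x = a y" and S: "S \<in> refine_basis T" "n (x, y) \<in> S"
  have y: "y \<in> Y" using xy T by simp
  consider (anchor) U where "S = {y \<in> Y. a y \<in> U}" "openin (objects G) U"
    | (compl) L where "S = Y - mul L Y" "compactin (cspace X) L"
    | (mul) V W where "S = mul V W" "openin (cspace X) V" "openin T W"
    using S(1) unfolding refine_basis_def by blast
  then show "\<exists>V W. openin (cspace X) V \<and> openin T W \<and> x \<in> V \<and> y \<in> W \<and>
        (\<forall>x' y'. x' \<in> V \<longrightarrow> y' \<in> W \<longrightarrow> ranchor X x' = a y' \<longrightarrow> n (x', y') \<in> S)"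
  proof cases
    case anchor
    have "openin (cspace X) {x \<in> XS. lanchor X x \<in> U}"
      using L.continuous_anchor anchor(2) unfolding continuous_map_def by blast
    moreover have "lanchor X x \<in> U" using S(2) anchor(1) anchor_mult xy(1,3) y by simp
    ultimately show ?thesis using xy y anchor(1) T anchor_mult mult_in
      by (intro exI[of _ "{x \<in> XS. lanchor X x \<in> U}"] exI[of _ Y]) (metis (no_types, lifting) mem_Collect_eq openin_topspace)
  next
    case compl
    \<comment> \<open>Membership of a product in \<open>mul L Y\<close> depends only on the orbit of
      its first factor, so the saturation of \<open>L\<close> has to be removed.\<close>
    define V where "V = XS - {x \<in> XS. orbit_of G X x \<in> orbit_of G X ` L}"
    have "openin (cspace X) V" using closedin_saturation[OF compl(2)] unfolding V_def closedin_def by blast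
    moreover have "x \<in> V"
    proof -
      have False if "orbit_of G X x \<in> orbit_of G X ` L"
      proof -
        have "n (x, y) \<in> {n (x, y) |x y. x \<in> XS \<and> y \<in> Y \<and> ranchor X x = a y \<and> orbit_of G X x \<in> orbit_of G X ` L}"
          using that xy(1,3) y by blast
        then show False
          using mul_orbits[OF compactin_subset_topspace[OF compl(2)] refl] S(2) compl(1) by simp
      qed
      then show ?thesis using xy(1) by (auto simp: V_def)
    qed
    moreover have "n (x', y') \<in> S" if "x' \<in> V" "y' \<in> Y" "ranchor X x' = a y'" for x' y'
      using that not_in_mul_compact[OF compl(2), of x' y'] mult_in compl(1) by (auto simp: V_def)
    ultimately show ?thesis using y T by (intro exI[of _ V] exI[of _ Y]) (metis openin_topspace)
  next
    case mul
    then obtain x1 y1 where 1: "x1 \<in> V" "y1 \<in> W" "ranchor X x1 = a y1" "n (x, y) = n (x1, y1)"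
      using S(2) by (auto elim!: mulE)
    have "x1 \<in> XS" "y1 \<in> Y" using 1 mul T openin_subset by blast+
    then obtain g where g: "g \<in> GA" "rng G g = ranchor X x" "src G g = a y1" "x1 = ract X (x, g)" "y = m (g, y1)"
      using mult_eq_iff[of x y x1 y1] xy(1,3) y 1 by blast
    have "m (ginv G g, y) = y1" using g act_inv \<open>y1 \<in> Y\<close> by simp
    then have "m (ginv G g, y) \<in> W" using 1 by simp
    moreover have "ginv G g \<in> GA" "src G (ginv G g) = a y" using g xy by (simp_all add: ginv_closed src_ginv)
    ultimately obtain N W' where N: "openin (arrows G) N" "openin T W'" "ginv G g \<in> N" "y \<in> W'"
      "\<And>g' y'. \<lbrakk>g' \<in> N; y' \<in> W'; src G g' = a y'\<rbrakk> \<Longrightarrow> m (g', y') \<in> W"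
      using continuous_map_fibre_productD[OF act _ xy(2) _ mul(3)] by metis
    \<comment> \<open>A nearby pair \<open>(x', y')\<close> is rewritten by moving \<open>x'\<close>
      with some \<open>g'\<close> into \<open>V\<close> and \<open>y'\<close> with the inverse of
      \<open>g'\<close> into \<open>W\<close>. So \<open>g'\<close> has to be close to
      \<open>g\<close> and its inverse has to lie in \<open>N\<close>.\<close>
    define N' where "N' = {g' \<in> GA. ginv G g' \<in> N}"
    have N': "openin (arrows G) N'" "g \<in> N'"
      using continuous_ginv N g unfolding continuous_map_def N'_def by auto
    obtain V' where V': "openin (cspace X) V'" "x \<in> V'"
      "\<And>x'. x' \<in> V' \<Longrightarrow> \<exists>g'\<in>N'. ranchor X x' = rng G g' \<and> ract X (x', g') \<in> V"
      using ract_local[OF xy(1) g(1) g(2)[symmetric] mul(2) _ N'] 1(1) g(4) by metis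
    have "n (x', y') \<in> S" if x': "x' \<in> V'" "y' \<in> W'" "ranchor X x' = a y'" for x' y'
    proof -
      obtain g' where g': "g' \<in> N'" "ranchor X x' = rng G g'" "ract X (x', g') \<in> V" using V'(3)[OF x'(1)] by blast
      have in': "x' \<in> XS" "y' \<in> Y" "g' \<in> GA" "ginv G g' \<in> N"
        using x'(1,2) openin_subset[OF V'(1)] openin_subset[OF N(2)] T g'(1) by (auto simp: N'_def)
      have "n (x', y') = n (ract X (x', g'), m (ginv G g', y'))"
        using in' g' x' by (intro mult_shift) simp_all
      moreover have "m (ginv G g', y') \<in> W" using N(5) in' x' g' by (simp add: src_ginv)
      moreover have "ranchor X (ract X (x', g')) = a (m (ginv G g', y'))"
        using in' g' x' by (simp add: Rt.anchor_act anchor_act ginv_closed src_ginv rng_ginv)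
      ultimately show ?thesis using g'(3) mul(1) mulI by simp
    qed
    then show ?thesis using V' N by blast
  qed
qed

text \<open>The complements of the sets \<open>mul L Y\<close> are treated by cases: a point outside \<open>mul XS Y\<close> has
  a neighbourhood disjoint from \<open>mul (N\<inverse> L) Y\<close> for a compact neighbourhood \<open>N\<close> in \<open>G\<close>; on
  \<open>mul XS Y\<close> the action is controlled by the one on \<open>X\<close>.\<close>

lemma refine_act:
  assumes T: "topspace T = Y"
  shows "continuous_map (fibre_product (arrows G) (src G) a (refine T)) (refine T) m"
proof -
  have rT: "topspace (refine T) = Y" using T by (rule topspace_refine)
  have "continuous_map (fibre_product (arrows G) (src G) a (refine T)) (topology_generated_by (refine_basis T)) m"
  proof (rule continuous_map_fibre_product_generatedI)
    fix g y assume "g \<in> GA" "y \<in> topspace (refine T)" "src G g = a y"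
    then show "m (g, y) \<in> \<Union>(refine_basis T)" using T rT Union_refine_basis act_in by simp
  next
    fix g y S assume gy: "g \<in> GA" "y \<in> topspace (refine T)" "src G g = a y"
      and S: "S \<in> refine_basis T" "m (g, y) \<in> S"
    have y: "y \<in> Y" using gy rT by simp
    \<comment> \<open>If \<open>y = n (x, w)\<close>, the arrow \<open>g\<close> acts on the first
      factor only. The claim then follows from continuity of the left action on
      \<open>cspace X\<close>, while \<open>w\<close> stays in one \<open>T\<close>-open
      set.\<close>
    have via_X: "\<exists>N W. openin (arrows G) N \<and> openin (refine T) W \<and> g \<in> N \<and> y \<in> W \<and>
        (\<forall>g' y'. g' \<in> N \<longrightarrow> y' \<in> W \<longrightarrow> src G g' = a y' \<longrightarrow> m (g', y') \<in> S)"
      if x: "x \<in> XS" "w \<in> W" "openin T W" "ranchor X x = a w" "y = n (x, w)"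
        and V: "openin (cspace X) V" "lact X (g, x) \<in> V"
        and VW: "\<And>x' w'. \<lbrakk>x' \<in> V; w' \<in> W; ranchor X x' = a w'\<rbrakk> \<Longrightarrow> n (x', w') \<in> S"
      for x w V W
    proof -
      have WY: "W \<subseteq> Y" using x T openin_subset by blast
      then have gx: "src G g = lanchor X x" using gy x anchor_mult by auto
      obtain N V' where N: "openin (arrows G) N" "openin (cspace X) V'" "g \<in> N" "x \<in> V'"
        "\<And>g' x'. \<lbrakk>g' \<in> N; x' \<in> V'; src G g' = lanchor X x'\<rbrakk> \<Longrightarrow> lact X (g', x') \<in> V"
        using continuous_map_fibre_productD[OF L.continuous_act gy(1) x(1) gx V] by metis
      have "m (g', y') \<in> S" if g': "g' \<in> N" "y' \<in> mul V' W" "src G g' = a y'" for g' y'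
      proof -
        obtain x' w' where x': "x' \<in> V'" "w' \<in> W" "ranchor X x' = a w'" "y' = n (x', w')"
          using g'(2) by (auto elim: mulE)
        have in': "x' \<in> XS" "w' \<in> Y" "g' \<in> GA" using x' g' N WY openin_subset by blast+
        have "src G g' = lanchor X x'" using g'(3) x' in' anchor_mult by simp
        then have "m (g', y') = n (lact X (g', x'), w')" "lact X (g', x') \<in> V"
            "ranchor X (lact X (g', x')) = a w'"
          using x' in' act_mult N(5) g'(1) by simp_all
        then show ?thesis using VW x'(2) by simp
      qed
      moreover have "y \<in> mul V' W" using x N mulI by simp
      ultimately show ?thesis using N openin_refine_mul[OF N(2) x(3)] by blast
    qed
    consider (anchor) U where "S = {y \<in> Y. a y \<in> U}" "openin (objects G) U"
      | (compl) L where "S = Y - mul L Y" "compactin (cspace X) L"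
      | (mul) V W where "S = mul V W" "openin (cspace X) V" "openin T W"
      using S(1) unfolding refine_basis_def by blast
    then show "\<exists>N W. openin (arrows G) N \<and> openin (refine T) W \<and> g \<in> N \<and> y \<in> W \<and>
        (\<forall>g' y'. g' \<in> N \<longrightarrow> y' \<in> W \<longrightarrow> src G g' = a y' \<longrightarrow> m (g', y') \<in> S)"
    proof cases
      case anchor
      have "openin (arrows G) {g \<in> GA. rng G g \<in> U}"
        using continuous_rng anchor(2) unfolding continuous_map_def by blast
      moreover have "rng G g \<in> U" using S(2) anchor(1) anchor_act gy(1,3) y by simp
      ultimately show ?thesis using gy y anchor(1) rT anchor_act act_in
        by (intro exI[of _ "{g \<in> GA. rng G g \<in> U}"] exI[of _ Y]) (metis (no_types, lifting) mem_Collect_eq openin_topspace)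
    next
      case mul
      then obtain x1 w where 1: "x1 \<in> V" "w \<in> W" "ranchor X x1 = a w" "m (g, y) = n (x1, w)"
        using S(2) by (auto elim!: mulE)
      have in1: "x1 \<in> XS" "w \<in> Y" using 1 mul T openin_subset by blast+
      have anc: "lanchor X x1 = rng G g" using anchor_mult[OF in1 1(3)] anchor_act[OF gy(1) y gy(3)] 1(4) by simp
      \<comment> \<open>From \<open>m (g, y) = n (x1, w)\<close> the point \<open>y\<close> itself
        is a product, with the first factor moved back by the inverse of \<open>g\<close>.\<close>
      define x where "x = lact X (ginv G g, x1)"
      have x: "x \<in> XS" "ranchor X x = a w"
        using in1 anc gy 1 by (simp_all add: x_def L.act_in ginv_closed src_ginv)
      have "y = m (ginv G g, n (x1, w))" using act_inv[OF gy(1) y gy(3)] 1(4) by simp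
      also have "\<dots> = n (x, w)"
        unfolding x_def using in1 anc gy 1 by (intro act_mult) (simp_all add: ginv_closed src_ginv)
      finally have "y = n (x, w)" .
      moreover have "lact X (g, x) = x1"
        unfolding x_def using L.act_act[of g "ginv G g" x1] L.unit_act[of x1] in1 anc gy(1)
        by (simp add: ginv_closed src_ginv rng_ginv ginv_right)
      ultimately show ?thesis using via_X[of x w W V] x 1 mul mulI by simp
    next
      case compl
      show ?thesis
      proof (cases "y \<in> mul XS Y")
        case True
        then obtain x w where x: "x \<in> XS" "w \<in> Y" "ranchor X x = a w" "y = n (x, w)"
          by (auto elim: mulE)
        have gx: "src G g = lanchor X x" using gy x anchor_mult by simp
        define V where "V = XS - {x \<in> XS. orbit_of G X x \<in> orbit_of G X ` L}"
        have V: "openin (cspace X) V" using closedin_saturation[OF compl(2)] unfolding V_def closedin_def by blast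
        have gxX: "lact X (g, x) \<in> XS" "ranchor X (lact X (g, x)) = a w"
          using gx gy x by (simp_all add: L.act_in)
        have "m (g, y) = n (lact X (g, x), w)" using act_mult gx gy x by simp
        then have "n (lact X (g, x), w) \<notin> mul L Y" using S(2) compl(1) by simp
        then have "lact X (g, x) \<in> V"
          using mul_orbits[OF compactin_subset_topspace[OF compl(2)] refl] gxX x(2) unfolding V_def by blast
        moreover have "n (x', w') \<in> S" if "x' \<in> V" "w' \<in> Y" "ranchor X x' = a w'" for x' w'
          using that not_in_mul_compact[OF compl(2), of x' w'] mult_in compl(1) by (auto simp: V_def)
        moreover have "openin T Y" using T openin_topspace by metis
        ultimately show ?thesis using via_X[of x w Y V] x V by blast
      next
        case False
        obtain N K where N: "openin (arrows G) N" "compactin (arrows G) K" "g \<in> N" "N \<subseteq> K"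
        proof -
          have "locally_compact_space (arrows G)"
            using local_homeomorphism_locally_compact etale_src Hausdorff_objects locally_compact_objects by blast
          then show thesis using gy(1) that unfolding locally_compact_space_def by blast
        qed
        define Kinv where "Kinv = ginv G ` K"
        have Kinv: "compactin (arrows G) Kinv" unfolding Kinv_def using N(2) continuous_ginv by (rule image_compactin)
        define L' where "L' = lact X ` {(h, x). h \<in> Kinv \<and> x \<in> L \<and> src G h = lanchor X x}"
        \<comment> \<open>\<open>L'\<close> is the image of a fibre product of compact sets over the
          Hausdorff space \<open>objects G\<close>, so non-Hausdorff arrows do no harm.\<close>
        have L': "compactin (cspace X) L'" unfolding L'_def
          using compactin_fibre_product[OF Hausdorff_objects continuous_src L.continuous_anchor Kinv compl(2)]
            L.continuous_act by (rule image_compactin)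
        have "L' \<subseteq> XS" using L' by (rule compactin_subset_topspace)
        then have "y \<in> Y - mul L' Y" using False y mul_mono[of L' XS Y Y] by blast
        moreover have "m (g', y') \<in> S" if g': "g' \<in> N" "y' \<in> Y - mul L' Y" "src G g' = a y'" for g' y'
        proof -
          have g'G: "g' \<in> GA" "g' \<in> K" using g'(1) N openin_subset by blast+
          have "m (g', y') \<notin> mul L Y"
          proof
            assume "m (g', y') \<in> mul L Y"
            then obtain l w where l: "l \<in> L" "w \<in> Y" "ranchor X l = a w" "m (g', y') = n (l, w)" by (auto elim!: mulE)
            have lX: "l \<in> XS" using l(1) compl(2) compactin_subset_topspace by blast
            have anc: "lanchor X l = rng G g'"
              using anchor_mult[OF lX l(2,3)] anchor_act[of g' y'] g'G g' l(4) by simp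
            have "y' = m (ginv G g', n (l, w))" using act_inv[of g' y'] g'G g' l(4) by simp
            also have "\<dots> = n (lact X (ginv G g', l), w)"
              using lX l anc g'G by (intro act_mult) (simp_all add: ginv_closed src_ginv)
            finally have "y' = n (lact X (ginv G g', l), w)" .
            moreover have "lact X (ginv G g', l) \<in> L'"
              unfolding L'_def Kinv_def using g'G l(1) anc by (auto simp: src_ginv intro!: imageI)
            moreover have "ranchor X (lact X (ginv G g', l)) = a w"
              using lX l anc g'G by (simp add: ginv_closed src_ginv)
            ultimately show False using g'(2) l(2) mulI by blast
          qed
          then show ?thesis using compl(1) act_in[of g' y'] g'G g' by simp
        qed
        ultimately show ?thesis using N openin_refine_compl[OF L', of T] by blast
      qed
    qed
  qed
  then show ?thesis by (simp add: refine_def)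
qed

lemma level_props:
  "topspace (level k) = Y \<and> continuous_map (level k) (objects G) a \<and>
   continuous_map (fibre_product (arrows G) (src G) a (level k)) (level k) m"
proof (cases k)
  case 0
  have top: "topspace (pullback_topology Y a (objects G)) = Y"
    using anchor_unit by (auto simp: topspace_pullback_topology)
  have anc: "continuous_map (pullback_topology Y a (objects G)) (objects G) a"
    using continuous_map_pullback[of "objects G" "objects G" id Y a] by simp
  have "continuous_map (fibre_product (arrows G) (src G) a (level 0)) (level 0) m"
  proof (rule continuous_map_fibre_productI)
    fix g y S assume gy: "g \<in> GA" "y \<in> topspace (level 0)" "src G g = a y" "openin (level 0) S" "m (g, y) \<in> S"
    then obtain U where U: "openin (objects G) U" "S = a -` U \<inter> Y" by (auto simp: openin_pullback_topology)
    have "openin (arrows G) {g \<in> GA. rng G g \<in> U}"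
      using continuous_rng U(1) unfolding continuous_map_def by blast
    moreover have "rng G g \<in> U" using gy U anchor_act top by auto
    moreover have "m (g', y') \<in> S" if "g' \<in> {g \<in> GA. rng G g \<in> U}" "y' \<in> Y" "src G g' = a y'" for g' y'
      using that U(2) anchor_act act_in by simp
    ultimately show "\<exists>V W. openin (arrows G) V \<and> openin (level 0) W \<and> g \<in> V \<and> y \<in> W \<and>
        (\<forall>g' y'. g' \<in> V \<longrightarrow> y' \<in> W \<longrightarrow> src G g' = a y' \<longrightarrow> m (g', y') \<in> S)"
      using gy top by (intro exI[of _ "{g \<in> GA. rng G g \<in> U}"] exI[of _ Y])
        (metis (no_types, lifting) level.simps(1) mem_Collect_eq openin_topspace)
  qed (use top act_in in simp)
  then show ?thesis using top anc 0 by simp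
next
  case (Suc j)
  have "topspace (level j) = Y"
    by (induction j) (use anchor_unit topspace_refine in \<open>auto simp: topspace_pullback_topology\<close>)
  then show ?thesis using Suc topspace_refine refine_anchor refine_act by simp
qed

lemmas topspace_level = level_props[THEN conjunct1]
  and level_anchor = level_props[THEN conjunct2, THEN conjunct1]
  and level_act = level_props[THEN conjunct2, THEN conjunct2]

lemma level_mult: "continuous_map (corr_domain X a (level k)) (level (Suc k)) n"
  using refine_mult[OF topspace_level level_anchor level_act] by simp

lemma refine_mono:
  assumes "\<And>W. openin T W \<Longrightarrow> openin T' W" and "openin (refine T) S"
  shows "openin (refine T') S"
proof -
  have "refine_basis T \<subseteq> refine_basis T'" unfolding refine_basis_def using assms(1) by blast
  have "generate_topology_on (refine_basis T) S"
    using assms(2) by (simp add: refine_def openin_topology_generated_by_iff)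
  then have "generate_topology_on (refine_basis T') S"
  proof (induction rule: generate_topology_on.induct)
    case (Basis s)
    then show ?case using \<open>refine_basis T \<subseteq> refine_basis T'\<close> by (blast intro: generate_topology_on.Basis)
  qed (blast intro: generate_topology_on.intros)+
  then show ?thesis by (simp add: refine_def openin_topology_generated_by_iff)
qed

text \<open>In general \<open>refine T\<close> does not contain the open sets of \<open>T\<close>.
  For the levels it does, because every refinement contains the anchor preimages with which the
  induction starts, and \<open>refine\<close> is monotone.\<close>

lemma level_Suc_mono: "openin (level k) S \<Longrightarrow> openin (level (Suc k)) S"
proof (induction k arbitrary: S)
  case 0
  then obtain U where U: "openin (objects G) U" "S = a -` U \<inter> Y" by (auto simp: openin_pullback_topology)
  have "openin (level (Suc 0)) {y \<in> Y. a y \<in> U}"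
    using topspace_level level_anchor U(1) by (rule openin_anchor_preimage)
  moreover have "{y \<in> Y. a y \<in> U} = S" using U(2) by blast
  ultimately show ?case by (rule back_subst)
next
  case (Suc k)
  then show ?case using refine_mono[of "level k" "level (Suc k)"] by simp
qed

lemma level_mono: "j \<le> k \<Longrightarrow> openin (level j) S \<Longrightarrow> openin (level k) S"
  by (induction k rule: dec_induct) (auto intro: level_Suc_mono simp del: level.simps)

lemma topspace_coarsest: "topspace coarsest = Y"
proof -
  have "\<Union>(\<Union>k. {W. openin (level k) W}) \<subseteq> Y" using topspace_level openin_subset by blast
  moreover have "openin (level 0) Y" using topspace_level openin_topspace by metis
  ultimately show ?thesis
    unfolding coarsest_def topology_generated_by_topspace by blast
qed

lemma level_coarsest: "openin (level k) W \<Longrightarrow> openin coarsest W"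
  unfolding coarsest_def by (rule topology_generated_by_Basis) auto

text \<open>The levels increase, so a finite intersection of sets from several levels is open at the
  highest of them. The union of the levels is therefore a base, and neighbourhood arguments take
  place at a single level.\<close>

lemma coarsest_nhds:
  assumes "openin coarsest S" "y \<in> S"
  obtains k W where "openin (level k) W" "y \<in> W" "W \<subseteq> S"
proof -
  have "generate_topology_on (\<Union>k. {W. openin (level k) W}) S"
    using assms(1) by (simp add: coarsest_def openin_topology_generated_by_iff)
  then have "\<exists>k W. openin (level k) W \<and> y \<in> W \<and> W \<subseteq> S" using assms(2)
  proof (induction rule: generate_topology_on.induct)
    case (Int b c)
    then obtain j k V W where "openin (level j) V" "y \<in> V" "V \<subseteq> b" "openin (level k) W" "y \<in> W" "W \<subseteq> c"
      by blast
    moreover from this have "openin (level (max j k)) (V \<inter> W)"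
      using level_mono[of j "max j k" V] level_mono[of k "max j k" W] by auto
    ultimately show ?case by (metis IntI Int_mono)
  next
    case (UN K)
    then obtain k where k: "k \<in> K" "y \<in> k" by blast
    then obtain j W where "openin (level j) W" "y \<in> W" "W \<subseteq> k" using UN.IH by blast
    then show ?case using k(1) by (meson Union_upper order_trans)
  qed auto
  then show thesis using that by blast
qed

lemma corr_action_coarsest: "corr_action G X R coarsest a m n"
proof (rule corr_actionI)
  show "topspace coarsest = Y" by (rule topspace_coarsest)
  show "continuous_map coarsest (objects G) a"
    unfolding continuous_map_def
  proof (intro conjI allI impI)
    show "a \<in> topspace coarsest \<rightarrow> topspace (objects G)" using anchor_unit topspace_coarsest by simp
    fix U assume "openin (objects G) U"
    then have "openin coarsest {y \<in> Y. a y \<in> U}"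
      using openin_anchor_preimage[OF topspace_level level_anchor] level_coarsest by blast
    then show "openin coarsest {y \<in> topspace coarsest. a y \<in> U}" using topspace_coarsest by simp
  qed
  show "continuous_map (fibre_product (arrows G) (src G) a coarsest) coarsest m"
  proof (rule continuous_map_fibre_productI)
    fix g y S assume gy: "g \<in> GA" "y \<in> topspace coarsest" "src G g = a y" "openin coarsest S" "m (g, y) \<in> S"
    then obtain k O' where O': "openin (level k) O'" "m (g, y) \<in> O'" "O' \<subseteq> S" by (metis coarsest_nhds)
    have y: "y \<in> topspace (level k)" using gy(2) topspace_coarsest topspace_level by simp
    obtain N W where "openin (arrows G) N" "openin (level k) W" "g \<in> N" "y \<in> W"
      "\<And>g' y'. \<lbrakk>g' \<in> N; y' \<in> W; src G g' = a y'\<rbrakk> \<Longrightarrow> m (g', y') \<in> O'"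
      using continuous_map_fibre_productD[OF level_act gy(1) y gy(3) O'(1,2)] by metis
    then show "\<exists>V W. openin (arrows G) V \<and> openin coarsest W \<and> g \<in> V \<and> y \<in> W \<and>
        (\<forall>g' y'. g' \<in> V \<longrightarrow> y' \<in> W \<longrightarrow> src G g' = a y' \<longrightarrow> m (g', y') \<in> S)"
      using O'(3) level_coarsest by (meson subsetD)
  qed (use topspace_coarsest act_in in simp)
  show "continuous_map (corr_domain X a coarsest) coarsest n"
    unfolding corr_domain_def
  proof (rule continuous_map_fibre_productI)
    fix x y S assume xy: "x \<in> XS" "y \<in> topspace coarsest" "ranchor X x = a y" "openin coarsest S" "n (x, y) \<in> S"
    then obtain k O' where O': "openin (level k) O'" "n (x, y) \<in> O'" "O' \<subseteq> S" by (metis coarsest_nhds)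
    have y: "y \<in> topspace (level k)" using xy(2) topspace_coarsest topspace_level by simp
    \<comment> \<open>\<open>level_mult\<close> leads from level \<open>k\<close> to level
      \<open>Suc k\<close>, so the target set is first regarded as open one level higher.\<close>
    obtain V W where "openin (cspace X) V" "openin (level k) W" "x \<in> V" "y \<in> W"
      "\<And>x' y'. \<lbrakk>x' \<in> V; y' \<in> W; ranchor X x' = a y'\<rbrakk> \<Longrightarrow> n (x', y') \<in> O'"
      using continuous_map_fibre_productD[OF level_mult[unfolded corr_domain_def] xy(1) y xy(3)
          level_Suc_mono[OF O'(1)] O'(2)] by metis
    then show "\<exists>V W. openin (cspace X) V \<and> openin coarsest W \<and> x \<in> V \<and> y \<in> W \<and>
        (\<forall>x' y'. x' \<in> V \<longrightarrow> y' \<in> W \<longrightarrow> ranchor X x' = a y' \<longrightarrow> n (x', y') \<in> S)"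
      using O'(3) level_coarsest by (meson subsetD)
  qed (use topspace_coarsest mult_in in simp)
next
  fix V W assume VW: "openin (cspace X) V" "openin coarsest W"
  show "openin coarsest (mul V W)"
  proof (subst openin_subopen, intro ballI)
    fix z assume "z \<in> mul V W"
    then obtain x y where xy: "x \<in> V" "y \<in> W" "ranchor X x = a y" "z = n (x, y)" by (rule mulE)
    obtain k O' where O': "openin (level k) O'" "y \<in> O'" "O' \<subseteq> W" using coarsest_nhds[OF VW(2) xy(2)] .
    have "openin (level (Suc k)) (mul V O')" using openin_refine_mul[OF VW(1) O'(1)] by simp
    then have "openin coarsest (mul V O')" by (rule level_coarsest)
    moreover have "z \<in> mul V O'" using xy O' mulI by simp
    moreover have "mul V O' \<subseteq> mul V W" using O' by (intro mul_mono) auto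
    ultimately show "\<exists>T. openin coarsest T \<and> z \<in> T \<and> T \<subseteq> mul V W" by blast
  qed
next
  fix L assume L: "compactin (cspace X) L"
  have "openin (level (Suc 0)) (Y - mul L Y)" using openin_refine_compl[OF L, of "level 0"] by simp
  then have "openin coarsest (Y - mul L Y)" by (rule level_coarsest)
  moreover have "mul L Y \<subseteq> Y" using L compactin_subset_topspace by (intro mul_subset) auto
  ultimately show "closedin coarsest (mul L Y)" by (simp add: closedin_def topspace_coarsest)
qed

end

subsection \<open>Compactness over compact sets of objects\<close>

text \<open>An ideal of sets is thought of as the dual of a filter; it clusters at \<open>z\<close> if the image of
  the filter in \<open>G\<^sup>0\<close> clusters there.  In the application, the ideal consists of the
  sets that are covered by finitely many members of a given open cover.\<close>

definition set_ideal :: "('a set \<Rightarrow> bool) \<Rightarrow> bool" where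
  "set_ideal I \<longleftrightarrow> I {} \<and> (\<forall>S T. I S \<longrightarrow> T \<subseteq> S \<longrightarrow> I T) \<and> (\<forall>S T. I S \<longrightarrow> I T \<longrightarrow> I (S \<union> T))"

lemma set_ideal_mono: "\<lbrakk>set_ideal I; I S; T \<subseteq> S\<rbrakk> \<Longrightarrow> I T"
  unfolding set_ideal_def by blast

lemma set_ideal_Un: "\<lbrakk>set_ideal I; I S; I T\<rbrakk> \<Longrightarrow> I (S \<union> T)"
  unfolding set_ideal_def by blast

lemma set_ideal_Union:
  assumes "set_ideal I" "finite A" "\<And>x. x \<in> A \<Longrightarrow> I (f x)"
  shows "I (\<Union>x\<in>A. f x)"
  using assms(2,3)
proof (induction A)
  case empty
  then show ?case using assms(1) by (simp add: set_ideal_def)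
next
  case (insert x A)
  then show ?case using assms(1) set_ideal_Un[of I "f x" "\<Union>x\<in>A. f x"] by simp
qed

context set_action
begin

text \<open>Dual to restricting a filter to products with first letter close to \<open>x\<close> and
  then passing to the second factor. The definition is made so that a cluster point \<open>w\<close>
  over \<open>ranchor X x\<close> yields the cluster point \<open>n (x, w)\<close> of
  \<open>I\<close>.\<close>

definition pull :: "'x \<Rightarrow> ('y set \<Rightarrow> bool) \<Rightarrow> 'y set \<Rightarrow> bool" where
  "pull x I S \<longleftrightarrow> (\<exists>V. openin (cspace X) V \<and> x \<in> V \<and> I (mul V S))"

definition clusters :: "('y set \<Rightarrow> bool) \<Rightarrow> 'g \<Rightarrow> bool" where
  "clusters I z \<longleftrightarrow> (\<forall>U. openin (objects G) U \<longrightarrow> z \<in> U \<longrightarrow> \<not> I {y \<in> Y. a y \<in> U})"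

lemma set_ideal_pull:
  assumes I: "set_ideal I" and x: "x \<in> XS"
  shows "set_ideal (pull x I)"
  unfolding set_ideal_def
proof (intro conjI allI impI)
  have "mul XS {} = {}" by (simp add: mul_def)
  then have "I (mul XS {})" using I by (simp add: set_ideal_def)
  then show "pull x I {}" unfolding pull_def using x by blast
next
  fix S T assume "pull x I S" "T \<subseteq> S"
  then obtain V where V: "openin (cspace X) V" "x \<in> V" "I (mul V S)" unfolding pull_def by blast
  then have "I (mul V T)" using set_ideal_mono[OF I V(3)] mul_mono[OF subset_refl \<open>T \<subseteq> S\<close>] by blast
  then show "pull x I T" unfolding pull_def using V by blast
next
  fix S T assume "pull x I S" "pull x I T"
  then obtain V W where V: "openin (cspace X) V" "x \<in> V" "I (mul V S)"
    and W: "openin (cspace X) W" "x \<in> W" "I (mul W T)" unfolding pull_def by blast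
  have "mul (V \<inter> W) (S \<union> T) \<subseteq> mul V S \<union> mul W T" by (auto simp: mul_def)
  then have "I (mul (V \<inter> W) (S \<union> T))" using set_ideal_mono[OF I set_ideal_Un[OF I V(3) W(3)]] by blast
  moreover have "openin (cspace X) (V \<inter> W)" using V(1) W(1) by blast
  ultimately show "pull x I (S \<union> T)" unfolding pull_def using V(2) W(2) by blast
qed

text \<open>Otherwise each \<open>x\<close> in \<open>L\<close> has a neighbourhood whose products
  are negligible for \<open>I\<close> near \<open>z\<close>: if \<open>x\<close> lies over
  \<open>z\<close> by assumption, and else because \<open>objects G\<close> is Hausdorff. Finitely
  many of these neighbourhoods cover \<open>L\<close>, so \<open>mul L Y\<close> is negligible near
  \<open>z\<close>.\<close>

lemma clusters_step:
  assumes I: "set_ideal I" and z: "z \<in> units G" and L: "compactin (cspace X) L"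
    and nI: "\<And>U. \<lbrakk>openin (objects G) U; z \<in> U\<rbrakk> \<Longrightarrow> \<not> I ({y \<in> Y. a y \<in> U} \<inter> mul L Y)"
  obtains x where "x \<in> L" "lanchor X x = z" "clusters (pull x I) (ranchor X x)"
proof -
  have LX: "L \<subseteq> XS" using L by (rule compactin_subset_topspace)
  have "\<exists>x\<in>L. lanchor X x = z \<and> (\<forall>V. openin (cspace X) V \<longrightarrow> x \<in> V \<longrightarrow> \<not> I (mul V Y))"
  proof (rule ccontr)
    assume contra: "\<not> ?thesis"
    define P where "P = (\<lambda>x V U. openin (cspace X) V \<and> x \<in> V \<and> openin (objects G) U \<and> z \<in> U \<and>
        I ({y \<in> Y. a y \<in> U} \<inter> mul V Y))"
    have "\<exists>V U. P x V U" if x: "x \<in> L" for x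
    proof (cases "lanchor X x = z")
      case True
      then obtain V where V: "openin (cspace X) V" "x \<in> V" "I (mul V Y)" using contra x by blast
      have "I ({y \<in> Y. a y \<in> units G} \<inter> mul V Y)" using set_ideal_mono[OF I V(3)] by blast
      moreover have "openin (objects G) (units G)" using openin_topspace[of "objects G"] by simp
      ultimately show ?thesis unfolding P_def using V z by blast
    next
      case False
      have "lanchor X x \<in> topspace (objects G)" "z \<in> topspace (objects G)" using x LX z by auto
      then obtain U1 U where U: "openin (objects G) U1" "openin (objects G) U" "lanchor X x \<in> U1" "z \<in> U" "U1 \<inter> U = {}"
        using Hausdorff_separate[OF Hausdorff_objects _ _ False] by metis
      define V where "V = {x \<in> XS. lanchor X x \<in> U1}"
      have "openin (cspace X) V" using L.continuous_anchor U(1) unfolding continuous_map_def V_def by blast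
      moreover have "{y \<in> Y. a y \<in> U} \<inter> mul V Y = {}" using U(5) by (auto simp: mul_def V_def anchor_mult)
      ultimately show ?thesis unfolding P_def using U x LX I
        by (intro exI[of _ V] exI[of _ U]) (auto simp: V_def set_ideal_def)
    qed
    then obtain v u where vu: "\<And>x. x \<in> L \<Longrightarrow> P x (v x) (u x)" by metis
    have "\<forall>W\<in>v ` L. openin (cspace X) W" "L \<subseteq> \<Union>(v ` L)" using vu unfolding P_def by blast+
    then obtain \<F> where F: "finite \<F>" "\<F> \<subseteq> v ` L" "L \<subseteq> \<Union>\<F>"
      using L unfolding compactin_def by meson
    then obtain A where A: "finite A" "A \<subseteq> L" "\<F> = v ` A" by (metis finite_subset_image)
    \<comment> \<open>Intersecting with \<open>units G\<close> takes care of empty \<open>A\<close>,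
      where the second intersection is the whole type.\<close>
    define U where "U = units G \<inter> (\<Inter>x\<in>A. u x)"
    have "openin (objects G) U"
      unfolding U_def using A vu openin_topspace[of "objects G"]
      by (cases "A = {}") (auto simp: P_def intro!: openin_Int openin_Inter)
    moreover have "z \<in> U" unfolding U_def using A vu z by (auto simp: P_def)
    moreover have "I (\<Union>x\<in>A. {y \<in> Y. a y \<in> u x} \<inter> mul (v x) Y)"
      using I A(1) by (rule set_ideal_Union) (use A vu in \<open>auto simp: P_def\<close>)
    then have "I ({y \<in> Y. a y \<in> U} \<inter> mul L Y)"
    proof (rule set_ideal_mono[OF I])
      show "{y \<in> Y. a y \<in> U} \<inter> mul L Y \<subseteq> (\<Union>x\<in>A. {y \<in> Y. a y \<in> u x} \<inter> mul (v x) Y)"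
      proof
        fix w assume w: "w \<in> {y \<in> Y. a y \<in> U} \<inter> mul L Y"
        then obtain l y where l: "l \<in> L" "y \<in> Y" "ranchor X l = a y" "w = n (l, y)" by (auto elim: mulE)
        then obtain x where x: "x \<in> A" "l \<in> v x" using F(3) A(3) by auto
        then have "w \<in> mul (v x) Y" using l mulI by simp
        then show "w \<in> (\<Union>x\<in>A. {y \<in> Y. a y \<in> u x} \<inter> mul (v x) Y)" using w x(1) by (auto simp: U_def)
      qed
    qed
    ultimately show False using nI by blast
  qed
  then obtain x where x: "x \<in> L" "lanchor X x = z"
    "\<And>V. \<lbrakk>openin (cspace X) V; x \<in> V\<rbrakk> \<Longrightarrow> \<not> I (mul V Y)" by blast
  have "clusters (pull x I) (ranchor X x)"
    unfolding clusters_def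
  proof (intro allI impI notI)
    fix U assume U: "openin (objects G) U" "ranchor X x \<in> U" and "pull x I {y \<in> Y. a y \<in> U}"
    then obtain V where V: "openin (cspace X) V" "x \<in> V" "I (mul V {y \<in> Y. a y \<in> U})"
      unfolding pull_def by blast
    \<comment> \<open>The two anchors in a product agree, so restricting the first factor to right
      anchors in \<open>U\<close> puts the second factor over \<open>U\<close>.\<close>
    define V' where "V' = V \<inter> {x \<in> XS. ranchor X x \<in> U}"
    have "openin (cspace X) {x \<in> XS. ranchor X x \<in> U}"
      using Rt.continuous_anchor U(1) unfolding continuous_map_def by blast
    then have V': "openin (cspace X) V'" "x \<in> V'" using V U x LX by (auto simp: V'_def)
    have "mul V' Y \<subseteq> mul V {y \<in> Y. a y \<in> U}" by (force simp: mul_def V'_def)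
    then have "I (mul V' Y)" using set_ideal_mono[OF I V(3)] by blast
    then show False using x(3) V' by blast
  qed
  then show thesis using that x by blast
qed

text \<open>No set \<open>mul V W\<close> contains a root. Near \<open>y\<close> only the anchor
  preimages and the complements of sets \<open>mul L Y\<close> matter, and finite intersections of
  these again have the stated form.\<close>

lemma root_nhds:
  assumes y: "y \<in> Y" "y \<notin> mul XS Y" and S: "openin coarsest S" "y \<in> S"
  obtains U L where "openin (objects G) U" "a y \<in> U" "compactin (cspace X) L"
    "{w \<in> Y. a w \<in> U} - mul L Y \<subseteq> S"
proof -
  define P where "P = (\<lambda>S. \<exists>U L. openin (objects G) U \<and> a y \<in> U \<and> compactin (cspace X) L \<and>
    {w \<in> Y. a w \<in> U} - mul L Y \<subseteq> S)"
  obtain k W where W: "openin (level k) W" "y \<in> W" "W \<subseteq> S" using coarsest_nhds[OF S] .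
  \<comment> \<open>Going up one level makes \<open>W\<close> a set generated by a
    \<open>refine_basis\<close>, which level 0 does not provide.\<close>
  have "openin (refine (level k)) W" using level_Suc_mono[OF W(1)] by simp
  then have "generate_topology_on (refine_basis (level k)) W"
    by (simp add: refine_def openin_topology_generated_by_iff)
  then have "P W" using W(2)
  proof (induction rule: generate_topology_on.induct)
    case Empty
    then show ?case by simp
  next
    case (Int b c)
    then obtain U L U' L' where UL: "openin (objects G) U" "a y \<in> U" "compactin (cspace X) L"
        "{w \<in> Y. a w \<in> U} - mul L Y \<subseteq> b" "openin (objects G) U'" "a y \<in> U'" "compactin (cspace X) L'"
        "{w \<in> Y. a w \<in> U'} - mul L' Y \<subseteq> c" unfolding P_def by blast
    have "mul L Y \<subseteq> mul (L \<union> L') Y" "mul L' Y \<subseteq> mul (L \<union> L') Y" by (auto simp: mul_def)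
    then have "{w \<in> Y. a w \<in> U \<inter> U'} - mul (L \<union> L') Y \<subseteq> b \<inter> c" using UL by blast
    then show ?case unfolding P_def using UL
      by (intro exI[of _ "U \<inter> U'"] exI[of _ "L \<union> L'"]) (auto intro: compactin_Un)
  next
    case (UN K)
    then obtain b where b: "b \<in> K" "y \<in> b" by blast
    then have "P b" using UN by blast
    then show ?case unfolding P_def using b(1) by (meson Union_upper order_trans)
  next
    case (Basis b)
    then consider (anchor) U where "b = {y \<in> Y. a y \<in> U}" "openin (objects G) U"
      | (compl) L where "b = Y - mul L Y" "compactin (cspace X) L"
      | (mul) V W where "b = mul V W" "openin (cspace X) V" "openin (level k) W"
      unfolding refine_basis_def by blast
    then show ?case
    proof cases
      case anchor
      have "compactin (cspace X) {}" by simp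
      then show ?thesis using anchor Basis(2) unfolding P_def by blast
    next
      case compl
      have "openin (objects G) (units G)" using openin_topspace[of "objects G"] by simp
      then show ?thesis using compl y(1) anchor_unit unfolding P_def by blast
    next
      case mul
      have "V \<subseteq> XS" "W \<subseteq> Y" using openin_subset[OF mul(2)] openin_subset[OF mul(3)] topspace_level by auto
      then have "y \<in> mul XS Y" using Basis(2) mul(1) mul_mono by blast
      then show ?thesis using y(2) by blast
    qed
  qed
  then show thesis using that W(3) unfolding P_def by blast
qed

definition cluster_point :: "('y set \<Rightarrow> bool) \<Rightarrow> 'y \<Rightarrow> bool" where
  "cluster_point I y \<longleftrightarrow> (\<forall>S. openin coarsest S \<longrightarrow> y \<in> S \<longrightarrow> \<not> I S)"

text \<open>If no compact set of first letters carries the ideal near \<open>z\<close>, a root over \<open>z\<close> is a cluster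
  point.  Otherwise, a cluster point of some pulled back ideal produces one of the original ideal.
  If this never stops, the letters found on the way form an infinite path.\<close>

lemma cluster_point_exists:
  assumes reg: "\<And>z. z \<in> R \<Longrightarrow> z \<in> units G \<Longrightarrow> \<exists>U L. openin (objects G) U \<and> z \<in> U \<and> compactin (cspace X) L \<and>
      {y \<in> Y. a y \<in> U} \<subseteq> mul L Y"
    and roots: "\<And>z. \<lbrakk>z \<in> units G; z \<notin> R\<rbrakk> \<Longrightarrow> \<exists>y\<in>Y. a y = z \<and> y \<notin> mul XS Y"
    and paths: "\<And>\<xi>. (\<And>i. \<xi> i \<in> XS \<and> ranchor X (\<xi> i) = lanchor X (\<xi> (Suc i))) \<Longrightarrow>
      \<exists>\<omega>. \<forall>i::nat. \<omega> i \<in> Y \<and> ranchor X (\<xi> i) = a (\<omega> (Suc i)) \<and> \<omega> i = n (\<xi> i, \<omega> (Suc i))"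
    and I: "set_ideal I" and z: "z \<in> units G" and cl: "clusters I z"
  shows "\<exists>y\<in>Y. a y = z \<and> cluster_point I y"
proof (rule ccontr)
  \<comment> \<open>A bad pair is a counterexample to the lemma. The proof shows that each bad pair
    has a bad successor along some letter, and then refutes an infinite chain of them.\<close>
  define bad where "bad = (\<lambda>(I, z). set_ideal I \<and> z \<in> units G \<and> clusters I z \<and>
    \<not> (\<exists>y\<in>Y. a y = z \<and> cluster_point I y))"
  define follows where "follows = (\<lambda>(I, z) (I', z') x. x \<in> XS \<and> lanchor X x = z \<and> z' = ranchor X x \<and> I' = pull x I)"
  assume "\<not> ?thesis"
  then have start: "bad (I, z)" using I z cl by (simp add: bad_def)
  have step: "\<exists>q. bad q \<and> (\<exists>x. follows p q x)" if p: "bad p" for p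
  proof -
    obtain I z where Iz: "p = (I, z)" by force
    have I: "set_ideal I" and z: "z \<in> units G" and cl: "clusters I z"
      and no: "\<And>y. \<lbrakk>y \<in> Y; a y = z\<rbrakk> \<Longrightarrow> \<not> cluster_point I y"
      using p Iz by (auto simp: bad_def)
    have "\<exists>L. compactin (cspace X) L \<and>
        (\<forall>U. openin (objects G) U \<longrightarrow> z \<in> U \<longrightarrow> \<not> I ({y \<in> Y. a y \<in> U} \<inter> mul L Y))"
    proof (rule ccontr)
      assume "\<not> ?thesis"
      then have small: "\<And>L. compactin (cspace X) L \<Longrightarrow>
          \<exists>U. openin (objects G) U \<and> z \<in> U \<and> I ({y \<in> Y. a y \<in> U} \<inter> mul L Y)" by blast
      show False
      \<comment> \<open>Over \<open>R\<close>, regularity puts all points near \<open>z\<close> into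
        one set \<open>mul L Y\<close>. Outside \<open>R\<close>, a root over \<open>z\<close> that
        is not a cluster point has a negligible neighbourhood, which omits only some
        \<open>mul L Y\<close> near \<open>z\<close>. Since \<open>mul L Y\<close> is negligible
        near \<open>z\<close>, in both cases \<open>I\<close> cannot cluster at
        \<open>z\<close>.\<close>
      proof (cases "z \<in> R")
        case True
        then obtain U L where U: "openin (objects G) U" "z \<in> U" "compactin (cspace X) L"
          "{y \<in> Y. a y \<in> U} \<subseteq> mul L Y" using reg z by blast
        obtain U' where U': "openin (objects G) U'" "z \<in> U'" "I ({y \<in> Y. a y \<in> U'} \<inter> mul L Y)"
          using small[OF U(3)] by blast
        have "I {y \<in> Y. a y \<in> U \<inter> U'}"
          by (rule set_ideal_mono[OF I U'(3)]) (use U(4) in blast)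
        moreover have "openin (objects G) (U \<inter> U')" using U U' by blast
        ultimately show False using cl U(2) U'(2) unfolding clusters_def by blast
      next
        case False
        then obtain y where y: "y \<in> Y" "a y = z" "y \<notin> mul XS Y" using roots z by blast
        then obtain S where S: "openin coarsest S" "y \<in> S" "I S" using no unfolding cluster_point_def by blast
        obtain U L where U: "openin (objects G) U" "a y \<in> U" "compactin (cspace X) L"
          "{w \<in> Y. a w \<in> U} - mul L Y \<subseteq> S" using root_nhds[OF y(1,3) S(1,2)] .
        obtain U' where U': "openin (objects G) U'" "z \<in> U'" "I ({y \<in> Y. a y \<in> U'} \<inter> mul L Y)"
          using small[OF U(3)] by blast
        have "I {y \<in> Y. a y \<in> U \<inter> U'}"
          by (rule set_ideal_mono[OF I set_ideal_Un[OF I S(3) U'(3)]]) (use U(4) in blast)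
        moreover have "openin (objects G) (U \<inter> U')" using U U' by blast
        ultimately show False using cl U(2) U'(2) y(2) unfolding clusters_def by blast
      qed
    qed
    then obtain L where L: "compactin (cspace X) L"
      "\<And>U. \<lbrakk>openin (objects G) U; z \<in> U\<rbrakk> \<Longrightarrow> \<not> I ({y \<in> Y. a y \<in> U} \<inter> mul L Y)" by blast
    obtain x where x: "x \<in> L" "lanchor X x = z" "clusters (pull x I) (ranchor X x)"
      using clusters_step[OF I z L] by metis
    have xX: "x \<in> XS" using x(1) L(1) compactin_subset_topspace by blast
    \<comment> \<open>A cluster point of the pulled back ideal would give one of \<open>I\<close> by
      multiplying with \<open>x\<close>, because \<open>n\<close> is continuous for the coarsest
      topology.\<close>
    have "\<not> cluster_point (pull x I) w" if w: "w \<in> Y" "a w = ranchor X x" for w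
    proof
      assume cp: "cluster_point (pull x I) w"
      have "cluster_point I (n (x, w))"
        unfolding cluster_point_def
      proof (intro allI impI notI)
        fix S assume S: "openin coarsest S" "n (x, w) \<in> S" "I S"
        have "continuous_map (corr_domain X a coarsest) coarsest n"
          using corr_action_coarsest by (rule corr_action.continuous_mult)
        moreover have "w \<in> topspace coarsest" using w topspace_coarsest by simp
        ultimately obtain V W where VW: "openin (cspace X) V" "openin coarsest W" "x \<in> V" "w \<in> W"
          "\<And>x' w'. \<lbrakk>x' \<in> V; w' \<in> W; ranchor X x' = a w'\<rbrakk> \<Longrightarrow> n (x', w') \<in> S"
          using continuous_map_fibre_productD[of "cspace X" "ranchor X" a coarsest coarsest n x w S]
            xX w(2) S(1,2) unfolding corr_domain_def by metis
        have "mul V W \<subseteq> S" using VW(5) by (auto simp: mul_def)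
        then have "pull x I W" unfolding pull_def using VW(1,3) set_ideal_mono[OF I S(3)] by blast
        then show False using cp VW(2,4) unfolding cluster_point_def by blast
      qed
      moreover have "n (x, w) \<in> Y" "a (n (x, w)) = z" using xX w x(2) mult_in anchor_mult by auto
      ultimately show False using no by blast
    qed
    then have "bad (pull x I, ranchor X x)" using set_ideal_pull[OF I xX] x(3) xX by (auto simp: bad_def)
    moreover have "follows p (pull x I, ranchor X x) x" using Iz x(2) xX by (simp add: follows_def)
    ultimately show ?thesis by blast
  qed
  \<comment> \<open>The clause for \<open>i = 0\<close> makes dependent choice start at the given
    pair.\<close>
  have "\<exists>f. \<forall>i::nat. (bad (f i) \<and> (i = 0 \<longrightarrow> f i = (I, z))) \<and> (\<exists>x. follows (f i) (f (Suc i)) x)"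
  proof (rule dependent_nat_choice)
    show "\<exists>p. bad p \<and> ((0::nat) = 0 \<longrightarrow> p = (I, z))" using start by blast
  next
    fix p and i :: nat assume "bad p \<and> (i = 0 \<longrightarrow> p = (I, z))"
    then show "\<exists>q. (bad q \<and> (Suc i = 0 \<longrightarrow> q = (I, z))) \<and> (\<exists>x. follows p q x)" using step[of p] by auto
  qed
  then obtain f where f: "\<And>i::nat. bad (f i)" "f 0 = (I, z)" "\<And>i. \<exists>x. follows (f i) (f (Suc i)) x" by blast
  then obtain \<xi> where \<xi>: "\<And>i. follows (f i) (f (Suc i)) (\<xi> i)" by metis
  have \<xi>': "\<xi> i \<in> XS" "lanchor X (\<xi> i) = snd (f i)" "snd (f (Suc i)) = ranchor X (\<xi> i)"
    "fst (f (Suc i)) = pull (\<xi> i) (fst (f i))" for i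
    using \<xi>[of i] unfolding follows_def by (auto split: prod.splits)
  then have "\<xi> i \<in> XS \<and> ranchor X (\<xi> i) = lanchor X (\<xi> (Suc i))" for i by simp
  then obtain \<omega> where \<omega>: "\<And>i. \<omega> i \<in> Y \<and> ranchor X (\<xi> i) = a (\<omega> (Suc i)) \<and> \<omega> i = n (\<xi> i, \<omega> (Suc i))"
    using paths[of \<xi>] by blast
  have \<omega>a: "a (\<omega> i) = snd (f i)" for i
    using \<omega>[of i] \<omega>[of "Suc i"] \<xi>'[of i] anchor_mult[of "\<xi> i" "\<omega> (Suc i)"] by metis
  have fI: "set_ideal (fst (f i)) \<and> clusters (fst (f i)) (snd (f i))" for i
    using f(1)[of i] by (auto simp: bad_def split: prod.splits)
  \<comment> \<open>Induction on the level for all positions at once. A neighbourhood of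
    \<open>\<omega> i\<close> at level \<open>Suc k\<close> pulls back along the letter
    \<open>\<xi> i\<close> to a neighbourhood of \<open>\<omega> (Suc i)\<close> at level
    \<open>k\<close>; at level 0 only the anchor matters, and there the ideal clusters.\<close>
  have lev: "\<not> fst (f i) S" if "openin (level k) S" "\<omega> i \<in> S" for k i S
    using that
  proof (induction k arbitrary: i S)
    case 0
    then obtain U where U: "openin (objects G) U" "S = a -` U \<inter> Y" by (auto simp: openin_pullback_topology)
    have "S = {y \<in> Y. a y \<in> U}" using U(2) by blast
    moreover have "snd (f i) \<in> U" using 0(2) U(2) \<omega>a by simp
    ultimately show ?case using fI[of i] U(1) unfolding clusters_def by blast
  next
    case (Suc k)
    have w: "\<omega> (Suc i) \<in> topspace (level k)" "ranchor X (\<xi> i) = a (\<omega> (Suc i))" "n (\<xi> i, \<omega> (Suc i)) \<in> S"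
      using \<omega>[of i] \<omega>[of "Suc i"] Suc(3) topspace_level by metis+
    obtain V W where VW: "openin (cspace X) V" "openin (level k) W" "\<xi> i \<in> V" "\<omega> (Suc i) \<in> W"
      "\<And>x' w'. \<lbrakk>x' \<in> V; w' \<in> W; ranchor X x' = a w'\<rbrakk> \<Longrightarrow> n (x', w') \<in> S"
      using continuous_map_fibre_productD[OF level_mult[unfolded corr_domain_def] \<xi>'(1) w(1,2) Suc(2) w(3)] by metis
    have "\<not> pull (\<xi> i) (fst (f i)) W" using Suc(1)[OF VW(2,4)] \<xi>'(4) by simp
    then have "\<not> fst (f i) (mul V W)" unfolding pull_def using VW(1,3) by blast
    moreover have "mul V W \<subseteq> S" using VW(5) by (auto simp: mul_def)
    ultimately show ?case using fI[of i] set_ideal_mono by blast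
  qed
  have "cluster_point I (\<omega> 0)"
    unfolding cluster_point_def
  proof (intro allI impI notI)
    fix S assume S: "openin coarsest S" "\<omega> 0 \<in> S" "I S"
    obtain k W where "openin (level k) W" "\<omega> 0 \<in> W" "W \<subseteq> S" using coarsest_nhds[OF S(1,2)] .
    then show False using lev[of k W 0] f(2) set_ideal_mono[OF I S(3)] by auto
  qed
  then show False using start \<omega>[of 0] \<omega>a[of 0] f(2) by (auto simp: bad_def)
qed

text \<open>The sets whose part over \<open>C\<close> has a finite subcover form an ideal. If it
  does not contain \<open>Y\<close>, compactness of \<open>C\<close> gives an object where it
  clusters, hence a cluster point over \<open>C\<close>. Some member of the cover contains that
  point, but each member lies in the ideal.\<close>

theorem compactin_coarsest:
  assumes reg: "\<And>z. z \<in> R \<Longrightarrow> z \<in> units G \<Longrightarrow> \<exists>U L. openin (objects G) U \<and> z \<in> U \<and> compactin (cspace X) L \<and>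
      {y \<in> Y. a y \<in> U} \<subseteq> mul L Y"
    and roots: "\<And>z. \<lbrakk>z \<in> units G; z \<notin> R\<rbrakk> \<Longrightarrow> \<exists>y\<in>Y. a y = z \<and> y \<notin> mul XS Y"
    and paths: "\<And>\<xi>. (\<And>i. \<xi> i \<in> XS \<and> ranchor X (\<xi> i) = lanchor X (\<xi> (Suc i))) \<Longrightarrow>
      \<exists>\<omega>. \<forall>i::nat. \<omega> i \<in> Y \<and> ranchor X (\<xi> i) = a (\<omega> (Suc i)) \<and> \<omega> i = n (\<xi> i, \<omega> (Suc i))"
    and C: "compactin (objects G) C"
  shows "compactin coarsest {y \<in> Y. a y \<in> C}"
  unfolding compactin_def
proof (intro conjI allI impI)
  show "{y \<in> Y. a y \<in> C} \<subseteq> topspace coarsest" using topspace_coarsest by auto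
  fix \<U> assume \<U>: "(\<forall>U\<in>\<U>. openin coarsest U) \<and> {y \<in> Y. a y \<in> C} \<subseteq> \<Union>\<U>"
  define I where "I = (\<lambda>S. \<exists>\<F>. finite \<F> \<and> \<F> \<subseteq> \<U> \<and> S \<inter> {y \<in> Y. a y \<in> C} \<subseteq> \<Union>\<F>)"
  have I: "set_ideal I"
    unfolding set_ideal_def
  proof (intro conjI allI impI)
    show "I {}" unfolding I_def by (intro exI[of _ "{}"]) simp
  next
    fix S T assume "I S" "T \<subseteq> S"
    then show "I T" unfolding I_def by blast
  next
    fix S T assume "I S" "I T"
    then obtain \<F> \<F>' where "finite \<F>" "\<F> \<subseteq> \<U>" "S \<inter> {y \<in> Y. a y \<in> C} \<subseteq> \<Union>\<F>"
      "finite \<F>'" "\<F>' \<subseteq> \<U>" "T \<inter> {y \<in> Y. a y \<in> C} \<subseteq> \<Union>\<F>'" unfolding I_def by blast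
    then show "I (S \<union> T)" unfolding I_def by (intro exI[of _ "\<F> \<union> \<F>'"]) auto
  qed
  have "I Y"
  proof (rule ccontr)
    assume nI: "\<not> I Y"
    \<comment> \<open>Without such an object, finitely many negligible anchor preimages would
      already account for everything over \<open>C\<close>.\<close>
    have "\<exists>z\<in>C. clusters I z"
    proof (rule ccontr)
      assume "\<not> (\<exists>z\<in>C. clusters I z)"
      then have "\<forall>z\<in>C. \<exists>U. openin (objects G) U \<and> z \<in> U \<and> I {y \<in> Y. a y \<in> U}"
        unfolding clusters_def by blast
      then obtain u where u: "\<And>z. z \<in> C \<Longrightarrow> openin (objects G) (u z) \<and> z \<in> u z \<and> I {y \<in> Y. a y \<in> u z}"
        by metis
      have "\<forall>W\<in>u ` C. openin (objects G) W" "C \<subseteq> \<Union>(u ` C)" using u by blast+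
      then obtain \<F> where F: "finite \<F>" "\<F> \<subseteq> u ` C" "C \<subseteq> \<Union>\<F>"
        using C unfolding compactin_def by meson
      then obtain A where A: "finite A" "A \<subseteq> C" "\<F> = u ` A" by (metis finite_subset_image)
      have "I (\<Union>z\<in>A. {y \<in> Y. a y \<in> u z})"
        using I A(1) by (rule set_ideal_Union) (use A u in blast)
      then obtain \<F>' where F': "finite \<F>'" "\<F>' \<subseteq> \<U>"
        "(\<Union>z\<in>A. {y \<in> Y. a y \<in> u z}) \<inter> {y \<in> Y. a y \<in> C} \<subseteq> \<Union>\<F>'" unfolding I_def by blast
      have "Y \<inter> {y \<in> Y. a y \<in> C} \<subseteq> (\<Union>z\<in>A. {y \<in> Y. a y \<in> u z}) \<inter> {y \<in> Y. a y \<in> C}"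
        using F(3) A(3) by blast
      then have "I Y" unfolding I_def using F' by (meson order_trans)
      then show False using nI by blast
    qed
    then obtain z where z: "z \<in> C" "clusters I z" by blast
    have zu: "z \<in> units G" using z(1) compactin_subset_topspace[OF C] by auto
    obtain y where y: "y \<in> Y" "a y = z" "cluster_point I y"
      using cluster_point_exists[OF reg roots paths I zu z(2)] by blast
    then obtain S where S: "S \<in> \<U>" "y \<in> S" using \<U> z(1) by blast
    have "I S" unfolding I_def using S(1) by (intro exI[of _ "{S}"]) auto
    then show False using y(3) \<U> S unfolding cluster_point_def by blast
  qed
  then obtain \<F> where "finite \<F>" "\<F> \<subseteq> \<U>" "Y \<inter> {y \<in> Y. a y \<in> C} \<subseteq> \<Union>\<F>" unfolding I_def by blast
  then show "\<exists>\<F>. finite \<F> \<and> \<F> \<subseteq> \<U> \<and> {y \<in> Y. a y \<in> C} \<subseteq> \<Union>\<F>" by blast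
qed

text \<open>For regular \<open>X\<close>, the set of first letters over a compact set in \<open>R\<close> is compact.\<close>

lemma regular_on_compact:
  assumes reg: "regular_on G X R" and R: "openin (objects G) R" and z: "z \<in> R"
  shows "\<exists>U L. openin (objects G) U \<and> z \<in> U \<and> compactin (cspace X) L \<and> {y \<in> Y. a y \<in> U} \<subseteq> mul L Y"
proof -
  define P where "P = {C \<in> topspace (orbit_space G X). orbit_lanchor X C \<in> R}"
  have pr: "proper_map (subtopology (orbit_space G X) P) (subtopology (objects G) R) (orbit_lanchor X)"
    using reg unfolding regular_on_def Let_def P_def by blast
  have RU: "R \<subseteq> units G" using R openin_subset by fastforce
  have "locally_compact_space (subtopology (objects G) R)"
    using Hausdorff_objects locally_compact_objects R locally_compact_space_open_subset by blast
  moreover have "z \<in> topspace (subtopology (objects G) R)" using z RU by auto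
  ultimately obtain U C where UC: "openin (subtopology (objects G) R) U"
    "compactin (subtopology (objects G) R) C" "z \<in> U" "U \<subseteq> C"
    unfolding locally_compact_space_def by blast
  have U: "openin (objects G) U" using UC(1) R openin_trans_full by blast
  have UR: "U \<subseteq> R" using openin_subset[OF UC(1)] by simp
  define K where "K = {c \<in> topspace (subtopology (orbit_space G X) P). orbit_lanchor X c \<in> C}"
  have "compactin (subtopology (orbit_space G X) P) K"
    unfolding K_def using pr UC(2) unfolding proper_map_alt by blast
  then have "compactin (orbit_space G X) K" by (simp add: compactin_subtopology)
  then obtain L where L: "compactin (cspace X) L" "orbit_of G X ` L = K" by (rule compact_orbits_lift)
  have "{y \<in> Y. a y \<in> U} \<subseteq> mul L Y"
  proof
    fix y assume y: "y \<in> {y \<in> Y. a y \<in> U}"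
    then obtain x w where x: "x \<in> XS" "w \<in> Y" "ranchor X x = a w" "y = n (x, w)" using covers[of y] UR by blast
    then have "lanchor X x \<in> U" using y anchor_mult[of x w] by simp
    then have "orbit_of G X x \<in> K"
      using x(1) UC(4) UR by (auto simp: K_def P_def topspace_orbit_space)
    then show "y \<in> mul L Y"
      using mul_orbits[OF compactin_subset_topspace[OF L(1)] L(2)] x by blast
  qed
  then show ?thesis using U UC(3) L(1) by blast
qed

end

section \<open>The action on paths\<close>

text \<open>Every \<open>x\<close> is uniquely \<open>rep x \<cdot> coord x\<close> for a chosen representative of its orbit.  A path
  \<open>[x\<^sub>1, x\<^sub>2, \<dots>]\<close> therefore has a normal form that consists of representatives only, obtained by
  moving the coordinates to the right.  Paths are sequences \<open>nat \<Rightarrow> 'x option\<close> that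
  are \<open>None\<close> after the last letter, together with their first vertex.\<close>

context correspondence_setting
begin

definition rep :: "'x \<Rightarrow> 'x" where
  "rep x = (SOME y. y \<in> orbit_of G X x)"

definition coord :: "'x \<Rightarrow> 'g" where
  "coord x = (SOME g. g \<in> GA \<and> ranchor X (rep x) = rng G g \<and> ract X (rep x, g) = x)"

lemma rep_in_orbit: "x \<in> XS \<Longrightarrow> rep x \<in> orbit_of G X x"
  unfolding rep_def using orbit_of_self by (rule someI)

lemma rep_in [simp]: "x \<in> XS \<Longrightarrow> rep x \<in> XS"
  and lanchor_rep [simp]: "x \<in> XS \<Longrightarrow> lanchor X (rep x) = lanchor X x"
  and orbit_of_rep [simp]: "x \<in> XS \<Longrightarrow> orbit_of G X (rep x) = orbit_of G X x"
proof -
  assume x: "x \<in> XS"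
  then obtain g where g: "g \<in> GA" "ranchor X x = rng G g" "rep x = ract X (x, g)"
    using rep_in_orbit[OF x] unfolding orbit_of_def by blast
  then show "rep x \<in> XS" "lanchor X (rep x) = lanchor X x" "orbit_of G X (rep x) = orbit_of G X x"
    using x by (simp_all add: Rt.act_in)
qed

lemma coord:
  assumes "x \<in> XS"
  shows "coord x \<in> GA" "rng G (coord x) = ranchor X (rep x)" "ract X (rep x, coord x) = x"
proof -
  have "\<exists>g. g \<in> GA \<and> ranchor X (rep x) = rng G g \<and> ract X (rep x, g) = x"
    using orbit_of_eq_iff[of "rep x" x] assms by auto
  then have "coord x \<in> GA \<and> ranchor X (rep x) = rng G (coord x) \<and> ract X (rep x, coord x) = x"
    unfolding coord_def by (rule someI_ex)
  then show "coord x \<in> GA" "rng G (coord x) = ranchor X (rep x)" "ract X (rep x, coord x) = x" by auto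
qed

lemma src_coord: "x \<in> XS \<Longrightarrow> src G (coord x) = ranchor X x"
  using Rt.anchor_act[of "rep x" "coord x"] by (metis coord rep_in)

lemma coord_unique:
  assumes "x \<in> XS" "g \<in> GA" "rng G g = ranchor X (rep x)" "ract X (rep x, g) = x"
  shows "coord x = g"
  by (rule ract_cancel[of "rep x"]) (use coord[OF assms(1)] assms in simp_all)

text \<open>The choice in \<open>rep\<close> is made from the orbit as a set, so equal orbits have
  equal representatives.\<close>

lemma rep_ract:
  assumes "x \<in> XS" "g \<in> GA" "ranchor X x = rng G g"
  shows "rep (ract X (x, g)) = rep x"
  unfolding rep_def using assms by simp

lemma coord_ract:
  assumes "x \<in> XS" "g \<in> GA" "ranchor X x = rng G g"
  shows "coord (ract X (x, g)) = gcomp G (coord x) g"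
proof (rule coord_unique)
  show "ract X (rep (ract X (x, g)), gcomp G (coord x) g) = ract X (x, g)"
    unfolding rep_ract[OF assms]
    using assms coord[of x] src_coord[of x] Rt.act_act[of "rep x" "coord x" g] by simp
qed (use assms coord[of x] src_coord[of x] in \<open>simp_all add: Rt.act_in comp_closed rng_comp rep_ract\<close>)

lemma rep_rep [simp]: "x \<in> XS \<Longrightarrow> rep (rep x) = rep x"
  using rep_ract[of "rep x" "coord x"] coord[of x] by simp

lemma coord_of_rep:
  assumes "x \<in> XS" "rep x = x"
  shows "coord x = ranchor X x"
  using assms by (intro coord_unique) (simp_all add: rng_of_unit Rt.unit_act)

text \<open>The arrow that remains after \<open>h\<close> has been carried past the first
  \<open>i\<close> letters: at each letter the product is split into its representative and its
  coordinate, and the coordinate moves on. After the end of the path it is frozen.\<close>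

primrec state :: "'g \<Rightarrow> (nat \<Rightarrow> 'x option) \<Rightarrow> nat \<Rightarrow> 'g" where
  "state h \<sigma> 0 = h"
| "state h \<sigma> (Suc i) = (case \<sigma> i of None \<Rightarrow> state h \<sigma> i | Some x \<Rightarrow> coord (lact X (state h \<sigma> i, x)))"

definition translate :: "'g \<Rightarrow> (nat \<Rightarrow> 'x option) \<Rightarrow> nat \<Rightarrow> 'x option" where
  "translate h \<sigma> i = map_option (\<lambda>x. rep (lact X (state h \<sigma> i, x))) (\<sigma> i)"

primrec vertex :: "'g \<Rightarrow> (nat \<Rightarrow> 'x option) \<Rightarrow> nat \<Rightarrow> 'g" where
  "vertex z \<sigma> 0 = z"
| "vertex z \<sigma> (Suc i) = (case \<sigma> i of None \<Rightarrow> vertex z \<sigma> i | Some x \<Rightarrow> ranchor X x)"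

text \<open>A path may stop only outside \<open>R\<close>, so that over \<open>R\<close> it has a
  first letter, as \<open>covers\<close> demands. The vertex is frozen after the end, which makes
  the stopping condition repeat itself there.\<close>

definition itinerary :: "'g set \<Rightarrow> 'g \<Rightarrow> (nat \<Rightarrow> 'x option) \<Rightarrow> bool" where
  "itinerary R z \<sigma> \<longleftrightarrow> z \<in> units G \<and> (\<forall>i. case \<sigma> i of
     None \<Rightarrow> vertex z \<sigma> i \<notin> R \<and> \<sigma> (Suc i) = None
   | Some x \<Rightarrow> x \<in> XS \<and> lanchor X x = vertex z \<sigma> i)"

definition path_space :: "'g set \<Rightarrow> ('g \<times> (nat \<Rightarrow> 'x option)) set" where
  "path_space R = {(z, \<sigma>). itinerary R z \<sigma> \<and> (\<forall>i x. \<sigma> i = Some x \<longrightarrow> rep x = x)}"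

definition path_act :: "'g \<times> 'g \<times> (nat \<Rightarrow> 'x option) \<Rightarrow> 'g \<times> (nat \<Rightarrow> 'x option)" where
  "path_act = (\<lambda>(h, z, \<sigma>). (rng G h, translate h \<sigma>))"

text \<open>Prefixing \<open>x\<close> itself would leave the normal form, so only its
  representative becomes the first letter and its coordinate acts on the remaining path.\<close>

definition path_mult :: "'x \<times> 'g \<times> (nat \<Rightarrow> 'x option) \<Rightarrow> 'g \<times> (nat \<Rightarrow> 'x option)" where
  "path_mult = (\<lambda>(x, z, \<sigma>). (lanchor X x, case_nat (Some (rep x)) (translate (coord x) \<sigma>)))"

section \<open>Translation of paths by arrows\<close>

lemma itinerary_SomeD: "\<lbrakk>itinerary R z \<sigma>; \<sigma> i = Some x\<rbrakk> \<Longrightarrow> x \<in> XS \<and> lanchor X x = vertex z \<sigma> i"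
  and itinerary_NoneD: "\<lbrakk>itinerary R z \<sigma>; \<sigma> i = None\<rbrakk> \<Longrightarrow> vertex z \<sigma> i \<notin> R \<and> \<sigma> (Suc i) = None"
  and itinerary_unit: "itinerary R z \<sigma> \<Longrightarrow> z \<in> units G"
  unfolding itinerary_def by (auto split: option.splits dest: spec[of _ i])

lemma state_props:
  assumes "itinerary R z \<sigma>" "h \<in> GA" "src G h = z"
  shows "state h \<sigma> i \<in> GA \<and> src G (state h \<sigma> i) = vertex z \<sigma> i \<and>
    rng G (state h \<sigma> i) = vertex (rng G h) (translate h \<sigma>) i"
proof (induction i)
  case 0
  then show ?case using assms by simp
next
  case (Suc i)
  show ?case
  proof (cases "\<sigma> i")
    case None
    then show ?thesis using Suc by (simp add: translate_def)
  next
    case (Some x)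
    then have "x \<in> XS" "lanchor X x = vertex z \<sigma> i" using itinerary_SomeD[OF assms(1)] by auto
    then show ?thesis using Suc Some by (simp add: translate_def L.act_in coord src_coord)
  qed
qed

text \<open>\<open>state h \<sigma> i\<close> is an arrow between the \<open>i\<close>-th vertices
  of the two paths, so invariance of \<open>R\<close> carries the stopping condition over.\<close>

lemma itinerary_translate:
  assumes R: "invariant_set G R" and it: "itinerary R z \<sigma>" and h: "h \<in> GA" "src G h = z"
  shows "itinerary R (rng G h) (translate h \<sigma>)"
  unfolding itinerary_def
proof (intro conjI allI)
  show "rng G h \<in> units G" using h rng_unit by simp
  fix i
  note st = state_props[OF it h, of i]
  show "case translate h \<sigma> i of
     None \<Rightarrow> vertex (rng G h) (translate h \<sigma>) i \<notin> R \<and> translate h \<sigma> (Suc i) = None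
   | Some x \<Rightarrow> x \<in> XS \<and> lanchor X x = vertex (rng G h) (translate h \<sigma>) i"
  proof (cases "\<sigma> i")
    case None
    have "vertex z \<sigma> i \<notin> R" "\<sigma> (Suc i) = None" using itinerary_NoneD[OF it None] by auto
    then show ?thesis using None st R unfolding invariant_set_def translate_def by force
  next
    case (Some x)
    then have "x \<in> XS" "lanchor X x = vertex z \<sigma> i" using itinerary_SomeD[OF it] by auto
    then show ?thesis using Some st L.anchor_act[of "state h \<sigma> i" x] by (simp add: translate_def L.act_in)
  qed
qed

lemma translate_rep:
  assumes "itinerary R z \<sigma>" "h \<in> GA" "src G h = z" "translate h \<sigma> i = Some x"
  shows "rep x = x"
proof -
  obtain y where y: "\<sigma> i = Some y" "x = rep (lact X (state h \<sigma> i, y))"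
    using assms(4) by (auto simp: translate_def)
  then show ?thesis
    using itinerary_SomeD[OF assms(1) y(1)] state_props[OF assms(1-3), of i] by (simp add: L.act_in)
qed

lemma translate_in_path_space:
  assumes "invariant_set G R" "itinerary R z \<sigma>" "h \<in> GA" "src G h = z"
  shows "(rng G h, translate h \<sigma>) \<in> path_space R"
  unfolding path_space_def using itinerary_translate[OF assms] translate_rep[OF assms(2-4)] by blast

text \<open>The cocycle rule for one letter. Split \<open>kx\<close> into representative and
  coordinate and let \<open>h'\<close> act on the representative: the new representative comes from
  that product, and the old coordinate becomes a right factor of the new one.\<close>

lemma lact_translate:
  assumes it: "itinerary R z \<sigma>" and k: "k \<in> GA" "src G k = z" and h: "h \<in> GA" "src G h = rng G k"
    and R: "invariant_set G R" and x: "\<sigma> i = Some x"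
  defines "kx \<equiv> lact X (state k \<sigma> i, x)" and "h' \<equiv> state h (translate k \<sigma>) i"
  shows "translate k \<sigma> i = Some (rep kx)"
    "rep (lact X (gcomp G h' (state k \<sigma> i), x)) = rep (lact X (h', rep kx))"
    "coord (lact X (gcomp G h' (state k \<sigma> i), x)) = gcomp G (coord (lact X (h', rep kx))) (coord kx)"
proof -
  note st = state_props[OF it k, of i] state_props[OF itinerary_translate[OF R it k] h, of i]
  show "translate k \<sigma> i = Some (rep kx)" using x by (simp add: translate_def kx_def)
  have xX: "x \<in> XS" "lanchor X x = vertex z \<sigma> i" using itinerary_SomeD[OF it x] by auto
  have kx: "kx \<in> XS" "lanchor X kx = rng G (state k \<sigma> i)"
    using st xX by (simp_all add: kx_def L.act_in L.anchor_act)
  have h': "h' \<in> GA" "src G h' = rng G (state k \<sigma> i)" using st by (simp_all add: h'_def)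
  have "lact X (gcomp G h' (state k \<sigma> i), x) = lact X (h', kx)"
    using L.act_act[of h' "state k \<sigma> i" x] h' st xX by (simp add: kx_def)
  also have "\<dots> = ract X (lact X (h', rep kx), coord kx)"
    using ract_lact[of h' "rep kx" "coord kx"] h' kx coord[of kx] by simp
  finally show "rep (lact X (gcomp G h' (state k \<sigma> i), x)) = rep (lact X (h', rep kx))"
    "coord (lact X (gcomp G h' (state k \<sigma> i), x)) = gcomp G (coord (lact X (h', rep kx))) (coord kx)"
    using rep_ract[of "lact X (h', rep kx)" "coord kx"] coord_ract[of "lact X (h', rep kx)" "coord kx"]
      h' kx coord[of kx] by (simp_all add: L.act_in)
qed

lemma state_translate:
  assumes "itinerary R z \<sigma>" "k \<in> GA" "src G k = z" "h \<in> GA" "src G h = rng G k" "invariant_set G R"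
  shows "state (gcomp G h k) \<sigma> i = gcomp G (state h (translate k \<sigma>) i) (state k \<sigma> i)"
proof (induction i)
  case (Suc i)
  show ?case
  proof (cases "\<sigma> i")
    case None
    then show ?thesis using Suc by (simp add: translate_def)
  next
    case (Some x)
    then show ?thesis using Suc lact_translate(1,3)[OF assms Some] by simp
  qed
qed simp

lemma translate_translate:
  assumes "itinerary R z \<sigma>" "k \<in> GA" "src G k = z" "h \<in> GA" "src G h = rng G k" "invariant_set G R"
  shows "translate h (translate k \<sigma>) = translate (gcomp G h k) \<sigma>"
proof
  fix i
  show "translate h (translate k \<sigma>) i = translate (gcomp G h k) \<sigma> i"
  proof (cases "\<sigma> i")
    case None
    then show ?thesis by (simp add: translate_def)
  next
    case (Some x)
    then show ?thesis using state_translate[OF assms, of i] lact_translate(1,2)[OF assms Some]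
      unfolding translate_def[of h] translate_def[of "gcomp G h k"] by simp
  qed
qed

text \<open>The letters are representatives, so each coordinate is a unit. On other itineraries,
  translation by a unit is the passage to normal form.\<close>

lemma translate_unit:
  assumes "(z, \<sigma>) \<in> path_space R"
  shows "translate z \<sigma> = \<sigma>"
proof -
  have it: "itinerary R z \<sigma>" and r: "\<And>i x. \<sigma> i = Some x \<Longrightarrow> rep x = x"
    using assms by (auto simp: path_space_def)
  have st: "state z \<sigma> i = vertex z \<sigma> i" for i
  proof (induction i)
    case (Suc i)
    show ?case
    proof (cases "\<sigma> i")
      case (Some x)
      then have "x \<in> XS" "lanchor X x = vertex z \<sigma> i" using itinerary_SomeD[OF it] by auto
      then show ?thesis using Some Suc r[OF Some] L.unit_act[of x] coord_of_rep by simp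
    qed (use Suc in simp)
  qed simp
  show ?thesis
  proof
    fix i
    show "translate z \<sigma> i = \<sigma> i"
    proof (cases "\<sigma> i")
      case (Some x)
      then have "x \<in> XS" "lanchor X x = vertex z \<sigma> i" using itinerary_SomeD[OF it] by auto
      then show ?thesis using Some st r[OF Some] L.unit_act[of x] by (simp add: translate_def)
    qed (simp add: translate_def)
  qed
qed

section \<open>Prefixing and removing a first letter\<close>

lemma vertex_case_nat: "vertex z (case_nat (Some y) \<tau>) (Suc i) = vertex (ranchor X y) \<tau> i"
  by (induction i) (auto split: option.splits)

lemma state_case_nat: "state g (case_nat (Some y) \<tau>) (Suc i) = state (coord (lact X (g, y))) \<tau> i"
  by (induction i) (auto split: option.splits)

lemma translate_case_nat:
  "translate g (case_nat (Some y) \<tau>) = case_nat (Some (rep (lact X (g, y)))) (translate (coord (lact X (g, y))) \<tau>)"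
proof
  fix i show "translate g (case_nat (Some y) \<tau>) i =
    case_nat (Some (rep (lact X (g, y)))) (translate (coord (lact X (g, y))) \<tau>) i"
    by (cases i) (simp_all only: translate_def state_case_nat, simp_all add: translate_def)
qed

lemma itinerary_case_nat:
  assumes "x \<in> XS" "itinerary R (ranchor X x) \<tau>"
  shows "itinerary R (lanchor X x) (case_nat (Some x) \<tau>)"
  unfolding itinerary_def
proof (intro conjI allI)
  fix i
  show "case case_nat (Some x) \<tau> i of
     None \<Rightarrow> vertex (lanchor X x) (case_nat (Some x) \<tau>) i \<notin> R \<and> case_nat (Some x) \<tau> (Suc i) = None
   | Some y \<Rightarrow> y \<in> XS \<and> lanchor X y = vertex (lanchor X x) (case_nat (Some x) \<tau>) i"
  proof (cases i)
    case (Suc j)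
    show ?thesis unfolding Suc vertex_case_nat nat.case
      using assms(2) itinerary_SomeD itinerary_NoneD by (cases "\<tau> j") auto
  qed (use assms in simp)
qed (use assms in simp)

lemma itinerary_shift:
  assumes "itinerary R z \<sigma>" "\<sigma> 0 = Some x"
  shows "itinerary R (ranchor X x) (\<lambda>i. \<sigma> (Suc i))" "\<sigma> = case_nat (Some x) (\<lambda>i. \<sigma> (Suc i))"
proof -
  show eq: "\<sigma> = case_nat (Some x) (\<lambda>i. \<sigma> (Suc i))"
    using assms(2) by (auto simp: fun_eq_iff split: nat.splits)
  have v: "vertex z \<sigma> (Suc i) = vertex (ranchor X x) (\<lambda>i. \<sigma> (Suc i)) i" for i
    using vertex_case_nat[of z x "\<lambda>i. \<sigma> (Suc i)" i] eq by simp
  show "itinerary R (ranchor X x) (\<lambda>i. \<sigma> (Suc i))"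
    unfolding itinerary_def
  proof (intro conjI allI)
    show "ranchor X x \<in> units G" using itinerary_SomeD[OF assms] by simp
    fix i
    show "case \<sigma> (Suc i) of
      None \<Rightarrow> vertex (ranchor X x) (\<lambda>i. \<sigma> (Suc i)) i \<notin> R \<and> \<sigma> (Suc (Suc i)) = None
     | Some y \<Rightarrow> y \<in> XS \<and> lanchor X y = vertex (ranchor X x) (\<lambda>i. \<sigma> (Suc i)) i"
      using itinerary_SomeD[OF assms(1), of "Suc i"] itinerary_NoneD[OF assms(1), of "Suc i"] v[of i]
      by (cases "\<sigma> (Suc i)") auto
  qed
qed

lemma path_mult_in:
  assumes R: "invariant_set G R" and x: "x \<in> XS" and it: "itinerary R (ranchor X x) \<sigma>"
  shows "path_mult (x, ranchor X x, \<sigma>) \<in> path_space R"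
proof -
  note c = coord(1)[OF x] src_coord[OF x]
  have "itinerary R (lanchor X (rep x)) (case_nat (Some (rep x)) (translate (coord x) \<sigma>))"
    using itinerary_case_nat[of "rep x"] itinerary_translate[OF R it c] coord(2)[OF x] x by simp
  moreover have "rep y = y" if "case_nat (Some (rep x)) (translate (coord x) \<sigma>) i = Some y" for i y
    using that x translate_rep[OF it c] by (cases i) auto
  ultimately show ?thesis using x by (auto simp: path_space_def path_mult_def)
qed

text \<open>Equality at position 0 says that \<open>x\<close> and \<open>x'\<close> share their
  representative, hence differ by an arrow. Equality at the other positions says that this arrow
  relates the remaining paths.\<close>

lemma path_mult_eq_iff:
  assumes R: "invariant_set G R" and x: "x \<in> XS" "x' \<in> XS"
    and p: "(ranchor X x, \<sigma>) \<in> path_space R" "(ranchor X x', \<sigma>') \<in> path_space R"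
  shows "path_mult (x, ranchor X x, \<sigma>) = path_mult (x', ranchor X x', \<sigma>') \<longleftrightarrow>
    (\<exists>g \<in> GA. rng G g = ranchor X x \<and> src G g = ranchor X x' \<and> x' = ract X (x, g) \<and>
       (ranchor X x, \<sigma>) = path_act (g, ranchor X x', \<sigma>'))"
proof
  have it: "itinerary R (ranchor X x) \<sigma>" "itinerary R (ranchor X x') \<sigma>'"
    using p by (auto simp: path_space_def)
  note c = coord[OF x(1)] src_coord[OF x(1)] coord[OF x(2)] src_coord[OF x(2)]
  {
    assume eq: "path_mult (x, ranchor X x, \<sigma>) = path_mult (x', ranchor X x', \<sigma>')"
    then have eq': "case_nat (Some (rep x)) (translate (coord x) \<sigma>) = case_nat (Some (rep x')) (translate (coord x') \<sigma>')"
      by (simp add: path_mult_def)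
    have r: "rep x = rep x'" using fun_cong[OF eq', of 0] by simp
    have t: "translate (coord x) \<sigma> = translate (coord x') \<sigma>'"
    proof
      fix i show "translate (coord x) \<sigma> i = translate (coord x') \<sigma>' i" using fun_cong[OF eq', of "Suc i"] by simp
    qed
    \<comment> \<open>The shared representative times \<open>coord x\<close> is \<open>x\<close>,
      and times \<open>coord x'\<close> is \<open>x'\<close>, so \<open>g\<close> has to be the
      quotient of the two coordinates.\<close>
    define g where "g = gcomp G (ginv G (coord x)) (coord x')"
    have g: "g \<in> GA" "rng G g = ranchor X x" "src G g = ranchor X x'"
      using c r by (simp_all add: g_def comp_closed ginv_closed rng_comp src_comp src_ginv rng_ginv)
    have cg: "gcomp G (coord x) g = coord x'"
      unfolding g_def using c r by (intro cancel_left') simp_all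
    have "ract X (x, g) = x'"
      using Rt.act_act[of "rep x" "coord x" g] c g cg r x by simp
    moreover have "translate g \<sigma>' = \<sigma>"
    proof -
      have "translate g \<sigma>' = translate (ginv G (coord x)) (translate (coord x') \<sigma>')"
        unfolding g_def using c r
        by (intro translate_translate[symmetric, OF it(2)] R) (simp_all add: ginv_closed src_ginv)
      also have "\<dots> = translate (gcomp G (ginv G (coord x)) (coord x)) \<sigma>"
        unfolding t[symmetric] using c
        by (intro translate_translate[OF it(1)] R) (simp_all add: ginv_closed src_ginv)
      also have "\<dots> = \<sigma>" using c translate_unit[OF p(1)] by (simp add: ginv_left)
      finally show ?thesis .
    qed
    ultimately show "\<exists>g \<in> GA. rng G g = ranchor X x \<and> src G g = ranchor X x' \<and> x' = ract X (x, g) \<and>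
       (ranchor X x, \<sigma>) = path_act (g, ranchor X x', \<sigma>')"
      using g by (intro bexI[of _ g]) (auto simp: path_act_def)
  next
    assume "\<exists>g \<in> GA. rng G g = ranchor X x \<and> src G g = ranchor X x' \<and> x' = ract X (x, g) \<and>
       (ranchor X x, \<sigma>) = path_act (g, ranchor X x', \<sigma>')"
    then obtain g where g: "g \<in> GA" "rng G g = ranchor X x" "src G g = ranchor X x'" "x' = ract X (x, g)"
       "\<sigma> = translate g \<sigma>'" by (auto simp: path_act_def)
    have "rep x' = rep x" "coord x' = gcomp G (coord x) g" "lanchor X x' = lanchor X x"
      using g x(1) by (simp_all add: rep_ract coord_ract)
    moreover have "translate (coord x) \<sigma> = translate (gcomp G (coord x) g) \<sigma>'"
      unfolding g(5) using c g by (intro translate_translate[OF it(2)] R) simp_all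
    ultimately show "path_mult (x, ranchor X x, \<sigma>) = path_mult (x', ranchor X x', \<sigma>')"
      by (simp add: path_mult_def)
  }
qed

lemma path_action:
  assumes R: "invariant_set G R"
  shows "set_action G X R (path_space R) fst path_act path_mult"
proof unfold_locales
  fix p assume p: "p \<in> path_space R"
  then obtain z \<sigma> where z: "p = (z, \<sigma>)" "itinerary R z \<sigma>" by (auto simp: path_space_def)
  show "fst p \<in> units G" using z itinerary_unit by simp
  show "path_act (fst p, p) = p"
    using z p translate_unit[of z \<sigma> R] itinerary_unit[OF z(2)] by (simp add: path_act_def rng_of_unit)
  {
    fix g assume g: "g \<in> GA" "src G g = fst p"
    show "path_act (g, p) \<in> path_space R"
      using z g translate_in_path_space[OF R z(2)] by (simp add: path_act_def)
    show "fst (path_act (g, p)) = rng G g" using z by (simp add: path_act_def)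
  }
  {
    fix g h assume g: "g \<in> GA" "h \<in> GA" "src G g = rng G h" "src G h = fst p"
    show "path_act (g, path_act (h, p)) = path_act (gcomp G g h, p)"
      using z g translate_translate[OF z(2) _ _ _ _ R, of h g] by (simp add: path_act_def rng_comp)
  }
  {
    fix x assume x: "x \<in> XS" "ranchor X x = fst p"
    show "path_mult (x, p) \<in> path_space R" using path_mult_in[OF R x(1)] z x(2) by simp
    show "fst (path_mult (x, p)) = lanchor X x" using z by (simp add: path_mult_def)
    fix g assume g: "g \<in> GA" "src G g = lanchor X x"
    \<comment> \<open>Both sides are compared through the split of \<open>x\<close>: acting by
      \<open>g\<close> on the representative first shows which coordinate reaches the remaining
      path.\<close>
    have gx: "lact X (g, x) = ract X (lact X (g, rep x), coord x)"
      using ract_lact[of g "rep x" "coord x"] g x coord[of x] by simp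
    have grep: "lact X (g, rep x) \<in> XS" "ranchor X (lact X (g, rep x)) = rng G (coord x)"
      using g x coord[of x] by (simp_all add: L.act_in)
    have "rep (lact X (g, x)) = rep (lact X (g, rep x))"
      "coord (lact X (g, x)) = gcomp G (coord (lact X (g, rep x))) (coord x)"
      unfolding gx using grep coord[of x] x(1) by (simp_all add: rep_ract coord_ract)
    moreover have "translate (coord (lact X (g, rep x))) (translate (coord x) \<sigma>) =
        translate (gcomp G (coord (lact X (g, rep x))) (coord x)) \<sigma>"
      using z x coord[of x] src_coord[of x] coord[OF grep(1)] src_coord[OF grep(1)] grep(2)
      by (intro translate_translate[OF z(2)] R) simp_all
    ultimately show "path_act (g, path_mult (x, p)) = path_mult (lact X (g, x), p)"
      using z g x L.anchor_act[of g x] by (simp add: path_act_def path_mult_def translate_case_nat)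
  }
  {
    fix x x' p' assume x: "x \<in> XS" "ranchor X x = fst p" "x' \<in> XS" "p' \<in> path_space R" "ranchor X x' = fst p'"
    obtain z' \<sigma>' where z': "p' = (z', \<sigma>')" by (cases p')
    show "path_mult (x, p) = path_mult (x', p') \<longleftrightarrow>
        (\<exists>g \<in> GA. rng G g = ranchor X x \<and> src G g = fst p' \<and> x' = ract X (x, g) \<and> p = path_act (g, p'))"
      using path_mult_eq_iff[OF R x(1,3), of \<sigma> \<sigma>'] x p z(1) z' by simp
  }
  {
    assume zR: "fst p \<in> R"
    have "\<sigma> 0 \<noteq> None" using itinerary_NoneD[OF z(2), of 0] zR z(1) by auto
    then obtain x where x: "\<sigma> 0 = Some x" by blast
    have xX: "x \<in> XS" "lanchor X x = z" "rep x = x"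
      using itinerary_SomeD[OF z(2) x] p z(1) x by (auto simp: path_space_def)
    note sh = itinerary_shift[OF z(2) x]
    have p': "(ranchor X x, \<lambda>i. \<sigma> (Suc i)) \<in> path_space R"
      using sh(1) p z(1) by (auto simp: path_space_def)
    \<comment> \<open>The first letter is a representative, so its coordinate is a unit and
      multiplication by it merely puts the letter in front.\<close>
    have "p = path_mult (x, ranchor X x, \<lambda>i. \<sigma> (Suc i))"
      using xX z(1) coord_of_rep[OF xX(1,3)] translate_unit[OF p'] sh(2)[symmetric] by (simp add: path_mult_def)
    then show "\<exists>x\<in>XS. \<exists>p'\<in>path_space R. ranchor X x = fst p' \<and> p = path_mult (x, p')"
      using xX(1) p' by (metis fst_conv)
  }
qed

text \<open>The empty path may start outside \<open>R\<close>, and a product always has a letter at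
  position 0.\<close>

lemma path_space_root:
  assumes "z \<in> units G" "z \<notin> R"
  shows "(z, \<lambda>_. None) \<in> path_space R" "(z, \<lambda>_. None) \<noteq> path_mult (x, p)"
proof -
  have "vertex z (\<lambda>_. None) i = z" for i by (induction i) auto
  then show "(z, \<lambda>_. None) \<in> path_space R" using assms by (auto simp: path_space_def itinerary_def)
  show "(z, \<lambda>_. None) \<noteq> path_mult (x, p)"
    by (cases p) (auto simp: path_mult_def fun_eq_iff split: nat.splits)
qed

lemma path_space_infinite:
  assumes R: "invariant_set G R" and \<xi>: "\<And>i. \<xi> i \<in> XS \<and> ranchor X (\<xi> i) = lanchor X (\<xi> (Suc i))"
  obtains \<omega> where "\<And>i::nat. \<omega> i \<in> path_space R"
    "\<And>i. ranchor X (\<xi> i) = fst (\<omega> (Suc i))" "\<And>i. \<omega> i = path_mult (\<xi> i, \<omega> (Suc i))"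
proof -
  define s where "s = (\<lambda>j i. Some (\<xi> (j + i)))"
  have v: "vertex (lanchor X (\<xi> j)) (s j) i = lanchor X (\<xi> (j + i))" for i j
    by (cases i) (use \<xi> in \<open>auto simp: s_def\<close>)
  have it: "itinerary R (lanchor X (\<xi> j)) (s j)" for j
    unfolding itinerary_def v using \<xi> by (auto simp: s_def)
  have s_Suc: "s j = case_nat (Some (\<xi> j)) (s (Suc j))" for j
    by (auto simp: s_def fun_eq_iff split: nat.splits)
  \<comment> \<open>The \<open>j\<close>-th tail of the given sequence, brought into normal form by
    translating with its first vertex.\<close>
  define \<omega> where "\<omega> = (\<lambda>j. (lanchor X (\<xi> j), translate (lanchor X (\<xi> j)) (s j)))"
  have u: "lanchor X (\<xi> j) \<in> units G" for j using \<xi> by simp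
  show thesis
  proof (rule that)
    fix j
    show "\<omega> j \<in> path_space R"
      using translate_in_path_space[OF R it, of "lanchor X (\<xi> j)" j] u[of j] by (simp add: \<omega>_def rng_of_unit)
    show "ranchor X (\<xi> j) = fst (\<omega> (Suc j))" using \<xi> by (simp add: \<omega>_def)
    have x: "\<xi> j \<in> XS" "ranchor X (\<xi> j) = lanchor X (\<xi> (Suc j))" using \<xi> by auto
    have "translate (lanchor X (\<xi> j)) (s j) = case_nat (Some (rep (\<xi> j))) (translate (coord (\<xi> j)) (s (Suc j)))"
      using L.unit_act[OF x(1)] by (subst s_Suc) (simp add: translate_case_nat)
    \<comment> \<open>A unit is inserted on the right of the coordinate, so that the cocycle rule
      can split off the normalisation of the next tail.\<close>
    also have "translate (coord (\<xi> j)) (s (Suc j)) =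
        translate (gcomp G (coord (\<xi> j)) (lanchor X (\<xi> (Suc j)))) (s (Suc j))"
      using right_unit[of "coord (\<xi> j)"] coord[OF x(1)] src_coord[OF x(1)] x(2) by simp
    also have "\<dots> = translate (coord (\<xi> j)) (translate (lanchor X (\<xi> (Suc j))) (s (Suc j)))"
      using u[of "Suc j"] coord[OF x(1)] src_coord[OF x(1)] x(2)
      by (intro translate_translate[symmetric, OF it] R) (simp_all add: rng_of_unit)
    finally show "\<omega> j = path_mult (\<xi> j, \<omega> (Suc j))" by (simp add: \<omega>_def path_mult_def)
  qed
qed

end

text \<open>Used to fit the action on paths into the auxiliary type of a groupoid model.\<close>

lemma (in set_action) set_action_image:
  assumes e: "\<And>y. y \<in> Y \<Longrightarrow> d (e y) = y"
  shows "set_action G X R (e ` Y) (a \<circ> d) (\<lambda>(g, w). e (m (g, d w))) (\<lambda>(x, w). e (n (x, d w)))"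
proof unfold_locales
  fix w assume w: "w \<in> e ` Y"
  then obtain y where y: "y \<in> Y" "w = e y" "d w = y" using e by auto
  show "(a \<circ> d) w \<in> units G" using y anchor_unit by simp
  show "(case ((a \<circ> d) w, w) of (g, w) \<Rightarrow> e (m (g, d w))) = w" using y unit_act by simp
  {
    fix g assume g: "g \<in> GA" "src G g = (a \<circ> d) w"
    show "(case (g, w) of (g, w) \<Rightarrow> e (m (g, d w))) \<in> e ` Y" using y g act_in by simp
    show "(a \<circ> d) (case (g, w) of (g, w) \<Rightarrow> e (m (g, d w))) = rng G g"
      using y g act_in anchor_act e by simp
  }
  {
    fix g h assume g: "g \<in> GA" "h \<in> GA" "src G g = rng G h" "src G h = (a \<circ> d) w"
    show "(case (g, case (h, w) of (g, w) \<Rightarrow> e (m (g, d w))) of (g, w) \<Rightarrow> e (m (g, d w))) =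
        (case (gcomp G g h, w) of (g, w) \<Rightarrow> e (m (g, d w)))"
      using y g act_in act_act e by simp
  }
  {
    fix x assume x: "x \<in> XS" "ranchor X x = (a \<circ> d) w"
    show "(case (x, w) of (x, w) \<Rightarrow> e (n (x, d w))) \<in> e ` Y" using y x mult_in by simp
    show "(a \<circ> d) (case (x, w) of (x, w) \<Rightarrow> e (n (x, d w))) = lanchor X x"
      using y x mult_in anchor_mult e by simp
    fix g assume g: "g \<in> GA" "src G g = lanchor X x"
    show "(case (g, case (x, w) of (x, w) \<Rightarrow> e (n (x, d w))) of (g, w) \<Rightarrow> e (m (g, d w))) =
        (case (lact X (g, x), w) of (x, w) \<Rightarrow> e (n (x, d w)))"
      using y x g mult_in act_mult e by simp
  }
  {
    fix x x' w' assume x: "x \<in> XS" "ranchor X x = (a \<circ> d) w" "x' \<in> XS" "w' \<in> e ` Y" "ranchor X x' = (a \<circ> d) w'"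
    then obtain y' where y': "y' \<in> Y" "w' = e y'" "d w' = y'" using e by auto
    have inj: "e u = e v \<longleftrightarrow> u = v" if "u \<in> Y" "v \<in> Y" for u v using e that by metis
    have "(case (x, w) of (x, w) \<Rightarrow> e (n (x, d w))) = (case (x', w') of (x, w) \<Rightarrow> e (n (x, d w))) \<longleftrightarrow>
        n (x, y) = n (x', y')"
      using inj mult_in x y y' by simp
    also have "\<dots> \<longleftrightarrow> (\<exists>g \<in> GA. rng G g = ranchor X x \<and> src G g = a y' \<and> x' = ract X (x, g) \<and> y = m (g, y'))"
      using x y y' by (intro mult_eq_iff) simp_all
    also have "\<dots> \<longleftrightarrow> (\<exists>g \<in> GA. rng G g = ranchor X x \<and> src G g = (a \<circ> d) w' \<and> x' = ract X (x, g) \<and>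
        w = (case (g, w') of (g, w) \<Rightarrow> e (m (g, d w))))"
      using inj act_in y y' by (auto intro!: bexI)
    finally show "(case (x, w) of (x, w) \<Rightarrow> e (n (x, d w))) = (case (x', w') of (x, w) \<Rightarrow> e (n (x, d w))) \<longleftrightarrow>
        (\<exists>g \<in> GA. rng G g = ranchor X x \<and> src G g = (a \<circ> d) w' \<and> x' = ract X (x, g) \<and>
        w = (case (g, w') of (g, w) \<Rightarrow> e (m (g, d w))))" .
  }
  {
    assume "(a \<circ> d) w \<in> R"
    then obtain x y' where "x \<in> XS" "y' \<in> Y" "ranchor X x = a y'" "y = n (x, y')" using covers[OF y(1)] y by auto
    then show "\<exists>x\<in>XS. \<exists>w'\<in>e ` Y. ranchor X x = (a \<circ> d) w' \<and> w = (case (x, w') of (x, w) \<Rightarrow> e (n (x, d w)))"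
      using y e by (auto intro!: bexI[of _ x] bexI[of _ y'])
  }
qed

section \<open>The object space of the groupoid model\<close>

lemma corr_actions_topspace:
  assumes "(a, m, n) \<in> corr_actions G X R T" "corr_action G X R T' a m n" "topspace T' = topspace T"
  shows "(a, m, n) \<in> corr_actions G X R T'"
  using assms by (simp add: corr_actions_def topspace_fibre_product topspace_corr_domain)

text \<open>Equivariance is a condition on points. This allows a map to be compared with the
  identity after the topology on its source has been made discrete.\<close>

lemma corr_equivariant_topspace:
  assumes "topspace T' = topspace T"
  shows "corr_equivariant G X T' Z \<alpha> \<beta> \<phi> \<longleftrightarrow> corr_equivariant G X T Z \<alpha> \<beta> \<phi>"
  using assms by (simp add: corr_equivariant_def groupoid_equivariant_def topspace_corr_domain split: prod.splits)

context correspondence_setting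
begin

section \<open>Passing between topological actions and actions on sets\<close>

lemma set_action_of_corr_action:
  assumes "corr_action G X R T a m n"
  shows "set_action G X R (topspace T) a m n"
proof -
  interpret A: corr_action G X R T a m n by fact
  interpret B: left_action G T a m by (rule A.groupoid_act)
  show ?thesis
  proof (rule set_action.intro)
    show "correspondence_setting G X" by unfold_locales
    show "set_action_axioms G X R (topspace T) a m n"
    proof (rule set_action_axioms.intro)
      fix x y assume "x \<in> XS" "y \<in> topspace T" "ranchor X x = a y"
      then show "n (x, y) \<in> topspace T"
        using A.continuous_mult by (auto simp: continuous_map_def topspace_corr_domain)
    next
      fix y assume "y \<in> topspace T" "a y \<in> R"
      then show "\<exists>x\<in>XS. \<exists>y'\<in>topspace T. ranchor X x = a y' \<and> y = n (x, y')"
        using A.covers by (force simp: topspace_corr_domain)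
    qed (use B.anchor_in B.act_in B.anchor_act B.act_act B.unit_act A.anchor_mult A.act_mult A.mult_eq_iff in \<open>simp_all\<close>)
  qed
qed

lemma set_action_cong:
  assumes S: "set_action G X R Y a m n"
    and a: "\<And>y. y \<in> Y \<Longrightarrow> a' y = a y"
    and m: "\<And>g y. \<lbrakk>g \<in> GA; y \<in> Y; src G g = a y\<rbrakk> \<Longrightarrow> m' (g, y) = m (g, y)"
    and n: "\<And>x y. \<lbrakk>x \<in> XS; y \<in> Y; ranchor X x = a y\<rbrakk> \<Longrightarrow> n' (x, y) = n (x, y)"
  shows "set_action G X R Y a' m' n'"
proof -
  interpret S: set_action G X R Y a m n by fact
  show ?thesis
  proof unfold_locales
    fix x y x' y' assume xy: "x \<in> XS" "y \<in> Y" "ranchor X x = a' y" "x' \<in> XS" "y' \<in> Y" "ranchor X x' = a' y'"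
    have "n' (x, y) = n' (x', y') \<longleftrightarrow> n (x, y) = n (x', y')" using xy a n by simp
    also have "\<dots> \<longleftrightarrow> (\<exists>g \<in> GA. rng G g = ranchor X x \<and> src G g = a y' \<and> x' = ract X (x, g) \<and> y = m (g, y'))"
      using xy a by (intro S.mult_eq_iff) simp_all
    also have "\<dots> \<longleftrightarrow> (\<exists>g \<in> GA. rng G g = ranchor X x \<and> src G g = a' y' \<and> x' = ract X (x, g) \<and> y = m' (g, y'))"
      using xy a m by (intro bex_cong) auto
    finally show "n' (x, y) = n' (x', y') \<longleftrightarrow>
        (\<exists>g \<in> GA. rng G g = ranchor X x \<and> src G g = a' y' \<and> x' = ract X (x, g) \<and> y = m' (g, y'))" .
  next
    fix y assume "y \<in> Y" "a' y \<in> R"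
    then obtain x w where "x \<in> XS" "w \<in> Y" "ranchor X x = a w" "y = n (x, w)" using S.covers[of y] a by auto
    then show "\<exists>x\<in>XS. \<exists>y'\<in>Y. ranchor X x = a' y' \<and> y = n' (x, y')" using a n by (intro bexI[of _ x] bexI[of _ w]) simp_all
  qed (use a m n S.anchor_unit S.act_in S.anchor_act S.act_act S.unit_act S.mult_in S.anchor_mult S.act_mult in
      \<open>simp_all add: comp_closed src_comp L.act_in\<close>)
qed

lemma corr_action_open_closed:
  assumes "corr_action G X R T a m n"
  shows "\<lbrakk>openin (cspace X) V; openin T W\<rbrakk> \<Longrightarrow> openin T (set_action.mul X a n V W)"
    and "compactin (cspace X) L \<Longrightarrow> closedin T (set_action.mul X a n L (topspace T))"
proof -
  interpret S: set_action G X R "topspace T" a m n using assms by (rule set_action_of_corr_action)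
  show "openin T (S.mul V W)" if "openin (cspace X) V" "openin T W"
    unfolding S.mul_def
    by (rule corr_action.open_mult[OF assms, unfolded corr_domain_def open_map_fibre_product_iff, rule_format, OF that])
  show "closedin T (S.mul L (topspace T))" if L: "compactin (cspace X) L"
  proof -
    have "compactin (orbit_space G X) (orbit_of G X ` L)" using L continuous_orbit_of by (rule image_compactin)
    from corr_action.closed[OF assms this]
    have "closedin T {n (x, y) |x y. x \<in> XS \<and> y \<in> topspace T \<and> ranchor X x = a y \<and> orbit_of G X x \<in> orbit_of G X ` L}"
      by (simp add: topspace_corr_domain conj_assoc)
    then show ?thesis using S.mul_orbits[OF compactin_subset_topspace[OF L] refl] by simp
  qed
qed

lemma corr_action_cong:
  assumes act: "corr_action G X R T a m n"
    and a: "\<And>y. y \<in> topspace T \<Longrightarrow> a' y = a y"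
    and m: "\<And>g y. \<lbrakk>g \<in> GA; y \<in> topspace T; src G g = a y\<rbrakk> \<Longrightarrow> m' (g, y) = m (g, y)"
    and n: "\<And>x y. \<lbrakk>x \<in> XS; y \<in> topspace T; ranchor X x = a y\<rbrakk> \<Longrightarrow> n' (x, y) = n (x, y)"
  shows "corr_action G X R T a' m' n'"
proof -
  interpret A: corr_action G X R T a m n by fact
  interpret S: set_action G X R "topspace T" a m n using act by (rule set_action_of_corr_action)
  interpret S': set_action G X R "topspace T" a' m' n'
    by (rule set_action_cong[OF set_action_of_corr_action[OF act] a m n])
  have fp: "fibre_product (arrows G) (src G) a' T = fibre_product (arrows G) (src G) a T"
    using a by (rule fibre_product_cong)
  have cd: "corr_domain X a' T = corr_domain X a T"
    unfolding corr_domain_def using a by (rule fibre_product_cong)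
  have mul: "S'.mul V W = S.mul V W" if "V \<subseteq> XS" "W \<subseteq> topspace T" for V W
  proof -
    have "n' (x, y) = n (x, y) \<and> a' y = a y" if "x \<in> V" "y \<in> W" "ranchor X x = a y" for x y
      using that \<open>V \<subseteq> XS\<close> \<open>W \<subseteq> topspace T\<close> a[of y] n[of x y] by auto
    moreover have "a' y = a y" if "y \<in> W" for y using that \<open>W \<subseteq> topspace T\<close> a by auto
    ultimately show ?thesis unfolding S.mul_def S'.mul_def by (intro Collect_cong) metis
  qed
  show ?thesis
  proof (rule S'.corr_actionI)
    show "continuous_map T (objects G) a'"
      by (rule continuous_map_eq[OF left_action.continuous_anchor[OF A.groupoid_act]]) (simp add: a)
    show "continuous_map (fibre_product (arrows G) (src G) a' T) T m'"
      unfolding fp by (rule continuous_map_eq[OF left_action.continuous_act[OF A.groupoid_act]])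
        (auto simp: topspace_fibre_product m)
    show "continuous_map (corr_domain X a' T) T n'"
      unfolding cd by (rule continuous_map_eq[OF A.continuous_mult]) (auto simp: topspace_corr_domain n)
  next
    fix V W assume "openin (cspace X) V" "openin T W"
    then show "openin T (S'.mul V W)"
      using corr_action_open_closed(1)[OF act] mul openin_subset by metis
  next
    fix L assume "compactin (cspace X) L"
    then show "closedin T (S'.mul L (topspace T))"
      using corr_action_open_closed(2)[OF act] mul compactin_subset_topspace by (metis subset_refl)
  qed simp
qed

lemma corr_action_restrict:
  assumes "corr_action G X R T a m n"
  shows "(restrict a (topspace T), restrict m (topspace (fibre_product (arrows G) (src G) a T)),
    restrict n (topspace (corr_domain X a T))) \<in> corr_actions G X R T"
proof -
  have "corr_action G X R T (restrict a (topspace T))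
    (restrict m (topspace (fibre_product (arrows G) (src G) a T))) (restrict n (topspace (corr_domain X a T)))"
    by (rule corr_action_cong[OF assms]) (auto simp: topspace_fibre_product topspace_corr_domain)
  moreover have "fibre_product (arrows G) (src G) (restrict a (topspace T)) T = fibre_product (arrows G) (src G) a T"
    "corr_domain X (restrict a (topspace T)) T = corr_domain X a T"
    unfolding corr_domain_def by (rule fibre_product_restrict)+
  ultimately show ?thesis by (simp add: corr_actions_def)
qed

text \<open>On the set of points of a terminal action, the coarsest topology cannot be strictly coarser
  than the given one: the discrete topology has only one equivariant map to the terminal action.\<close>

theorem terminal_anchor_proper:
  fixes \<Omega> :: "'z topology" and e :: "'g \<times> (nat \<Rightarrow> 'x option) \<Rightarrow> 'z"
  assumes R: "openin (objects G) R" "invariant_set G R" "regular_on G X R"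
    and \<Omega>: "(q, m, n) \<in> corr_actions G X R \<Omega>"
    and ex: "\<And>(Y :: 'z topology) \<alpha>. \<alpha> \<in> corr_actions G X R Y \<Longrightarrow>
      \<exists>\<phi>. continuous_map Y \<Omega> \<phi> \<and> corr_equivariant G X Y \<Omega> \<alpha> (q, m, n) \<phi>"
    and uniq: "\<And>(Y :: 'z topology) \<alpha> \<phi> \<psi> y. \<lbrakk>\<alpha> \<in> corr_actions G X R Y;
      continuous_map Y \<Omega> \<phi>; corr_equivariant G X Y \<Omega> \<alpha> (q, m, n) \<phi>;
      continuous_map Y \<Omega> \<psi>; corr_equivariant G X Y \<Omega> \<alpha> (q, m, n) \<psi>; y \<in> topspace Y\<rbrakk> \<Longrightarrow> \<phi> y = \<psi> y"
    and e: "inj e"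
  shows "proper_map \<Omega> (objects G) q"
proof -
  have act: "corr_action G X R \<Omega> q m n" using \<Omega> by (simp add: corr_actions_def)
  interpret A: corr_action G X R \<Omega> q m n by (rule act)
  interpret S: set_action G X R "topspace \<Omega>" q m n using act by (rule set_action_of_corr_action)
  interpret P: set_action G X R "path_space R" fst path_act path_mult using R(2) by (rule path_action)
  have id: "continuous_map S.coarsest \<Omega> id"
  proof -
    have L: "(q, m, n) \<in> corr_actions G X R S.coarsest"
      using \<Omega> S.corr_action_coarsest S.topspace_coarsest by (rule corr_actions_topspace)
    have D: "(q, m, n) \<in> corr_actions G X R (discrete_topology (topspace \<Omega>))"
      using \<Omega> S.corr_action_discrete by (rule corr_actions_topspace) simp
    \<comment> \<open>Terminality supplies a continuous equivariant map on the coarsest topology.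
      Over the discrete topology both it and the identity are equivariant, so they agree on points
      and the identity inherits continuity.\<close>
    obtain \<phi> where \<phi>: "continuous_map S.coarsest \<Omega> \<phi>" "corr_equivariant G X S.coarsest \<Omega> (q, m, n) (q, m, n) \<phi>"
      using ex[OF L] by blast
    have "\<phi> y = id y" if "y \<in> topspace \<Omega>" for y
    proof (rule uniq[OF D, where \<phi> = \<phi> and \<psi> = id])
      show "continuous_map (discrete_topology (topspace \<Omega>)) \<Omega> \<phi>"
        using \<phi>(1) by (auto simp: continuous_map_def S.topspace_coarsest)
      have "topspace (discrete_topology (topspace \<Omega>)) = topspace S.coarsest"
        by (simp add: S.topspace_coarsest)
      from corr_equivariant_topspace[OF this] \<phi>(2)
      show "corr_equivariant G X (discrete_topology (topspace \<Omega>)) \<Omega> (q, m, n) (q, m, n) \<phi>"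
        by (rule iffD2)
      have "n ` topspace (corr_domain X q \<Omega>) \<subseteq> topspace \<Omega>"
        using S.mult_in by (auto simp: topspace_corr_domain)
      then show "corr_equivariant G X (discrete_topology (topspace \<Omega>)) \<Omega> (q, m, n) (q, m, n) id"
        by (auto simp: corr_equivariant_def groupoid_equivariant_def topspace_corr_domain)
    qed (use that in auto)
    then show ?thesis using \<phi>(1) by (intro continuous_map_eq[OF \<phi>(1)]) (simp add: S.topspace_coarsest)
  qed
  \<comment> \<open>Terminality is assumed only for topologies on the type \<open>'z\<close>, so the
    action on paths is first copied into that type.\<close>
  define P' where "P' = e ` path_space R"
  define d where "d = inv e"
  have d: "d (e p) = p" for p using e by (simp add: d_def)
  interpret P': set_action G X R P' "fst \<circ> d" "\<lambda>(g, w). e (path_act (g, d w))" "\<lambda>(x, w). e (path_mult (x, d w))"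
    unfolding P'_def using P.set_action_image[of d e] d by blast
  obtain \<phi> where \<phi>: "continuous_map (discrete_topology P') \<Omega> \<phi>"
    "corr_equivariant G X (discrete_topology P') \<Omega>
      (restrict (fst \<circ> d) (topspace (discrete_topology P')),
       restrict (\<lambda>(g, w). e (path_act (g, d w)))
         (topspace (fibre_product (arrows G) (src G) (fst \<circ> d) (discrete_topology P'))),
       restrict (\<lambda>(x, w). e (path_mult (x, d w))) (topspace (corr_domain X (fst \<circ> d) (discrete_topology P'))))
      (q, m, n) \<phi>"
    using ex[OF corr_action_restrict[OF P'.corr_action_discrete]] by blast
  define f where "f = \<phi> \<circ> e"
  have fin: "f p \<in> topspace \<Omega>" if "p \<in> path_space R" for p
    using \<phi>(1) that by (auto simp: f_def P'_def continuous_map_def)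
  have fa: "q (f p) = fst p" if "p \<in> path_space R" for p
    using \<phi>(2) that d by (auto simp: corr_equivariant_def groupoid_equivariant_def f_def P'_def)
  have fn: "f (path_mult (x, p)) = n (x, f p)" if "x \<in> XS" "p \<in> path_space R" "ranchor X x = fst p" for x p
    using \<phi>(2) that d
    by (simp add: corr_equivariant_def f_def P'_def topspace_corr_domain)
  \<comment> \<open>The preimage clause of equivariance: only products of paths are sent to
    products. Hence the image of an empty path is a root.\<close>
  have fpre: "\<exists>x p'. p = path_mult (x, p')" if p: "p \<in> path_space R" "f p \<in> S.mul XS (topspace \<Omega>)" for p
  proof -
    have "\<phi> (e p) \<in> n ` topspace (corr_domain X q \<Omega>)"
      using p(2) by (auto simp: f_def topspace_corr_domain elim!: S.mulE)
    moreover have "e p \<in> P'" using p(1) by (simp add: P'_def)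
    moreover have "{y \<in> topspace (discrete_topology P'). \<phi> y \<in> n ` topspace (corr_domain X q \<Omega>)} =
        restrict (\<lambda>(x, w). e (path_mult (x, d w))) (topspace (corr_domain X (fst \<circ> d) (discrete_topology P'))) `
        topspace (corr_domain X (restrict (fst \<circ> d) (topspace (discrete_topology P'))) (discrete_topology P'))"
      using \<phi>(2) unfolding corr_equivariant_def split by (elim conjE)
    ultimately obtain t where "t \<in> topspace (corr_domain X (restrict (fst \<circ> d) P') (discrete_topology P'))"
      "e p = restrict (\<lambda>(x, w). e (path_mult (x, d w))) (topspace (corr_domain X (fst \<circ> d) (discrete_topology P'))) t"
      unfolding topspace_discrete_topology by blast
    then obtain x w where "e p = e (path_mult (x, d w))" by (auto simp: topspace_corr_domain)
    then have "p = path_mult (x, d w)" using e by (simp add: inj_eq)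
    then show ?thesis by blast
  qed
  have compact: "compactin S.coarsest {y \<in> topspace \<Omega>. q y \<in> C}" if C: "compactin (objects G) C" for C
  proof (rule S.compactin_coarsest[OF _ _ _ C])
    fix z assume "z \<in> R" "z \<in> units G"
    then show "\<exists>U L. openin (objects G) U \<and> z \<in> U \<and> compactin (cspace X) L \<and>
        {y \<in> topspace \<Omega>. q y \<in> U} \<subseteq> S.mul L (topspace \<Omega>)"
      using S.regular_on_compact R by blast
  next
    fix z assume z: "z \<in> units G" "z \<notin> R"
    show "\<exists>y\<in>topspace \<Omega>. q y = z \<and> y \<notin> S.mul XS (topspace \<Omega>)"
      using path_space_root[OF z] fin fa fpre by (metis fst_conv)
  next
    fix \<xi> :: "nat \<Rightarrow> 'x" assume \<xi>: "\<And>i. \<xi> i \<in> XS \<and> ranchor X (\<xi> i) = lanchor X (\<xi> (Suc i))"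
    obtain \<omega> where \<omega>: "\<And>i. \<omega> i \<in> path_space R" "\<And>i. ranchor X (\<xi> i) = fst (\<omega> (Suc i))"
      "\<And>i. \<omega> i = path_mult (\<xi> i, \<omega> (Suc i))"
      using path_space_infinite[OF R(2), of \<xi>] \<xi> by blast
    show "\<exists>\<omega>. \<forall>i::nat. \<omega> i \<in> topspace \<Omega> \<and> ranchor X (\<xi> i) = q (\<omega> (Suc i)) \<and> \<omega> i = n (\<xi> i, \<omega> (Suc i))"
    proof (intro exI[of _ "\<lambda>i. f (\<omega> i)"] allI conjI)
      fix i
      show "f (\<omega> i) \<in> topspace \<Omega>" "ranchor X (\<xi> i) = q (f (\<omega> (Suc i)))"
        using \<omega>(1,2) fin fa by simp_all
      show "f (\<omega> i) = n (\<xi> i, f (\<omega> (Suc i)))"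
        by (subst \<omega>(3)) (use \<omega>(1,2) \<xi> fn in blast)
    qed
  qed
  show ?thesis
  proof (rule compact_imp_proper_map)
    show "k_space (objects G)" using locally_compact_objects by (rule locally_compact_imp_k_space)
    show "kc_space (objects G)" using Hausdorff_objects by (rule Hausdorff_imp_kc_space)
    show "q \<in> topspace \<Omega> \<rightarrow> topspace (objects G)" using S.anchor_unit by auto
    show "continuous_map \<Omega> (objects G) q \<or> kc_space \<Omega>"
      using left_action.continuous_anchor[OF A.groupoid_act] by blast
    fix K assume "compactin (objects G) K"
    from image_compactin[OF compact[OF this] id]
    show "compactin \<Omega> {x \<in> topspace \<Omega>. q x \<in> K}" by simp
  qed
qed

end

section \<open>The object space as a terminal action\<close>

lemma (in etale_groupoid) object_action:
  assumes e: "inj e"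
  defines "\<Omega> \<equiv> pullback_topology (e ` units G) (inv e) (objects G)"
  shows "homeomorphic_map (objects G) \<Omega> e"
    and "(restrict (inv e) (topspace \<Omega>),
       restrict (\<lambda>(g, w). e (rng G g)) (topspace (fibre_product (arrows G) (src G) (inv e) \<Omega>)))
      \<in> groupoid_actions G \<Omega>"
proof -
  have top: "topspace \<Omega> = e ` units G" using e by (auto simp: \<Omega>_def topspace_pullback_topology)
  have ce: "continuous_map (objects G) \<Omega> e"
    unfolding \<Omega>_def
  proof (rule continuous_map_pullback')
    show "continuous_map (objects G) (objects G) (inv e \<circ> e)" using e by simp
  qed auto
  have ci: "continuous_map \<Omega> (objects G) (inv e)"
    using continuous_map_pullback[of "objects G" "objects G" id "e ` units G" "inv e"] by (simp add: \<Omega>_def)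
  show "homeomorphic_map (objects G) \<Omega> e"
    unfolding homeomorphic_map_maps homeomorphic_maps_def
    using ce ci e top by (intro exI[of _ "inv e"]) auto
  have fp: "fibre_product (arrows G) (src G) (restrict (inv e) (topspace \<Omega>)) \<Omega> =
      fibre_product (arrows G) (src G) (inv e) \<Omega>" by (rule fibre_product_restrict)
  let ?m = "restrict (\<lambda>(g, w). e (rng G g)) (topspace (fibre_product (arrows G) (src G) (inv e) \<Omega>))"
  have "left_action G \<Omega> (restrict (inv e) (topspace \<Omega>)) ?m"
  proof (rule left_action.intro)
    show "continuous_map \<Omega> (objects G) (restrict (inv e) (topspace \<Omega>))"
      by (rule continuous_map_eq[OF ci]) simp
    have "continuous_map (fibre_product (arrows G) (src G) (inv e) \<Omega>) (arrows G) fst"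
      unfolding fibre_product_def by (intro continuous_map_from_subtopology continuous_map_fst)
    from continuous_map_compose[OF continuous_map_compose[OF this continuous_rng] ce]
    have "continuous_map (fibre_product (arrows G) (src G) (inv e) \<Omega>) \<Omega> (e \<circ> (rng G \<circ> fst))" .
    then show "continuous_map (fibre_product (arrows G) (src G) (restrict (inv e) (topspace \<Omega>)) \<Omega>) \<Omega> ?m"
      unfolding fp by (rule continuous_map_eq) auto
  next
    fix g w assume gw: "g \<in> topspace (arrows G)" "w \<in> topspace \<Omega>" "src G g = restrict (inv e) (topspace \<Omega>) w"
    then show "restrict (inv e) (topspace \<Omega>) (?m (g, w)) = rng G g"
      using e rng_unit[OF gw(1)] by (simp add: topspace_fibre_product top)
  next
    fix g h w assume gw: "g \<in> topspace (arrows G)" "h \<in> topspace (arrows G)" "w \<in> topspace \<Omega>"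
      "src G g = rng G h" "src G h = restrict (inv e) (topspace \<Omega>) w"
    then show "?m (g, ?m (h, w)) = ?m (gcomp G g h, w)"
      using e rng_unit[OF gw(1)] rng_unit[OF gw(2)] by (simp add: topspace_fibre_product top comp_closed src_comp rng_comp)
  next
    fix w assume w: "w \<in> topspace \<Omega>"
    then obtain u where "u \<in> units G" "w = e u" using top by auto
    then show "?m (restrict (inv e) (topspace \<Omega>) w, w) = w"
      using e by (simp add: topspace_fibre_product top rng_of_unit)
  qed
  then show "(restrict (inv e) (topspace \<Omega>), ?m) \<in> groupoid_actions G \<Omega>"
    by (simp add: groupoid_actions_def fp)
qed

text \<open>An equivariant map preserves anchors, and the anchor map of the object space is the
  identity up to the relabelling \<open>e\<close>. So the anchor map of \<open>Y\<close> is the only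
  candidate.\<close>

lemma (in etale_groupoid) object_action_terminal:
  fixes e :: "'g \<Rightarrow> 'z"
  assumes e: "inj e" and am: "(a, m) \<in> groupoid_actions G Y"
  defines "\<Omega> \<equiv> pullback_topology (e ` units G) (inv e) (objects G)"
  defines "\<beta> \<equiv> (restrict (inv e) (topspace \<Omega>),
       restrict (\<lambda>(g, w). e (rng G g)) (topspace (fibre_product (arrows G) (src G) (inv e) \<Omega>)))"
  shows "continuous_map Y \<Omega> (e \<circ> a)"
    and "groupoid_equivariant G Y (a, m) \<beta> (e \<circ> a)"
    and "\<lbrakk>continuous_map Y \<Omega> \<phi>; groupoid_equivariant G Y (a, m) \<beta> \<phi>; y \<in> topspace Y\<rbrakk> \<Longrightarrow> \<phi> y = e (a y)"
proof -
  interpret A: left_action G Y a m using am by (simp add: groupoid_actions_def)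
  have top: "topspace \<Omega> = e ` units G" using e by (auto simp: \<Omega>_def topspace_pullback_topology)
  show "continuous_map Y \<Omega> (e \<circ> a)"
    using A.continuous_anchor homeomorphic_imp_continuous_map[OF object_action(1)[OF e]]
    unfolding \<Omega>_def by (rule continuous_map_compose)
  show "groupoid_equivariant G Y (a, m) \<beta> (e \<circ> a)"
    using A.anchor_in A.anchor_act e
    by (auto simp: groupoid_equivariant_def \<beta>_def top topspace_fibre_product)
  show "\<phi> y = e (a y)" if "continuous_map Y \<Omega> \<phi>" "groupoid_equivariant G Y (a, m) \<beta> \<phi>" "y \<in> topspace Y"
  proof -
    have "\<phi> y \<in> e ` units G" using that(1,3) top by (auto simp: continuous_map_def)
    moreover have "restrict (inv e) (topspace \<Omega>) (\<phi> y) = a y"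
      using that(2,3) by (simp add: groupoid_equivariant_def \<beta>_def)
    ultimately show ?thesis using e top by auto
  qed
qed

text \<open>The two injections say that the auxiliary type has room for the object space of \<open>M\<close> and for
  the path space.\<close>

theorem (in correspondence_setting) model_anchor_proper:
  fixes \<Phi> :: "('g, 'x, 'm, 'y) act_bij" and \<Psi> :: "('g, 'x, 'm, 'z) act_bij"
    and e :: "'m \<Rightarrow> 'z" and e' :: "'g \<times> (nat \<Rightarrow> 'x option) \<Rightarrow> 'z"
  assumes R: "openin (objects G) R" "invariant_set G R" "regular_on G X R"
    and M: "groupoid_model G X R M \<Phi> \<Psi>" and e: "inj e" and e': "inj e'"
  obtains r where "continuous_map (objects M) (objects G) r" "proper_map (objects M) (objects G) r"
    "\<And>Y a m n y. \<lbrakk>(a, m, n) \<in> corr_actions G X R Y; y \<in> topspace Y\<rbrakk> \<Longrightarrow> r (fst (\<Phi> Y (a, m, n)) y) = a y"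
proof -
  have etM: "etale_groupoid M" using M by (simp add: groupoid_model_def)
  interpret M: etale_groupoid M by (rule etM)
  define \<Omega> where "\<Omega> = pullback_topology (e ` units M) (inv e) (objects M)"
  define \<beta> where "\<beta> = (restrict (inv e) (topspace \<Omega>),
       restrict (\<lambda>(g, w). e (rng M g)) (topspace (fibre_product (arrows M) (src M) (inv e) \<Omega>)))"
  have \<beta>: "\<beta> \<in> groupoid_actions M \<Omega>" using M.object_action(2)[OF e] by (simp add: \<Omega>_def \<beta>_def)
  have bij: "bij_betw (\<Psi> \<Omega>) (corr_actions G X R \<Omega>) (groupoid_actions M \<Omega>)"
    using M by (simp add: groupoid_model_def action_bijections_def)
  \<comment> \<open>The action of the correspondence that matches the \<open>M\<close>-action on
    objects. By naturality it inherits terminality, and \<open>q\<close> becomes the map from the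
    objects of \<open>M\<close> to those of \<open>G\<close>.\<close>
  obtain \<alpha> where \<alpha>: "\<alpha> \<in> corr_actions G X R \<Omega>" "\<Psi> \<Omega> \<alpha> = \<beta>"
    using \<beta> bij by (metis (no_types, lifting) bij_betw_def imageE)
  obtain q m n where qmn: "\<alpha> = (q, m, n)" by (cases \<alpha>)
  have \<Psi>act: "\<Psi> Y \<gamma> \<in> groupoid_actions M Y" if "\<gamma> \<in> corr_actions G X R Y" for Y \<gamma>
    using M that unfolding groupoid_model_def action_bijections_def by (meson bij_betwE)
  have \<Psi>nat: "corr_equivariant G X Y \<Omega> \<gamma> \<alpha> \<phi> \<longleftrightarrow> groupoid_equivariant M Y (\<Psi> Y \<gamma>) \<beta> \<phi>"
    if "\<gamma> \<in> corr_actions G X R Y" "continuous_map Y \<Omega> \<phi>" for Y \<gamma> \<phi>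
    using M that \<alpha> unfolding groupoid_model_def natural_bijections_def by metis
  have prop_q: "proper_map \<Omega> (objects G) q"
  proof (rule terminal_anchor_proper[OF R, of q m n \<Omega> e'])
    show "(q, m, n) \<in> corr_actions G X R \<Omega>" using \<alpha>(1) qmn by simp
  next
    fix Y :: "'z topology" and \<gamma> assume \<gamma>: "\<gamma> \<in> corr_actions G X R Y"
    obtain b k where bk: "\<Psi> Y \<gamma> = (b, k)" by force
    have "(b, k) \<in> groupoid_actions M Y" using \<Psi>act[OF \<gamma>] bk by simp
    note t = M.object_action_terminal(1,2)[OF e this, folded \<Omega>_def, folded \<beta>_def]
    show "\<exists>\<phi>. continuous_map Y \<Omega> \<phi> \<and> corr_equivariant G X Y \<Omega> \<gamma> (q, m, n) \<phi>"
      using t \<Psi>nat[OF \<gamma> t(1)] bk qmn by auto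
  next
    fix Y :: "'z topology" and \<gamma> \<phi> \<psi> y
    assume \<gamma>: "\<gamma> \<in> corr_actions G X R Y"
      and \<phi>: "continuous_map Y \<Omega> \<phi>" "corr_equivariant G X Y \<Omega> \<gamma> (q, m, n) \<phi>"
      and \<psi>: "continuous_map Y \<Omega> \<psi>" "corr_equivariant G X Y \<Omega> \<gamma> (q, m, n) \<psi>" and y: "y \<in> topspace Y"
    obtain b k where bk: "\<Psi> Y \<gamma> = (b, k)" by force
    have "(b, k) \<in> groupoid_actions M Y" using \<Psi>act[OF \<gamma>] bk by simp
    note t = M.object_action_terminal(3)[OF e this, folded \<Omega>_def, folded \<beta>_def]
    have "groupoid_equivariant M Y (b, k) \<beta> \<phi>" "groupoid_equivariant M Y (b, k) \<beta> \<psi>"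
      using \<Psi>nat[OF \<gamma> \<phi>(1)] \<Psi>nat[OF \<gamma> \<psi>(1)] \<phi>(2) \<psi>(2) bk qmn by simp_all
    then show "\<phi> y = \<psi> y" using t[OF \<phi>(1) _ y] t[OF \<psi>(1) _ y] by simp
  qed (rule e')
  have hom: "homeomorphic_map (objects M) \<Omega> e" using M.object_action(1)[OF e] by (simp add: \<Omega>_def)
  show thesis
  proof (rule that)
    have "corr_action G X R \<Omega> q m n" using \<alpha>(1) qmn by (simp add: corr_actions_def)
    then have "continuous_map \<Omega> (objects G) q"
      using corr_action.groupoid_act left_action.continuous_anchor by blast
    then show "continuous_map (objects M) (objects G) (q \<circ> e)"
      using homeomorphic_imp_continuous_map[OF hom] continuous_map_compose by blast
    show "proper_map (objects M) (objects G) (q \<circ> e)"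
      using homeomorphic_imp_proper_map[OF hom] prop_q by (rule proper_map_compose)
    fix Y :: "'y topology" and a m' n' y
    assume \<gamma>: "(a, m', n') \<in> corr_actions G X R Y" and y: "y \<in> topspace Y"
    obtain b k where bk: "\<Phi> Y (a, m', n') = (b, k)" by force
    have "\<Phi> Y (a, m', n') \<in> groupoid_actions M Y"
      using M \<gamma> unfolding groupoid_model_def action_bijections_def by (meson bij_betwE)
    then have "(b, k) \<in> groupoid_actions M Y" using bk by simp
    note t = M.object_action_terminal(1,2)[OF e this, folded \<Omega>_def, folded \<beta>_def]
    \<comment> \<open>Here naturality across the two types is used: \<open>Y\<close> lives on the
      type of \<open>\<Phi>\<close> and the object space on that of \<open>\<Psi>\<close>.
      Preservation of anchors by \<open>e \<circ> b\<close> is the desired factorisation.\<close>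
    have "natural_bijections G X R M \<Phi> \<Psi>" using M by (simp add: groupoid_model_def)
    then have "corr_equivariant G X Y \<Omega> (a, m', n') \<alpha> (e \<circ> b)"
      using \<gamma> \<alpha> t bk unfolding natural_bijections_def by metis
    then show "(q \<circ> e) (fst (\<Phi> Y (a, m', n')) y) = a y"
      using y bk qmn by (simp add: corr_equivariant_def groupoid_equivariant_def)
  qed
qed

section \<open>Actions that commute with right translations\<close>

lemma fibre_product_subtopology:
  "fibre_product A p q (subtopology B S) = subtopology (fibre_product A p q B) (topspace A \<times> S)"
  unfolding fibre_product_def prod_topology_subtopology(2)
  by (simp add: subtopology_subtopology Int_commute)

lemma left_action_subtopology:
  assumes "left_action G Y a m"
    and S: "\<And>g y. \<lbrakk>g \<in> topspace (arrows G); y \<in> topspace Y; src G g = a y; y \<in> S\<rbrakk> \<Longrightarrow> m (g, y) \<in> S"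
  shows "left_action G (subtopology Y S) a m"
proof -
  interpret A: left_action G Y a m by fact
  show ?thesis
  proof (rule left_action.intro)
    show "continuous_map (subtopology Y S) (objects G) a"
      using A.continuous_anchor by (rule continuous_map_from_subtopology)
    show "continuous_map (fibre_product (arrows G) (src G) a (subtopology Y S)) (subtopology Y S) m"
      unfolding fibre_product_subtopology
      using S by (intro continuous_map_into_subtopology continuous_map_from_subtopology A.continuous_act)
        (auto simp: topspace_fibre_product)
  qed (use A.anchor_act A.act_act A.unit_act in simp_all)
qed

text \<open>The equivalence in the hypothesis on \<open>n\<close> makes a product lie in
  \<open>S\<close> exactly if its second factor does. Thus \<open>mul\<close> commutes with
  intersecting by \<open>S\<close>, and the open sets, closed sets and coverings restrict.\<close>

lemma (in correspondence_setting) corr_action_subtopology: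
  assumes act: "corr_action G X R Y a m n"
    and m: "\<And>g y. \<lbrakk>g \<in> GA; y \<in> topspace Y; src G g = a y; y \<in> S\<rbrakk> \<Longrightarrow> m (g, y) \<in> S"
    and n: "\<And>x y. \<lbrakk>x \<in> XS; y \<in> topspace Y; ranchor X x = a y\<rbrakk> \<Longrightarrow> n (x, y) \<in> S \<longleftrightarrow> y \<in> S"
  shows "corr_action G X R (subtopology Y S) a m n"
proof -
  interpret A: corr_action G X R Y a m n by (rule act)
  interpret B: set_action G X R "topspace Y" a m n using act by (rule set_action_of_corr_action)
  interpret C: left_action G "subtopology Y S" a m
    using A.groupoid_act m by (rule left_action_subtopology)
  interpret S: set_action G X R "topspace (subtopology Y S)" a m n
  proof unfold_locales
    fix y assume "y \<in> topspace (subtopology Y S)" "a y \<in> R"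
    then show "\<exists>x\<in>XS. \<exists>y'\<in>topspace (subtopology Y S). ranchor X x = a y' \<and> y = n (x, y')"
      using B.covers[of y] n by auto
  qed (use B.anchor_unit C.act_in B.anchor_act B.act_act B.unit_act B.mult_in B.anchor_mult B.act_mult B.mult_eq_iff n in
      \<open>simp_all\<close>)
  have mul: "S.mul V (W \<inter> S) = B.mul V W \<inter> S" if "V \<subseteq> XS" "W \<subseteq> topspace Y" for V W
    using that n by (fastforce simp: B.mul_def)
  show ?thesis
  proof (rule S.corr_actionI)
    show "continuous_map (subtopology Y S) (objects G) a" by (rule C.continuous_anchor)
    show "continuous_map (fibre_product (arrows G) (src G) a (subtopology Y S)) (subtopology Y S) m"
      by (rule C.continuous_act)
    show "continuous_map (corr_domain X a (subtopology Y S)) (subtopology Y S) n"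
      unfolding corr_domain_def fibre_product_subtopology
      using n A.continuous_mult[unfolded corr_domain_def]
      by (intro continuous_map_into_subtopology continuous_map_from_subtopology)
        (auto simp: topspace_fibre_product)
  next
    fix V W assume VW: "openin (cspace X) V" "openin (subtopology Y S) W"
    then obtain W' where W': "openin Y W'" "W = W' \<inter> S" by (auto simp: openin_subtopology)
    have "S.mul V W = B.mul V W' \<inter> S"
      unfolding W'(2) using openin_subset[OF VW(1)] openin_subset[OF W'(1)] by (rule mul)
    then show "openin (subtopology Y S) (S.mul V W)"
      using corr_action_open_closed(1)[OF act VW(1) W'(1)] by (auto simp: openin_subtopology)
  next
    fix L assume L: "compactin (cspace X) L"
    have "S.mul L (topspace (subtopology Y S)) = B.mul L (topspace Y) \<inter> S"
      using mul[OF compactin_subset_topspace[OF L] subset_refl] by simp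
    then show "closedin (subtopology Y S) (S.mul L (topspace (subtopology Y S)))"
      using corr_action_open_closed(2)[OF act L] by (auto simp: closedin_subtopology)
  qed simp
qed

definition translation_equivariant :: "'g tgroupoid \<Rightarrow> ('g, 'x) correspondence \<Rightarrow> 'h tgroupoid \<Rightarrow>
    ('h \<Rightarrow> 'g) \<Rightarrow> ('g \<times> 'h \<Rightarrow> 'h) \<Rightarrow> ('x \<times> 'h \<Rightarrow> 'h) \<Rightarrow> bool" where
  "translation_equivariant G X H a m n \<longleftrightarrow>
     commuting_actions G H (arrows H) a m (src H) (\<lambda>(h, k). gcomp H h k) \<and>
     (\<forall>x \<in> topspace (cspace X). \<forall>h \<in> topspace (arrows H). ranchor X x = a h \<longrightarrow>
        src H (n (x, h)) = src H h \<and>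
        (\<forall>k \<in> topspace (arrows H). src H h = rng H k \<longrightarrow> n (x, gcomp H h k) = gcomp H (n (x, h)) k))"

text \<open>Right translation by \<open>u\<close> is an equivariant map on the fibre of the source map over \<open>r(u)\<close>.
  Translation by a unit is the inclusion map.\<close>

locale actor_space = correspondence_setting G X + H: etale_groupoid H
  for G :: "'g tgroupoid" and X :: "('g, 'x) correspondence" and H :: "'h tgroupoid" +
  fixes R :: "'g set"
begin

abbreviation "HA \<equiv> topspace (arrows H)"

definition source_fibre :: "'h \<Rightarrow> 'h topology" where
  "source_fibre v = subtopology (arrows H) {h. src H h = v}"

lemma topspace_source_fibre [simp]: "topspace (source_fibre v) = {h \<in> HA. src H h = v}"
  by (auto simp: source_fibre_def)

lemma continuous_translation:
  "u \<in> HA \<Longrightarrow> continuous_map (source_fibre (rng H u)) (arrows H) (\<lambda>h. gcomp H h u)"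
  unfolding source_fibre_def by (rule H.right_translation_continuous)

lemma translation_equivariantI:
  assumes "\<And>h k. \<lbrakk>h \<in> HA; k \<in> HA; src H h = rng H k\<rbrakk> \<Longrightarrow> a (gcomp H h k) = a h"
    and "\<And>g h. \<lbrakk>g \<in> GA; h \<in> HA; src G g = a h\<rbrakk> \<Longrightarrow> src H (m (g, h)) = src H h"
    and "\<And>g h k. \<lbrakk>g \<in> GA; h \<in> HA; k \<in> HA; src G g = a h; src H h = rng H k\<rbrakk> \<Longrightarrow>
      m (g, gcomp H h k) = gcomp H (m (g, h)) k"
    and "\<And>x h. \<lbrakk>x \<in> XS; h \<in> HA; ranchor X x = a h\<rbrakk> \<Longrightarrow> src H (n (x, h)) = src H h"
    and "\<And>x h k. \<lbrakk>x \<in> XS; h \<in> HA; k \<in> HA; ranchor X x = a h; src H h = rng H k\<rbrakk> \<Longrightarrow>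
      n (x, gcomp H h k) = gcomp H (n (x, h)) k"
  shows "translation_equivariant G X H a m n"
  using assms unfolding translation_equivariant_def commuting_actions_def by auto

lemma translation_equivariantD:
  assumes "translation_equivariant G X H a m n"
  shows "\<And>h k. \<lbrakk>h \<in> HA; k \<in> HA; src H h = rng H k\<rbrakk> \<Longrightarrow> a (gcomp H h k) = a h"
    and "\<And>g h. \<lbrakk>g \<in> GA; h \<in> HA; src G g = a h\<rbrakk> \<Longrightarrow> src H (m (g, h)) = src H h"
    and "\<And>g h k. \<lbrakk>g \<in> GA; h \<in> HA; k \<in> HA; src G g = a h; src H h = rng H k\<rbrakk> \<Longrightarrow>
      m (g, gcomp H h k) = gcomp H (m (g, h)) k"
    and "\<And>x h. \<lbrakk>x \<in> XS; h \<in> HA; ranchor X x = a h\<rbrakk> \<Longrightarrow> src H (n (x, h)) = src H h"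
    and "\<And>x h k. \<lbrakk>x \<in> XS; h \<in> HA; k \<in> HA; ranchor X x = a h; src H h = rng H k\<rbrakk> \<Longrightarrow>
      n (x, gcomp H h k) = gcomp H (n (x, h)) k"
  using assms unfolding translation_equivariant_def commuting_actions_def by auto

text \<open>Taking \<open>u\<close> to be a unit identifies the auxiliary fibrewise maps
  \<open>bY\<close> and \<open>kY\<close> with \<open>b\<close> and \<open>k\<close> on that fibre;
  general \<open>u\<close> then gives the commutation rules. The same argument serves for arrows of
  \<open>M\<close>, arrows of \<open>G\<close> and elements of \<open>X\<close>.\<close>

lemma equivariant_on_fibres:
  assumes k: "\<And>g h. \<lbrakk>g \<in> A; h \<in> HA; p g = b h\<rbrakk> \<Longrightarrow>
      kY (src H h) (g, h) \<in> HA \<and> src H (kY (src H h) (g, h)) = src H h"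
    and tr: "\<And>g h u. \<lbrakk>g \<in> A; h \<in> HA; u \<in> HA; p g = bY (src H h) h; src H h = rng H u\<rbrakk> \<Longrightarrow>
      gcomp H (kY (src H h) (g, h)) u = k (g, gcomp H h u)"
    and b: "\<And>h u. \<lbrakk>h \<in> HA; u \<in> HA; src H h = rng H u\<rbrakk> \<Longrightarrow> b (gcomp H h u) = bY (src H h) h"
  shows "(\<forall>h\<in>HA. \<forall>u\<in>HA. src H h = rng H u \<longrightarrow> b (gcomp H h u) = b h) \<and>
    (\<forall>g\<in>A. \<forall>h\<in>HA. p g = b h \<longrightarrow> src H (k (g, h)) = src H h) \<and>
    (\<forall>g\<in>A. \<forall>h\<in>HA. \<forall>u\<in>HA. p g = b h \<longrightarrow> src H h = rng H u \<longrightarrow>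
      k (g, gcomp H h u) = gcomp H (k (g, h)) u)"
proof -
  have un: "src H h \<in> HA" "src H h = rng H (src H h)" if "h \<in> HA" for h
    using H.src_unit[OF that] by (simp_all add: H.rng_of_unit)
  have bb: "b h = bY (src H h) h" if "h \<in> HA" for h
    using b[OF that un[OF that]] H.right_unit[OF that] by simp
  have kk: "k (g, h) = kY (src H h) (g, h)" if "g \<in> A" "h \<in> HA" "p g = b h" for g h
    using tr[OF that(1,2) un(1)[OF that(2)] _ un(2)[OF that(2)]] H.right_unit[OF that(2)]
      H.right_unit[of "kY (src H h) (g, h)"] k[OF that] bb[OF that(2)] that(3) by simp
  have "b (gcomp H h u) = b h" if "h \<in> HA" "u \<in> HA" "src H h = rng H u" for h u
    using b[OF that] bb[OF that(1)] by simp
  moreover have "src H (k (g, h)) = src H h" if "g \<in> A" "h \<in> HA" "p g = b h" for g h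
    using kk[OF that] k[OF that] by simp
  moreover have "k (g, gcomp H h u) = gcomp H (k (g, h)) u"
    if "g \<in> A" "h \<in> HA" "u \<in> HA" "p g = b h" "src H h = rng H u" for g h u
    using tr[of g h u] that bb[of h] kk[of g h] by simp
  ultimately show ?thesis by blast
qed

lemma translation_corr_equivariant:
  assumes act: "(a, m, n) \<in> corr_actions G X R (arrows H)" and eq: "translation_equivariant G X H a m n"
    and u: "u \<in> HA"
  defines "Y \<equiv> source_fibre (rng H u)"
  defines "\<alpha> \<equiv> (restrict a (topspace Y), restrict m (topspace (fibre_product (arrows G) (src G) a Y)),
    restrict n (topspace (corr_domain X a Y)))"
  shows "\<alpha> \<in> corr_actions G X R Y"
    and "corr_equivariant G X Y (arrows H) \<alpha> (a, m, n) (\<lambda>h. gcomp H h u)"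
proof -
  have cact: "corr_action G X R (arrows H) a m n" using act by (simp add: corr_actions_def)
  interpret S: set_action G X R HA a m n using cact by (rule set_action_of_corr_action)
  note D = translation_equivariantD[OF eq]
  have "corr_action G X R Y a m n"
    unfolding Y_def source_fibre_def using D(2,4) by (intro corr_action_subtopology[OF cact]) auto
  then show "\<alpha> \<in> corr_actions G X R Y" unfolding \<alpha>_def by (rule corr_action_restrict)
  have pre: "{h \<in> topspace Y. gcomp H h u \<in> n ` topspace (corr_domain X a (arrows H))} =
      restrict n (topspace (corr_domain X a Y)) ` topspace (corr_domain X (restrict a (topspace Y)) Y)"
  proof (intro subset_antisym subsetI)
    fix h assume h: "h \<in> {h \<in> topspace Y. gcomp H h u \<in> n ` topspace (corr_domain X a (arrows H))}"
    then obtain x k where xk: "x \<in> XS" "k \<in> HA" "ranchor X x = a k" "gcomp H h u = n (x, k)"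
      by (auto simp: topspace_corr_domain)
    have hY: "h \<in> HA" "src H h = rng H u" using h by (auto simp: Y_def)
    have src: "src H k = src H u" using D(4)[OF xk(1-3)] xk(4) H.src_comp[OF hY(1) u hY(2)] by simp
    \<comment> \<open>If \<open>gcomp H h u\<close> is a product with second factor
      \<open>k\<close>, undoing the translation exhibits \<open>h\<close> as a product with second
      factor \<open>k'\<close>. This is the preimage clause of equivariance.\<close>
    define k' where "k' = gcomp H k (ginv H u)"
    have k': "k' \<in> HA" "src H k' = rng H u" "a k' = a k"
      using xk u src D(1)[of k "ginv H u"]
      by (simp_all add: k'_def H.comp_closed H.ginv_closed H.rng_ginv H.src_comp H.src_ginv)
    have "h = gcomp H (gcomp H h u) (ginv H u)" using H.cancel_right[OF hY(1) u hY(2)] by simp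
    also have "\<dots> = n (x, k')"
      unfolding xk(4) k'_def using D(5)[of x k "ginv H u"] xk u src by (simp add: H.ginv_closed H.rng_ginv)
    finally have "h = n (x, k')" .
    then show "h \<in> restrict n (topspace (corr_domain X a Y)) ` topspace (corr_domain X (restrict a (topspace Y)) Y)"
      using k' xk(1,3) by (intro image_eqI[of _ _ "(x, k')"]) (auto simp: topspace_corr_domain Y_def)
  next
    fix h assume "h \<in> restrict n (topspace (corr_domain X a Y)) ` topspace (corr_domain X (restrict a (topspace Y)) Y)"
    then obtain x k where xk: "x \<in> XS" "k \<in> HA" "src H k = rng H u" "ranchor X x = a k" "h = n (x, k)"
      by (auto simp: topspace_corr_domain Y_def)
    have "h \<in> HA" "src H h = rng H u" using xk D(4)[of x k] S.mult_in[of x k] by simp_all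
    moreover have "gcomp H h u = n (x, gcomp H k u)" using D(5)[of x k u] xk u by simp
    moreover have "(x, gcomp H k u) \<in> topspace (corr_domain X a (arrows H))"
      using xk u D(1)[of k u] by (simp add: topspace_corr_domain H.comp_closed)
    ultimately show "h \<in> {h \<in> topspace Y. gcomp H h u \<in> n ` topspace (corr_domain X a (arrows H))}"
      by (auto simp: Y_def)
  qed
  show "corr_equivariant G X Y (arrows H) \<alpha> (a, m, n) (\<lambda>h. gcomp H h u)"
    unfolding corr_equivariant_def \<alpha>_def split groupoid_equivariant_def
    using D(1,3,5) u pre by (auto simp: Y_def topspace_fibre_product topspace_corr_domain)
qed

lemma translation_groupoid_equivariant:
  assumes M: "etale_groupoid M" and act: "(b, k) \<in> actors M H" and u: "u \<in> HA"
  defines "Y \<equiv> source_fibre (rng H u)"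
  defines "\<beta> \<equiv> (restrict b (topspace Y), restrict k (topspace (fibre_product (arrows M) (src M) b Y)))"
  shows "\<beta> \<in> groupoid_actions M Y"
    and "groupoid_equivariant M Y \<beta> (b, k) (\<lambda>h. gcomp H h u)"
proof -
  interpret M: etale_groupoid M by (rule M)
  have lact: "left_action M (arrows H) b k"
    and c: "commuting_actions M H (arrows H) b k (src H) (\<lambda>(h, k). gcomp H h k)"
    using act by (auto simp: actors_def groupoid_actions_def)
  have "left_action M Y b k"
    unfolding Y_def source_fibre_def
    using c by (intro left_action_subtopology[OF lact]) (auto simp: commuting_actions_def)
  then interpret B: left_action M Y b k .
  have fp: "fibre_product (arrows M) (src M) (restrict b (topspace Y)) Y = fibre_product (arrows M) (src M) b Y"
    by (rule fibre_product_restrict)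
  have "left_action M Y (restrict b (topspace Y)) (restrict k (topspace (fibre_product (arrows M) (src M) b Y)))"
  proof (rule left_action.intro)
    show "continuous_map Y (objects M) (restrict b (topspace Y))"
      by (rule continuous_map_eq[OF B.continuous_anchor]) simp
    show "continuous_map (fibre_product (arrows M) (src M) (restrict b (topspace Y)) Y) Y
        (restrict k (topspace (fibre_product (arrows M) (src M) b Y)))"
      unfolding fp by (rule continuous_map_eq[OF B.continuous_act]) simp
  qed (use B.anchor_act B.act_act B.unit_act B.act_in B.anchor_in in
      \<open>simp_all add: topspace_fibre_product M.comp_closed M.src_comp\<close>)
  then show "\<beta> \<in> groupoid_actions M Y" by (simp add: groupoid_actions_def \<beta>_def fp)
  show "groupoid_equivariant M Y \<beta> (b, k) (\<lambda>h. gcomp H h u)"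
    using c u by (auto simp: groupoid_equivariant_def \<beta>_def Y_def topspace_fibre_product commuting_actions_def)
qed

lemma actor_iff_translation_equivariant:
  fixes \<Phi> :: "('g, 'x, 'm, 'h) act_bij"
  assumes M: "etale_groupoid M" and bij: "action_bijections G X R M \<Phi>" and nat: "natural_bijections G X R M \<Phi> \<Phi>"
    and act: "(a, m, n) \<in> corr_actions G X R (arrows H)"
  shows "\<Phi> (arrows H) (a, m, n) \<in> actors M H \<longleftrightarrow> translation_equivariant G X H a m n"
proof
  interpret M: etale_groupoid M by (rule M)
  obtain b k where bk: "\<Phi> (arrows H) (a, m, n) = (b, k)" by force
  have \<Phi>: "bij_betw (\<Phi> Y) (corr_actions G X R Y) (groupoid_actions M Y)" for Y
    using bij by (simp add: action_bijections_def)
  have bkact: "(b, k) \<in> groupoid_actions M (arrows H)" using \<Phi> act bk by (metis bij_betwE)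
  {
    assume eq: "translation_equivariant G X H a m n"
    define \<alpha>Y where "\<alpha>Y = (\<lambda>v. (restrict a (topspace (source_fibre v)),
      restrict m (topspace (fibre_product (arrows G) (src G) a (source_fibre v))),
      restrict n (topspace (corr_domain X a (source_fibre v)))))"
    \<comment> \<open>The fibre action is produced by \<open>\<Phi>\<close> and is not known in
      advance to be a restriction of \<open>(b, k)\<close>. \<open>equivariant_on_fibres\<close>
      needs only that all translations from it into \<open>H\<close> are equivariant.\<close>
    define bY where "bY = (\<lambda>v. fst (\<Phi> (source_fibre v) (\<alpha>Y v)))"
    define kY where "kY = (\<lambda>v. snd (\<Phi> (source_fibre v) (\<alpha>Y v)))"
    have \<alpha>Y: "\<alpha>Y (rng H u) \<in> corr_actions G X R (source_fibre (rng H u))"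
      "corr_equivariant G X (source_fibre (rng H u)) (arrows H) (\<alpha>Y (rng H u)) (a, m, n) (\<lambda>h. gcomp H h u)"
      if "u \<in> HA" for u
      unfolding \<alpha>Y_def using translation_corr_equivariant[OF act eq that] by simp_all
    have kY: "left_action M (source_fibre (rng H u)) (bY (rng H u)) (kY (rng H u))"
      and ge: "groupoid_equivariant M (source_fibre (rng H u)) (bY (rng H u), kY (rng H u)) (b, k) (\<lambda>h. gcomp H h u)"
      if u: "u \<in> HA" for u
    proof -
      have "\<Phi> (source_fibre (rng H u)) (\<alpha>Y (rng H u)) \<in> groupoid_actions M (source_fibre (rng H u))"
        using \<Phi> \<alpha>Y(1)[OF u] by (meson bij_betwE)
      then show "left_action M (source_fibre (rng H u)) (bY (rng H u)) (kY (rng H u))"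
        by (simp add: groupoid_actions_def bY_def kY_def split: prod.splits)
      have "groupoid_equivariant M (source_fibre (rng H u)) (\<Phi> (source_fibre (rng H u)) (\<alpha>Y (rng H u)))
          (\<Phi> (arrows H) (a, m, n)) (\<lambda>h. gcomp H h u)"
        using nat \<alpha>Y[OF u] act continuous_translation[OF u] unfolding natural_bijections_def by blast
      then show "groupoid_equivariant M (source_fibre (rng H u)) (bY (rng H u), kY (rng H u)) (b, k) (\<lambda>h. gcomp H h u)"
        by (simp add: bk bY_def kY_def)
    qed
    have un: "src H h \<in> HA" "rng H (src H h) = src H h" if "h \<in> HA" for h
      using H.src_unit[OF that] by (simp_all add: H.rng_of_unit)
    have b: "b (gcomp H h u) = bY (src H h) h" if "h \<in> HA" "u \<in> HA" "src H h = rng H u" for h u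
      using ge[OF that(2)] that by (simp add: groupoid_equivariant_def)
    have tr: "gcomp H (kY (src H h) (g, h)) u = k (g, gcomp H h u)"
      if "g \<in> topspace (arrows M)" "h \<in> HA" "u \<in> HA" "src M g = bY (src H h) h" "src H h = rng H u" for g h u
      using ge[OF that(3)] that by (simp add: groupoid_equivariant_def)
    have kin: "kY (src H h) (g, h) \<in> HA \<and> src H (kY (src H h) (g, h)) = src H h"
      if "g \<in> topspace (arrows M)" "h \<in> HA" "src M g = b h" for g h
    proof -
      have "b h = bY (src H h) h" using b[of h "src H h"] un[OF that(2)] H.right_unit[OF that(2)] that(2) by simp
      then show ?thesis
        using left_action.act_in[OF kY[OF un(1)[OF that(2)]], of g h] un[OF that(2)] that by simp
    qed
    have "(\<forall>h\<in>HA. \<forall>u\<in>HA. src H h = rng H u \<longrightarrow> b (gcomp H h u) = b h) \<and>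
      (\<forall>g\<in>topspace (arrows M). \<forall>h\<in>HA. src M g = b h \<longrightarrow> src H (k (g, h)) = src H h) \<and>
      (\<forall>g\<in>topspace (arrows M). \<forall>h\<in>HA. \<forall>u\<in>HA. src M g = b h \<longrightarrow> src H h = rng H u \<longrightarrow>
        k (g, gcomp H h u) = gcomp H (k (g, h)) u)"
      by (rule equivariant_on_fibres[where kY = kY and bY = bY]; (rule kin tr b; assumption))
    then have "commuting_actions M H (arrows H) b k (src H) (\<lambda>(h, k). gcomp H h k)"
      unfolding commuting_actions_def by simp
    then show "\<Phi> (arrows H) (a, m, n) \<in> actors M H" using bkact bk by (simp add: actors_def)
  next
    assume actor: "\<Phi> (arrows H) (a, m, n) \<in> actors M H"
    then have actor': "(b, k) \<in> actors M H" using bk by simp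
    define \<beta>Y where "\<beta>Y = (\<lambda>v. (restrict b (topspace (source_fibre v)),
      restrict k (topspace (fibre_product (arrows M) (src M) b (source_fibre v)))))"
    \<comment> \<open>For the converse the restricted \<open>M\<close>-action is sent back through
      the bijection on the fibre.\<close>
    define \<alpha>Y where "\<alpha>Y = (\<lambda>v. inv_into (corr_actions G X R (source_fibre v)) (\<Phi> (source_fibre v)) (\<beta>Y v))"
    define aY where "aY = (\<lambda>v. fst (\<alpha>Y v))"
    define mY where "mY = (\<lambda>v. fst (snd (\<alpha>Y v)))"
    define nY where "nY = (\<lambda>v. snd (snd (\<alpha>Y v)))"
    have \<alpha>Yeq: "\<alpha>Y v = (aY v, mY v, nY v)" for v by (simp add: aY_def mY_def nY_def)
    have cY: "corr_action G X R (source_fibre (rng H u)) (aY (rng H u)) (mY (rng H u)) (nY (rng H u))"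
      and ce: "corr_equivariant G X (source_fibre (rng H u)) (arrows H)
        (aY (rng H u), mY (rng H u), nY (rng H u)) (a, m, n) (\<lambda>h. gcomp H h u)"
      if u: "u \<in> HA" for u
    proof -
      have \<beta>: "\<beta>Y (rng H u) \<in> groupoid_actions M (source_fibre (rng H u))"
        "groupoid_equivariant M (source_fibre (rng H u)) (\<beta>Y (rng H u)) (b, k) (\<lambda>h. gcomp H h u)"
        unfolding \<beta>Y_def using translation_groupoid_equivariant[OF M actor' u] by simp_all
      have \<alpha>: "\<alpha>Y (rng H u) \<in> corr_actions G X R (source_fibre (rng H u))"
        "\<Phi> (source_fibre (rng H u)) (\<alpha>Y (rng H u)) = \<beta>Y (rng H u)"
        unfolding \<alpha>Y_def using \<Phi>[of "source_fibre (rng H u)"] \<beta>(1)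
        by (simp_all add: bij_betw_def inv_into_into f_inv_into_f)
      show "corr_action G X R (source_fibre (rng H u)) (aY (rng H u)) (mY (rng H u)) (nY (rng H u))"
        using \<alpha>(1) unfolding \<alpha>Yeq corr_actions_def by simp
      have "corr_equivariant G X (source_fibre (rng H u)) (arrows H) (\<alpha>Y (rng H u)) (a, m, n) (\<lambda>h. gcomp H h u)"
        using nat \<alpha> \<beta>(2) act bk continuous_translation[OF u] unfolding natural_bijections_def by metis
      then show "corr_equivariant G X (source_fibre (rng H u)) (arrows H)
        (aY (rng H u), mY (rng H u), nY (rng H u)) (a, m, n) (\<lambda>h. gcomp H h u)" by (simp add: \<alpha>Yeq)
    qed
    have un: "src H h \<in> HA" "rng H (src H h) = src H h" if "h \<in> HA" for h
      using H.src_unit[OF that] by (simp_all add: H.rng_of_unit)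
    have a: "a (gcomp H h u) = aY (src H h) h" if "h \<in> HA" "u \<in> HA" "src H h = rng H u" for h u
      using ce[OF that(2)] that by (simp add: corr_equivariant_def groupoid_equivariant_def)
    have aY: "a h = aY (src H h) h" if "h \<in> HA" for h
      using a[of h "src H h"] un[OF that] H.right_unit[OF that] that by simp
    have trm: "gcomp H (mY (src H h) (g, h)) u = m (g, gcomp H h u)"
      if "g \<in> GA" "h \<in> HA" "u \<in> HA" "src G g = aY (src H h) h" "src H h = rng H u" for g h u
      using ce[OF that(3)] that by (simp add: corr_equivariant_def groupoid_equivariant_def)
    have trn: "gcomp H (nY (src H h) (x, h)) u = n (x, gcomp H h u)"
      if "x \<in> XS" "h \<in> HA" "u \<in> HA" "ranchor X x = aY (src H h) h" "src H h = rng H u" for x h u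
      using ce[OF that(3)] that by (simp add: corr_equivariant_def)
    have sY: "set_action G X R {k \<in> HA. src H k = src H h} (aY (src H h)) (mY (src H h)) (nY (src H h))"
      if "h \<in> HA" for h
      using set_action_of_corr_action[OF cY[OF un(1)[OF that]]] un[OF that] by simp
    have min: "mY (src H h) (g, h) \<in> HA \<and> src H (mY (src H h) (g, h)) = src H h"
      if "g \<in> GA" "h \<in> HA" "src G g = a h" for g h
      using set_action.act_in[OF sY[OF that(2)], of g h] that aY[OF that(2)] by simp
    have nin: "nY (src H h) (x, h) \<in> HA \<and> src H (nY (src H h) (x, h)) = src H h"
      if "x \<in> XS" "h \<in> HA" "ranchor X x = a h" for x h
      using set_action.mult_in[OF sY[OF that(2)], of x h] that aY[OF that(2)] by simp
    have "(\<forall>h\<in>HA. \<forall>u\<in>HA. src H h = rng H u \<longrightarrow> a (gcomp H h u) = a h) \<and>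
      (\<forall>g\<in>GA. \<forall>h\<in>HA. src G g = a h \<longrightarrow> src H (m (g, h)) = src H h) \<and>
      (\<forall>g\<in>GA. \<forall>h\<in>HA. \<forall>u\<in>HA. src G g = a h \<longrightarrow> src H h = rng H u \<longrightarrow>
        m (g, gcomp H h u) = gcomp H (m (g, h)) u)"
      by (rule equivariant_on_fibres[where kY = mY and bY = aY]; (rule min trm a; assumption))
    moreover have "(\<forall>h\<in>HA. \<forall>u\<in>HA. src H h = rng H u \<longrightarrow> a (gcomp H h u) = a h) \<and>
      (\<forall>x\<in>XS. \<forall>h\<in>HA. ranchor X x = a h \<longrightarrow> src H (n (x, h)) = src H h) \<and>
      (\<forall>x\<in>XS. \<forall>h\<in>HA. \<forall>u\<in>HA. ranchor X x = a h \<longrightarrow> src H h = rng H u \<longrightarrow>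
        n (x, gcomp H h u) = gcomp H (n (x, h)) u)"
      by (rule equivariant_on_fibres[where kY = nY and bY = aY]; (rule nin trn a; assumption))
    ultimately show "translation_equivariant G X H a m n"
      by (intro translation_equivariantI) simp_all
  }
qed

end

section \<open>Actors from maps on the object space\<close>

lemma (in etale_groupoid) actor_mult_continuous:
  assumes \<mu>: "continuous_map (fibre_product Z p \<rho> (objects G)) (arrows G) \<mu>"
    and src: "\<And>z \<omega>. \<lbrakk>z \<in> topspace Z; \<omega> \<in> units G; p z = \<rho> \<omega>\<rbrakk> \<Longrightarrow> src G (\<mu> (z, \<omega>)) = \<omega>"
  shows "continuous_map (fibre_product Z p (\<rho> \<circ> rng G) (arrows G)) (arrows G) (\<lambda>(z, h). actor_mult G \<mu> z h)"
proof -
  let ?D = "fibre_product Z p (\<rho> \<circ> rng G) (arrows G)"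
  have fst: "continuous_map ?D Z fst" and snd: "continuous_map ?D (arrows G) snd"
    unfolding fibre_product_def
    by (intro continuous_map_from_subtopology continuous_map_fst continuous_map_snd)+
  have "continuous_map ?D (fibre_product Z p \<rho> (objects G)) (\<lambda>t. (fst t, rng G (snd t)))"
    unfolding fibre_product_def[of Z p \<rho>]
    using fst continuous_map_compose[OF snd continuous_rng]
    by (intro continuous_map_into_subtopology) (auto simp: continuous_map_pairwise o_def topspace_fibre_product)
  from continuous_map_compose[OF this \<mu>]
  have "continuous_map ?D (arrows G) (\<lambda>t. \<mu> (fst t, rng G (snd t)))" by (simp add: o_def)
  then have "continuous_map ?D (fibre_product (arrows G) (src G) (rng G) (arrows G))
      (\<lambda>t. (\<mu> (fst t, rng G (snd t)), snd t))"
    unfolding fibre_product_def[of "arrows G"]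
    using snd src rng_unit
    by (intro continuous_map_into_subtopology) (auto simp: continuous_map_pairwise o_def topspace_fibre_product)
  from continuous_map_compose[OF this continuous_comp] show ?thesis
    by (simp add: o_def actor_mult_def case_prod_unfold)
qed

text \<open>An arrow \<open>k'\<close> near \<open>k\<close> should factor through some
  \<open>h'\<close> in \<open>W\<close>. Openness of \<open>src\<close> gives \<open>h'\<close> near
  \<open>h\<close> with the source of \<open>k'\<close>, and continuity of division keeps the
  quotient of \<open>k'\<close> by \<open>h'\<close> in the open set \<open>P\<close> of values of
  \<mu>.\<close>

lemma (in etale_groupoid) actor_mult_open:
  assumes op: "open_map (fibre_product Z p \<rho> (objects G)) (arrows G) \<mu>"
    and \<mu>: "\<And>z \<omega>. \<lbrakk>z \<in> topspace Z; \<omega> \<in> units G; p z = \<rho> \<omega>\<rbrakk> \<Longrightarrow>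
      \<mu> (z, \<omega>) \<in> topspace (arrows G) \<and> src G (\<mu> (z, \<omega>)) = \<omega>"
  shows "open_map (fibre_product Z p (\<rho> \<circ> rng G) (arrows G)) (arrows G) (\<lambda>(z, h). actor_mult G \<mu> z h)"
  unfolding open_map_fibre_product_iff
proof (intro allI impI)
  fix V W assume VW: "openin Z V" "openin (arrows G) W"
  define P where "P = {\<mu> (z, \<omega>) |z \<omega>. z \<in> V \<and> \<omega> \<in> units G \<and> p z = \<rho> \<omega>}"
  have "openin (objects G) (units G)" using openin_topspace[of "objects G"] by simp
  then have P: "openin (arrows G) P"
    unfolding P_def using op[unfolded open_map_fibre_product_iff, rule_format, OF VW(1)] by blast
  show "openin (arrows G) {(case (z, h) of (z, h) \<Rightarrow> actor_mult G \<mu> z h) |z h. z \<in> V \<and> h \<in> W \<and> p z = (\<rho> \<circ> rng G) h}"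
    (is "openin _ ?S")
  proof (subst openin_subopen, intro ballI)
    fix k assume "k \<in> ?S"
    then obtain z h where zh: "z \<in> V" "h \<in> W" "p z = \<rho> (rng G h)" "k = gcomp G (\<mu> (z, rng G h)) h"
      by (auto simp: actor_mult_def)
    have h: "h \<in> topspace (arrows G)" using zh(2) openin_subset[OF VW(2)] by blast
    have z: "z \<in> topspace Z" using zh(1) openin_subset[OF VW(1)] by blast
    define u where "u = \<mu> (z, rng G h)"
    have u: "u \<in> topspace (arrows G)" "src G u = rng G h" "u \<in> P"
      using \<mu>[OF z rng_unit[OF h] zh(3)] zh rng_unit[OF h] by (auto simp: u_def P_def)
    have k: "k \<in> topspace (arrows G)" "src G k = src G h" using zh(4) u h by (simp_all add: u_def[symmetric] comp_closed src_comp)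
    have ku: "gcomp G k (ginv G h) = u" using cancel_right[OF u(1) h u(2)] zh(4) by (simp add: u_def)
    have hi: "ginv G h \<in> topspace (arrows G)" "src G k = rng G (ginv G h)"
      using h k by (simp_all add: ginv_closed rng_ginv)
    have "(case (k, ginv G h) of (g, h) \<Rightarrow> gcomp G g h) \<in> P" using ku u(3) by simp
    then obtain K N where KN: "openin (arrows G) K" "openin (arrows G) N" "k \<in> K" "ginv G h \<in> N"
      "\<And>k' h'. \<lbrakk>k' \<in> K; h' \<in> N; src G k' = rng G h'\<rbrakk> \<Longrightarrow> (case (k', h') of (g, h) \<Rightarrow> gcomp G g h) \<in> P"
      using continuous_map_fibre_productD[OF continuous_comp k(1) hi(1) hi(2) P] by metis
    define N' where "N' = W \<inter> {h' \<in> topspace (arrows G). ginv G h' \<in> N}"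
    have "openin (arrows G) {h' \<in> topspace (arrows G). ginv G h' \<in> N}"
      using continuous_ginv KN(2) unfolding continuous_map_def by blast
    then have N': "openin (arrows G) N'" "h \<in> N'" using VW(2) zh(2) h KN(4) by (auto simp: N'_def)
    define T where "T = K \<inter> {k' \<in> topspace (arrows G). src G k' \<in> src G ` N'}"
    have "openin (objects G) (src G ` N')" using open_src N'(1) unfolding open_map_def by blast
    then have "openin (arrows G) {k' \<in> topspace (arrows G). src G k' \<in> src G ` N'}"
      using continuous_src unfolding continuous_map_def by blast
    then have "openin (arrows G) T" "k \<in> T" using KN k N'(2) by (auto simp: T_def)
    moreover have "T \<subseteq> ?S"
    proof
      fix k' assume "k' \<in> T"
      then obtain h' where h': "k' \<in> K" "k' \<in> topspace (arrows G)" "h' \<in> N'" "src G k' = src G h'"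
        by (auto simp: T_def)
      have h'': "h' \<in> W" "h' \<in> topspace (arrows G)" "ginv G h' \<in> N" using h'(3) by (auto simp: N'_def)
      have "gcomp G k' (ginv G h') \<in> P" using KN(5)[of k' "ginv G h'"] h' h'' by (simp add: rng_ginv)
      then obtain z' \<omega> where z': "z' \<in> V" "\<omega> \<in> units G" "p z' = \<rho> \<omega>" "gcomp G k' (ginv G h') = \<mu> (z', \<omega>)"
        by (auto simp: P_def)
      have "z' \<in> topspace Z" using z'(1) openin_subset[OF VW(1)] by blast
      \<comment> \<open>In \<open>P\<close> the unit \<omega> is arbitrary. The source condition on
        \<mu> now forces it to be the range of \<open>h'\<close>.\<close>
      then have "\<omega> = src G (gcomp G k' (ginv G h'))" using \<mu> z' by simp
      also have "\<dots> = rng G h'" using h' h'' by (simp add: src_comp src_ginv rng_ginv ginv_closed)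
      finally have "\<omega> = rng G h'" .
      moreover have "k' = gcomp G (gcomp G k' (ginv G h')) h'"
        using cancel_right'[of k' h'] h' h'' by simp
      ultimately show "k' \<in> ?S" using z' h''(1) by (auto simp: actor_mult_def)
    qed
    ultimately show "\<exists>T. openin (arrows G) T \<and> k \<in> T \<and> T \<subseteq> ?S" by blast
  qed
qed

locale actor_setting = actor_space G X H R + D: actor_data G X H \<rho> \<mu>G \<mu>X
  for G :: "'g tgroupoid" and X :: "('g, 'x) correspondence" and H :: "'h tgroupoid" and R :: "'g set"
    and \<rho> :: "'h \<Rightarrow> 'g" and \<mu>G :: "'g \<times> 'h \<Rightarrow> 'h" and \<mu>X :: "'x \<times> 'h \<Rightarrow> 'h"
begin

abbreviation "anc \<equiv> \<rho> \<circ> rng H"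
abbreviation "mG \<equiv> \<lambda>(g, h). actor_mult H \<mu>G g h"
abbreviation "mX \<equiv> \<lambda>(x, h). actor_mult H \<mu>X x h"

lemma rho_unit: "\<omega> \<in> units H \<Longrightarrow> \<rho> \<omega> \<in> units G"
  using D.continuous_rho by (auto simp: continuous_map_def)

lemma muG_in: "\<lbrakk>g \<in> GA; \<omega> \<in> units H; src G g = \<rho> \<omega>\<rbrakk> \<Longrightarrow> \<mu>G (g, \<omega>) \<in> HA"
  using D.continuous_muG by (auto simp: continuous_map_def topspace_fibre_product)

lemma muX_in: "\<lbrakk>x \<in> XS; \<omega> \<in> units H; ranchor X x = \<rho> \<omega>\<rbrakk> \<Longrightarrow> \<mu>X (x, \<omega>) \<in> HA"
  using D.continuous_muX by (auto simp: continuous_map_def topspace_corr_domain)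

lemma multG:
  assumes "g \<in> GA" "h \<in> HA" "src G g = \<rho> (rng H h)"
  shows "actor_mult H \<mu>G g h \<in> HA" "src H (actor_mult H \<mu>G g h) = src H h"
    "\<rho> (rng H (actor_mult H \<mu>G g h)) = rng G g"
  using assms muG_in[of g "rng H h"] D.src_muG[of g "rng H h"] D.rng_muG[of g "rng H h"] H.rng_unit[of h]
  by (simp_all add: actor_mult_def H.comp_closed H.src_comp H.rng_comp)

lemma multX:
  assumes "x \<in> XS" "h \<in> HA" "ranchor X x = \<rho> (rng H h)"
  shows "actor_mult H \<mu>X x h \<in> HA" "src H (actor_mult H \<mu>X x h) = src H h"
    "\<rho> (rng H (actor_mult H \<mu>X x h)) = lanchor X x"
    "rng H (actor_mult H \<mu>X x h) = rng H (\<mu>X (x, rng H h))"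
  using assms muX_in[of x "rng H h"] D.src_muX[of x "rng H h"] D.rng_muX[of x "rng H h"] H.rng_unit[of h]
  by (simp_all add: actor_mult_def H.comp_closed H.src_comp H.rng_comp)

lemma multG_comp:
  assumes "g \<in> GA" "h \<in> HA" "k \<in> HA" "src G g = \<rho> (rng H h)" "src H h = rng H k"
  shows "actor_mult H \<mu>G g (gcomp H h k) = gcomp H (actor_mult H \<mu>G g h) k"
  using assms muG_in[of g "rng H h"] D.src_muG[of g "rng H h"] H.rng_unit[of h]
  by (simp add: actor_mult_def H.rng_comp H.comp_assoc)

lemma multX_comp:
  assumes "x \<in> XS" "h \<in> HA" "k \<in> HA" "ranchor X x = \<rho> (rng H h)" "src H h = rng H k"
  shows "actor_mult H \<mu>X x (gcomp H h k) = gcomp H (actor_mult H \<mu>X x h) k"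
  using assms muX_in[of x "rng H h"] D.src_muX[of x "rng H h"] H.rng_unit[of h]
  by (simp add: actor_mult_def H.rng_comp H.comp_assoc)

text \<open>An element of \<open>x \<cdot> H\<close> is recognised by its range, since \<open>x \<cdot> H\<close> is a right \<open>H\<close>-invariant set.\<close>

lemma mult_rng:
  assumes "x \<in> XS" "h \<in> HA" "ranchor X x = \<rho> (rng H h)" "k \<in> HA" "rng H k = rng H (actor_mult H \<mu>X x h)"
  obtains h' where "h' \<in> HA" "rng H h' = rng H h" "k = actor_mult H \<mu>X x h'"
proof -
  define y where "y = actor_mult H \<mu>X x h"
  note y = multX(1,2)[OF assms(1-3), folded y_def]
  have c: "gcomp H (ginv H y) k \<in> HA" "rng H (gcomp H (ginv H y) k) = src H y"
    using y assms(4,5) by (simp_all add: y_def[symmetric] H.comp_closed H.ginv_closed H.src_ginv H.rng_comp H.rng_ginv)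
  have "k = gcomp H y (gcomp H (ginv H y) k)"
    using H.cancel_left'[of y k] y assms(4,5) by (simp add: y_def[symmetric])
  also have "\<dots> = actor_mult H \<mu>X x (gcomp H h (gcomp H (ginv H y) k))"
    unfolding y_def using multX_comp[OF assms(1,2) c(1)[unfolded y_def] assms(3)] c(2) y(2) by (simp add: y_def)
  finally have "k = actor_mult H \<mu>X x (gcomp H h (gcomp H (ginv H y) k))" .
  moreover have "gcomp H h (gcomp H (ginv H y) k) \<in> HA" "rng H (gcomp H h (gcomp H (ginv H y) k)) = rng H h"
    using c y(2) assms(2) by (simp_all add: H.comp_closed H.rng_comp)
  ultimately show thesis using that by blast
qed

lemma conditions_imp_set_action:
  assumes assoc: "actor_associative G X H \<rho> \<mu>G \<mu>X" and unital: "actor_unital H \<rho> \<mu>G"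
    and cancel: "actor_cancellative G X H \<rho> \<mu>G \<mu>X" and cov: "actor_covering X R H \<rho> \<mu>X"
  shows "set_action G X R HA anc mG mX"
proof unfold_locales
  fix h assume h: "h \<in> HA"
  have r: "rng H h \<in> units H" using H.rng_unit[OF h] .
  show "anc h \<in> units G" using rho_unit[OF r] by simp
  \<comment> \<open>Unitality is assumed on units only; it spreads to all \<open>h\<close> because
    the multiplication commutes with right translation.\<close>
  have "actor_mult H \<mu>G (\<rho> (rng H h)) (rng H h) = rng H h" using unital r by (simp add: actor_unital_def)
  then have "actor_mult H \<mu>G (\<rho> (rng H h)) (gcomp H (rng H h) h) = gcomp H (rng H h) h"
    using multG_comp[of "\<rho> (rng H h)" "rng H h" h] r h rho_unit[OF r] by (simp add: H.rng_of_unit)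
  then show "mG (anc h, h) = h" using h by (simp add: H.left_unit)
  {
    assume "anc h \<in> R"
    then have "rng H h \<in> (rng H \<circ> \<mu>X) ` topspace (corr_domain X \<rho> (objects H))"
      using cov r by (auto simp: actor_covering_def)
    then obtain x \<omega> where x: "x \<in> XS" "\<omega> \<in> units H" "ranchor X x = \<rho> \<omega>" "rng H h = rng H (\<mu>X (x, \<omega>))"
      by (auto simp: topspace_corr_domain)
    have x': "\<omega> \<in> HA" "ranchor X x = \<rho> (rng H \<omega>)" using x by (simp_all add: H.rng_of_unit)
    \<comment> \<open>Covering speaks only of ranges; \<open>mult_rng\<close> turns equality of
      ranges into a factorisation of \<open>h\<close>.\<close>
    have "rng H h = rng H (actor_mult H \<mu>X x \<omega>)" using multX(4)[OF x(1) x'] x by (simp add: H.rng_of_unit)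
    then obtain h' where "h' \<in> HA" "rng H h' = rng H \<omega>" "h = actor_mult H \<mu>X x h'"
      using mult_rng[OF x(1) x' h] by metis
    then show "\<exists>x\<in>XS. \<exists>h'\<in>HA. ranchor X x = anc h' \<and> h = mX (x, h')"
      using x(1) x'(2) by (intro bexI[of _ x] bexI[of _ h']) simp_all
  }
next
  fix x y x' y' assume xy: "x \<in> XS" "y \<in> HA" "ranchor X x = anc y" "x' \<in> XS" "y' \<in> HA" "ranchor X x' = anc y'"
  show "mX (x, y) = mX (x', y') \<longleftrightarrow>
    (\<exists>g \<in> GA. rng G g = ranchor X x \<and> src G g = anc y' \<and> x' = ract X (x, g) \<and> y = mG (g, y'))"
    using xy cancel assoc unfolding actor_cancellative_def actor_associative_def by auto
next
  fix g h y assume "g \<in> GA" "h \<in> GA" "y \<in> HA" "src G g = rng G h" "src G h = anc y"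
  then show "mG (g, mG (h, y)) = mG (gcomp G g h, y)"
    using assoc unfolding actor_associative_def by simp
next
  fix g x y assume "g \<in> GA" "x \<in> XS" "y \<in> HA" "src G g = lanchor X x" "ranchor X x = anc y"
  then show "mG (g, mX (x, y)) = mX (lact X (g, x), y)"
    using assoc unfolding actor_associative_def by simp
qed (simp_all add: multG multX(1-3))

lemma conditions_imp_corr_action:
  assumes conds: "actor_associative G X H \<rho> \<mu>G \<mu>X" "actor_unital H \<rho> \<mu>G"
    "actor_cancellative G X H \<rho> \<mu>G \<mu>X" "actor_covering X R H \<rho> \<mu>X"
    and cl: "actor_closed G X H \<rho> \<mu>X"
  shows "corr_action G X R (arrows H) anc mG mX"
proof -
  interpret S: set_action G X R HA anc mG mX using conds by (rule conditions_imp_set_action)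
  show ?thesis
  proof (rule S.corr_actionI)
    show "continuous_map (arrows H) (objects G) anc"
      using H.continuous_rng D.continuous_rho by (rule continuous_map_compose)
    show "continuous_map (fibre_product (arrows G) (src G) anc (arrows H)) (arrows H) mG"
      using D.continuous_muG D.src_muG by (rule H.actor_mult_continuous)
    show "continuous_map (corr_domain X anc (arrows H)) (arrows H) mX"
      unfolding corr_domain_def using D.continuous_muX[unfolded corr_domain_def] D.src_muX
      by (rule H.actor_mult_continuous)
  next
    have "open_map (fibre_product (cspace X) (ranchor X) anc (arrows H)) (arrows H) mX"
      using D.open_muX[unfolded corr_domain_def] by (rule H.actor_mult_open) (use muX_in D.src_muX in simp)
    then show "openin (arrows H) (S.mul V W)" if "openin (cspace X) V" "openin (arrows H) W" for V W
      unfolding S.mul_def open_map_fibre_product_iff using that by (elim allE impE)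
  next
    fix L assume L: "compactin (cspace X) L"
    \<comment> \<open>The set of products is right invariant, so it is the full preimage of its set
      of ranges \<open>C\<close>, and closedness in \<open>H\<close> follows from closedness in the
      object space.\<close>
    define C where "C = {rng H (actor_mult H \<mu>X x h) |x h. x \<in> XS \<and> h \<in> HA \<and>
      orbit_of G X x \<in> orbit_of G X ` L \<and> ranchor X x = \<rho> (rng H h)}"
    have "closedin (objects H) C"
      using cl image_compactin[OF L continuous_orbit_of] unfolding actor_closed_def C_def by blast
    then have "closedin (arrows H) {k \<in> HA. rng H k \<in> C}"
      using H.continuous_rng closedin_continuous_map_preimage by blast
    moreover have "{k \<in> HA. rng H k \<in> C} = S.mul L HA"
      unfolding S.mul_orbits[OF compactin_subset_topspace[OF L] refl, symmetric]
    proof (intro subset_antisym subsetI)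
      fix k assume "k \<in> {k \<in> HA. rng H k \<in> C}"
      then obtain x h where xh: "k \<in> HA" "x \<in> XS" "h \<in> HA" "orbit_of G X x \<in> orbit_of G X ` L"
        "ranchor X x = \<rho> (rng H h)" "rng H k = rng H (actor_mult H \<mu>X x h)" by (auto simp: C_def)
      obtain h' where "h' \<in> HA" "rng H h' = rng H h" "k = actor_mult H \<mu>X x h'"
        using mult_rng[OF xh(2,3,5,1,6)] .
      then show "k \<in> {mX (x, y) |x y. x \<in> XS \<and> y \<in> HA \<and> ranchor X x = anc y \<and> orbit_of G X x \<in> orbit_of G X ` L}"
        using xh by (intro CollectI exI[of _ x] exI[of _ h']) auto
    next
      fix k assume "k \<in> {mX (x, y) |x y. x \<in> XS \<and> y \<in> HA \<and> ranchor X x = anc y \<and> orbit_of G X x \<in> orbit_of G X ` L}"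
      then show "k \<in> {k \<in> HA. rng H k \<in> C}" using multX(1) by (auto simp: C_def)
    qed
    ultimately show "closedin (arrows H) (S.mul L HA)" by simp
  qed simp
qed

lemma corr_action_imp_conditions:
  assumes act: "corr_action G X R (arrows H) anc mG mX"
  shows "actor_associative G X H \<rho> \<mu>G \<mu>X" "actor_unital H \<rho> \<mu>G"
    "actor_cancellative G X H \<rho> \<mu>G \<mu>X" "actor_covering X R H \<rho> \<mu>X" "actor_closed G X H \<rho> \<mu>X"
proof -
  interpret S: set_action G X R HA anc mG mX using act by (rule set_action_of_corr_action)
  show "actor_associative G X H \<rho> \<mu>G \<mu>X"
    unfolding actor_associative_def
    \<comment> \<open>The third associativity law comes from \<open>mult_ract\<close>, that is, from
      the equality criterion for products.\<close>
    using S.act_act S.act_mult S.mult_ract by simp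
  show "actor_unital H \<rho> \<mu>G"
    unfolding actor_unital_def
  proof
    fix \<omega> assume "\<omega> \<in> units H"
    then show "actor_mult H \<mu>G (\<rho> \<omega>) \<omega> = \<omega>" using S.unit_act[of \<omega>] by (simp add: H.rng_of_unit)
  qed
  show "actor_cancellative G X H \<rho> \<mu>G \<mu>X"
    unfolding actor_cancellative_def
  proof (intro ballI impI, elim conjE)
    fix x\<^sub>1 x\<^sub>2 y\<^sub>1 y\<^sub>2
    assume "x\<^sub>1 \<in> XS" "x\<^sub>2 \<in> XS" "y\<^sub>1 \<in> HA" "y\<^sub>2 \<in> HA" "ranchor X x\<^sub>1 = \<rho> (rng H y\<^sub>1)"
      "ranchor X x\<^sub>2 = \<rho> (rng H y\<^sub>2)" "actor_mult H \<mu>X x\<^sub>1 y\<^sub>1 = actor_mult H \<mu>X x\<^sub>2 y\<^sub>2"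
    then show "\<exists>g\<in>GA. rng G g = ranchor X x\<^sub>1 \<and> src G g = \<rho> (rng H y\<^sub>2) \<and>
        x\<^sub>2 = ract X (x\<^sub>1, g) \<and> y\<^sub>1 = actor_mult H \<mu>G g y\<^sub>2"
      using S.mult_eq_iff[of x\<^sub>1 y\<^sub>1 x\<^sub>2 y\<^sub>2] by simp
  qed
  show "actor_covering X R H \<rho> \<mu>X"
    unfolding actor_covering_def
  proof clarify
    fix \<omega> assume \<omega>: "\<omega> \<in> units H" "\<rho> \<omega> \<in> R"
    then obtain x h where x: "x \<in> XS" "h \<in> HA" "ranchor X x = \<rho> (rng H h)" "\<omega> = actor_mult H \<mu>X x h"
      using S.covers[of \<omega>] by (auto simp: H.rng_of_unit)
    have "\<omega> = rng H (\<mu>X (x, rng H h))" using \<omega>(1) multX(4)[OF x(1-3)] x(4) by (simp add: H.rng_of_unit)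
    then show "\<omega> \<in> (rng H \<circ> \<mu>X) ` topspace (corr_domain X \<rho> (objects H))"
      using x H.rng_unit[OF x(2)] by (intro image_eqI[of _ _ "(x, rng H h)"]) (auto simp: topspace_corr_domain)
  qed
  show "actor_closed G X H \<rho> \<mu>X"
    unfolding actor_closed_def
  proof (intro allI impI)
    fix K assume K: "compactin (orbit_space G X) K"
    define A where "A = {mX (x, y) |x y. (x, y) \<in> topspace (corr_domain X anc (arrows H)) \<and> orbit_of G X x \<in> K}"
    have "closedin (arrows H) A" unfolding A_def using act K by (rule corr_action.closed)
    then have "closedin (objects H) (A \<inter> units H)" unfolding objects_def closedin_subtopology by blast
    \<comment> \<open>By right invariance, the ranges of the products are exactly those units that
      are themselves products.\<close>
    moreover have "{rng H (actor_mult H \<mu>X x h) |x h. x \<in> XS \<and> h \<in> HA \<and> orbit_of G X x \<in> K \<and>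
        ranchor X x = \<rho> (rng H h)} = A \<inter> units H"
    proof (intro subset_antisym subsetI)
      fix \<omega> assume "\<omega> \<in> {rng H (actor_mult H \<mu>X x h) |x h. x \<in> XS \<and> h \<in> HA \<and> orbit_of G X x \<in> K \<and>
        ranchor X x = \<rho> (rng H h)}"
      then obtain x h where xh: "x \<in> XS" "h \<in> HA" "orbit_of G X x \<in> K" "ranchor X x = \<rho> (rng H h)"
        "\<omega> = rng H (actor_mult H \<mu>X x h)" by blast
      have \<omega>: "\<omega> \<in> units H" using multX(1)[OF xh(1,2,4)] H.rng_unit xh(5) by blast
      have "rng H \<omega> = rng H (actor_mult H \<mu>X x h)" using \<omega> xh(5) by (simp add: H.rng_of_unit)
      then obtain h' where "h' \<in> HA" "rng H h' = rng H h" "\<omega> = actor_mult H \<mu>X x h'"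
        using mult_rng[OF xh(1,2,4) H.units_arrow[OF \<omega>]] by metis
      then show "\<omega> \<in> A \<inter> units H" using \<omega> xh by (force simp: A_def topspace_corr_domain)
    next
      fix \<omega> assume "\<omega> \<in> A \<inter> units H"
      then obtain x h where xh: "x \<in> XS" "h \<in> HA" "orbit_of G X x \<in> K" "ranchor X x = \<rho> (rng H h)"
        "\<omega> = actor_mult H \<mu>X x h" "\<omega> \<in> units H" by (auto simp: A_def topspace_corr_domain)
      then have "\<omega> = rng H (actor_mult H \<mu>X x h)" by (simp add: H.rng_of_unit)
      then show "\<omega> \<in> {rng H (actor_mult H \<mu>X x h) |x h. x \<in> XS \<and> h \<in> HA \<and> orbit_of G X x \<in> K \<and>
        ranchor X x = \<rho> (rng H h)}" using xh by blast
    qed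
    ultimately show "closedin (objects H) {rng H (actor_mult H \<mu>X x h) |x h. x \<in> XS \<and> h \<in> HA \<and>
        orbit_of G X x \<in> K \<and> ranchor X x = \<rho> (rng H h)}" by simp
  qed
qed

lemma induced_action_iff:
  "induced_action G X H \<rho> \<mu>G \<mu>X \<in> corr_actions G X R (arrows H) \<longleftrightarrow>
   corr_action G X R (arrows H) anc mG mX"
proof
  assume "induced_action G X H \<rho> \<mu>G \<mu>X \<in> corr_actions G X R (arrows H)"
  then have "corr_action G X R (arrows H) (restrict anc HA)
      (restrict mG (topspace (fibre_product (arrows G) (src G) anc (arrows H))))
      (restrict mX (topspace (corr_domain X anc (arrows H))))"
    by (simp add: induced_action_def corr_actions_def)
  then show "corr_action G X R (arrows H) anc mG mX"
    by (rule corr_action_cong) (auto simp: topspace_fibre_product topspace_corr_domain)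
next
  assume "corr_action G X R (arrows H) anc mG mX"
  then show "induced_action G X H \<rho> \<mu>G \<mu>X \<in> corr_actions G X R (arrows H)"
    unfolding induced_action_def by (rule corr_action_restrict)
qed

lemma induced_restrict_translation_equivariant:
  "translation_equivariant G X H (restrict anc HA)
     (restrict mG (topspace (fibre_product (arrows G) (src G) anc (arrows H))))
     (restrict mX (topspace (corr_domain X anc (arrows H))))"
  by (rule translation_equivariantI)
    (simp_all add: topspace_fibre_product topspace_corr_domain multG multX multG_comp multX_comp
      H.rng_comp H.comp_closed)

text \<open>Associativity in \<open>H\<close> makes the induced maps commute with right translations
  whatever the data are. So the data define an actor as soon as the induced maps form an
  action.\<close>

theorem defines_actor_iff:
  fixes \<Phi> :: "('g, 'x, 'm, 'h) act_bij"
  assumes "etale_groupoid M" "action_bijections G X R M \<Phi>" "natural_bijections G X R M \<Phi> \<Phi>"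
  shows "defines_actor G X R M \<Phi> H \<rho> \<mu>G \<mu>X \<longleftrightarrow>
    actor_associative G X H \<rho> \<mu>G \<mu>X \<and> actor_unital H \<rho> \<mu>G \<and> actor_cancellative G X H \<rho> \<mu>G \<mu>X \<and>
    actor_covering X R H \<rho> \<mu>X \<and> actor_closed G X H \<rho> \<mu>X"
proof -
  have "defines_actor G X R M \<Phi> H \<rho> \<mu>G \<mu>X \<longleftrightarrow> corr_action G X R (arrows H) anc mG mX"
    unfolding defines_actor_def
    using induced_action_iff actor_iff_translation_equivariant[OF assms]
      induced_restrict_translation_equivariant
    by (auto simp: induced_action_def)
  then show ?thesis using conditions_imp_corr_action corr_action_imp_conditions by blast
qed

theorem proper_imp_closed:
  assumes assoc: "actor_associative G X H \<rho> \<mu>G \<mu>X" and pr: "proper_map (objects H) (objects G) \<rho>"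
  shows "actor_closed G X H \<rho> \<mu>X"
  unfolding actor_closed_def
proof (intro allI impI)
  fix K assume "compactin (orbit_space G X) K"
  then obtain L where L: "compactin (cspace X) L" "orbit_of G X ` L = K" by (rule compact_orbits_lift)
  have LX: "L \<subseteq> XS" using L(1) by (rule compactin_subset_topspace)
  define B where "B = {\<omega> \<in> units H. \<rho> \<omega> \<in> ranchor X ` L}"
  have "compactin (objects G) (ranchor X ` L)" using L(1) Rt.continuous_anchor by (rule image_compactin)
  then have B: "compactin (objects H) B" using pr by (simp add: B_def proper_map_alt)
  define P where "P = {(x, \<omega>). x \<in> L \<and> \<omega> \<in> B \<and> ranchor X x = \<rho> \<omega>}"
  have "compactin (corr_domain X \<rho> (objects H)) P"
    unfolding corr_domain_def P_def
    using Hausdorff_objects Rt.continuous_anchor D.continuous_rho L(1) B by (rule compactin_fibre_product)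
  from image_compactin[OF this continuous_map_compose[OF D.continuous_muX H.continuous_rng]]
  have "closedin (objects H) ((rng H \<circ> \<mu>X) ` P)"
    using H.Hausdorff_objects compactin_imp_closedin by blast
  moreover have "(rng H \<circ> \<mu>X) ` P = {rng H (actor_mult H \<mu>X x h) |x h. x \<in> XS \<and> h \<in> HA \<and>
      orbit_of G X x \<in> K \<and> ranchor X x = \<rho> (rng H h)}"
  proof (intro subset_antisym subsetI)
    fix \<nu> assume "\<nu> \<in> (rng H \<circ> \<mu>X) ` P"
    then obtain x \<omega> where x: "x \<in> L" "\<omega> \<in> units H" "ranchor X x = \<rho> \<omega>" "\<nu> = rng H (\<mu>X (x, \<omega>))"
      by (auto simp: P_def B_def)
    then have "\<nu> = rng H (actor_mult H \<mu>X x \<omega>)" using multX(4)[of x \<omega>] LX by (auto simp: H.rng_of_unit)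
    moreover have "x \<in> XS" "orbit_of G X x \<in> K" "\<omega> \<in> HA" "ranchor X x = \<rho> (rng H \<omega>)"
      using x LX L(2) by (auto simp: H.rng_of_unit)
    ultimately show "\<nu> \<in> {rng H (actor_mult H \<mu>X x h) |x h. x \<in> XS \<and> h \<in> HA \<and>
      orbit_of G X x \<in> K \<and> ranchor X x = \<rho> (rng H h)}" by blast
  next
    fix \<nu> assume "\<nu> \<in> {rng H (actor_mult H \<mu>X x h) |x h. x \<in> XS \<and> h \<in> HA \<and>
      orbit_of G X x \<in> K \<and> ranchor X x = \<rho> (rng H h)}"
    then obtain x h where x: "x \<in> XS" "h \<in> HA" "orbit_of G X x \<in> K" "ranchor X x = \<rho> (rng H h)"
      "\<nu> = rng H (actor_mult H \<mu>X x h)" by blast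
    obtain l where l: "l \<in> L" "orbit_of G X l = orbit_of G X x" using x(3) L(2) by auto
    then obtain g where g: "g \<in> GA" "ranchor X l = rng G g" "x = ract X (l, g)"
      using orbit_of_eq_iff[of l x] LX x(1) by auto
    have sg: "src G g = \<rho> (rng H h)" using x(4) g Rt.anchor_act[of l g] l(1) LX by auto
    \<comment> \<open>Here \<open>x\<close> is \<open>l\<close> moved by \<open>g\<close>;
      associativity shifts \<open>g\<close> to the second factor, so the range is already attained
      with first letter \<open>l\<close>.\<close>
    define \<omega> where "\<omega> = rng H (actor_mult H \<mu>G g h)"
    note gh = multG[OF g(1) x(2) sg]
    have "actor_mult H \<mu>X x h = actor_mult H \<mu>X l (actor_mult H \<mu>G g h)"
      using assoc l(1) LX g x(2) sg unfolding actor_associative_def by auto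
    then have "\<nu> = rng H (\<mu>X (l, \<omega>))"
      using x(5) multX(4)[of l "actor_mult H \<mu>G g h"] l(1) LX g(2) gh by (auto simp: \<omega>_def)
    moreover have "(l, \<omega>) \<in> P"
      using l(1) gh g(2) H.rng_unit[OF gh(1)] by (auto simp: P_def B_def \<omega>_def intro!: image_eqI[of _ _ l])
    ultimately show "\<nu> \<in> (rng H \<circ> \<mu>X) ` P" by (intro image_eqI[of _ _ "(l, \<omega>)"]) simp_all
  qed
  ultimately show "closedin (objects H) {rng H (actor_mult H \<mu>X x h) |x h. x \<in> XS \<and> h \<in> HA \<and>
      orbit_of G X x \<in> K \<and> ranchor X x = \<rho> (rng H h)}" by simp
qed

end

lemma proper_map_cong:
  assumes "\<And>x. x \<in> topspace A \<Longrightarrow> f x = g x"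
  shows "proper_map A B f \<longleftrightarrow> proper_map A B g"
proof -
  have "f ` U = g ` U" if "closedin A U" for U
    using assms closedin_subset[OF that] by (intro image_cong) auto
  moreover have "{x \<in> topspace A. f x = y} = {x \<in> topspace A. g x = y}" for y using assms by auto
  ultimately show ?thesis by (simp add: proper_map_def closed_map_def)
qed

section \<open>Recovering the triple of maps from an actor\<close>

context actor_space
begin

text \<open>Every \<open>h\<close> is its range unit times \<open>h\<close>, so a translation
  equivariant action is determined by its values on units.\<close>

lemma actor_data_of_action:
  assumes act: "(a, m, n) \<in> corr_actions G X R (arrows H)" and eq: "translation_equivariant G X H a m n"
  defines "\<rho> \<equiv> restrict a (units H)"
  defines "\<mu>G \<equiv> restrict m (topspace (fibre_product (arrows G) (src G) \<rho> (objects H)))"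
  defines "\<mu>X \<equiv> restrict n (topspace (corr_domain X \<rho> (objects H)))"
  shows "actor_data G X H \<rho> \<mu>G \<mu>X" and "induced_action G X H \<rho> \<mu>G \<mu>X = (a, m, n)"
proof -
  have cact: "corr_action G X R (arrows H) a m n" using act by (simp add: corr_actions_def)
  interpret A: corr_action G X R "arrows H" a m n by (rule cact)
  interpret S: set_action G X R HA a m n using cact by (rule set_action_of_corr_action)
  note D = translation_equivariantD[OF eq]
  have aunit: "a (rng H h) = a h" if h: "h \<in> HA" for h
    using D(1)[of "rng H h" h] H.rng_unit[OF h] h by (simp add: H.left_unit)
  have fpG: "fibre_product (arrows G) (src G) \<rho> (objects H) =
      subtopology (fibre_product (arrows G) (src G) a (arrows H)) (GA \<times> units H)"
    unfolding fibre_product_subtopology[symmetric] objects_def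
    by (rule fibre_product_cong) (simp add: \<rho>_def)
  have fpX: "fibre_product (cspace X) (ranchor X) \<rho> (objects H) =
      subtopology (fibre_product (cspace X) (ranchor X) a (arrows H)) (XS \<times> units H)"
    unfolding fibre_product_subtopology[symmetric] objects_def
    by (rule fibre_product_cong) (simp add: \<rho>_def)
  show data: "actor_data G X H \<rho> \<mu>G \<mu>X"
  proof (rule actor_data.intro)
    have "continuous_map (objects H) (objects G) a"
      using left_action.continuous_anchor[OF A.groupoid_act] by (rule H.continuous_map_from_objects)
    then show "continuous_map (objects H) (objects G) \<rho>"
      by (rule continuous_map_eq) (simp add: \<rho>_def)
    have "continuous_map (fibre_product (arrows G) (src G) \<rho> (objects H)) (arrows H) m"
      unfolding fpG using left_action.continuous_act[OF A.groupoid_act] by (rule continuous_map_from_subtopology)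
    then show "continuous_map (fibre_product (arrows G) (src G) \<rho> (objects H)) (arrows H) \<mu>G"
      by (rule continuous_map_eq) (simp add: \<mu>G_def)
    have "continuous_map (corr_domain X \<rho> (objects H)) (arrows H) n"
      unfolding corr_domain_def fpX using A.continuous_mult[unfolded corr_domain_def]
      by (rule continuous_map_from_subtopology)
    then show "continuous_map (corr_domain X \<rho> (objects H)) (arrows H) \<mu>X"
      by (rule continuous_map_eq) (simp add: \<mu>X_def)
    show "open_map (corr_domain X \<rho> (objects H)) (arrows H) \<mu>X"
      unfolding corr_domain_def open_map_fibre_product_iff
    proof (intro allI impI)
      fix V W assume VW: "openin (cspace X) V" "openin (objects H) W"
      \<comment> \<open>Units are open in an etale groupoid, so openness of the multiplication on
        all of \<open>H\<close> restricts to units.\<close>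
      then have "openin (arrows H) W" "W \<subseteq> units H" by (simp_all add: H.openin_objects_iff)
      moreover from this have "{\<mu>X (x, h) |x h. x \<in> V \<and> h \<in> W \<and> ranchor X x = \<rho> h} = S.mul V W"
        using openin_subset[OF VW(1)] unfolding S.mul_def \<mu>X_def
        by (intro Collect_cong ex_cong1) (auto simp: topspace_corr_domain \<rho>_def subset_iff)
      ultimately show "openin (arrows H) {\<mu>X (x, h) |x h. x \<in> V \<and> h \<in> W \<and> ranchor X x = \<rho> h}"
        using corr_action_open_closed(1)[OF cact VW(1)] by simp
    qed
  next
    fix g \<omega> assume g: "g \<in> GA" "\<omega> \<in> units H" "src G g = \<rho> \<omega>"
    then have g': "src G g = a \<omega>" "\<mu>G (g, \<omega>) = m (g, \<omega>)" "\<omega> \<in> HA"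
      by (simp_all add: \<rho>_def \<mu>G_def topspace_fibre_product)
    show "src H (\<mu>G (g, \<omega>)) = \<omega>" using D(2)[of g \<omega>] g g' by simp
    have "m (g, \<omega>) \<in> HA" using S.act_in g g' by simp
    then show "\<rho> (rng H (\<mu>G (g, \<omega>))) = rng G g"
      using aunit[of "m (g, \<omega>)"] S.anchor_act[of g \<omega>] g g' H.rng_unit by (simp add: \<rho>_def)
  next
    fix x \<omega> assume g: "x \<in> XS" "\<omega> \<in> units H" "ranchor X x = \<rho> \<omega>"
    then have g': "ranchor X x = a \<omega>" "\<mu>X (x, \<omega>) = n (x, \<omega>)" "\<omega> \<in> HA"
      by (simp_all add: \<rho>_def \<mu>X_def topspace_corr_domain)
    show "src H (\<mu>X (x, \<omega>)) = \<omega>" using D(4)[of x \<omega>] g g' by simp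
    have "n (x, \<omega>) \<in> HA" using S.mult_in g g' by simp
    then show "\<rho> (rng H (\<mu>X (x, \<omega>))) = lanchor X x"
      using aunit[of "n (x, \<omega>)"] S.anchor_mult[of x \<omega>] g g' H.rng_unit by (simp add: \<rho>_def)
  qed
  have anc: "(\<rho> \<circ> rng H) h = a h" if "h \<in> HA" for h
    using aunit[OF that] H.rng_unit[OF that] by (simp add: \<rho>_def)
  have ext: "a \<in> extensional HA" "m \<in> extensional (topspace (fibre_product (arrows G) (src G) a (arrows H)))"
    "n \<in> extensional (topspace (corr_domain X a (arrows H)))" using act by (auto simp: corr_actions_def)
  have fp: "fibre_product (arrows G) (src G) (\<rho> \<circ> rng H) (arrows H) = fibre_product (arrows G) (src G) a (arrows H)"
    using anc by (rule fibre_product_cong)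
  have cd: "corr_domain X (\<rho> \<circ> rng H) (arrows H) = corr_domain X a (arrows H)"
    unfolding corr_domain_def using anc by (rule fibre_product_cong)
  have "restrict (\<rho> \<circ> rng H) HA = a"
    using ext(1) anc by (intro extensionalityI[of _ HA]) auto
  moreover have "restrict (\<lambda>(g, h). actor_mult H \<mu>G g h) (topspace (fibre_product (arrows G) (src G) a (arrows H))) = m"
  proof (rule extensionalityI[OF restrict_extensional ext(2)])
    fix t assume t: "t \<in> topspace (fibre_product (arrows G) (src G) a (arrows H))"
    then obtain g h where gh: "t = (g, h)" "g \<in> GA" "h \<in> HA" "src G g = a h" by (auto simp: topspace_fibre_product)
    have "actor_mult H \<mu>G g h = gcomp H (m (g, rng H h)) h"
      using gh aunit[OF gh(3)] H.rng_unit[OF gh(3)]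
      by (simp add: actor_mult_def \<mu>G_def topspace_fibre_product \<rho>_def)
    also have "\<dots> = m (g, h)"
      using D(3)[of g "rng H h" h] gh aunit[OF gh(3)] H.rng_unit[OF gh(3)] by (simp add: H.left_unit)
    finally show "restrict (\<lambda>(g, h). actor_mult H \<mu>G g h)
        (topspace (fibre_product (arrows G) (src G) a (arrows H))) t = m t" using t gh(1) by simp
  qed
  moreover have "restrict (\<lambda>(x, h). actor_mult H \<mu>X x h) (topspace (corr_domain X a (arrows H))) = n"
  proof (rule extensionalityI[OF restrict_extensional ext(3)])
    fix t assume t: "t \<in> topspace (corr_domain X a (arrows H))"
    then obtain x h where xh: "t = (x, h)" "x \<in> XS" "h \<in> HA" "ranchor X x = a h" by (auto simp: topspace_corr_domain)
    have "actor_mult H \<mu>X x h = gcomp H (n (x, rng H h)) h"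
      using xh aunit[OF xh(3)] H.rng_unit[OF xh(3)]
      by (simp add: actor_mult_def \<mu>X_def topspace_corr_domain \<rho>_def)
    also have "\<dots> = n (x, h)"
      using D(5)[of x "rng H h" h] xh aunit[OF xh(3)] H.rng_unit[OF xh(3)] by (simp add: H.left_unit)
    finally show "restrict (\<lambda>(x, h). actor_mult H \<mu>X x h) (topspace (corr_domain X a (arrows H))) t = n t"
      using t xh(1) by simp
  qed
  ultimately show "induced_action G X H \<rho> \<mu>G \<mu>X = (a, m, n)"
    by (simp add: induced_action_def fp cd)
qed

lemma actor_data_determined:
  assumes data: "actor_data G X H \<rho> \<mu>G \<mu>X" and ind: "induced_action G X H \<rho> \<mu>G \<mu>X = (a, m, n)"
    and ext: "\<rho> \<in> extensional (units H)"
      "\<mu>G \<in> extensional (topspace (fibre_product (arrows G) (src G) \<rho> (objects H)))"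
      "\<mu>X \<in> extensional (topspace (corr_domain X \<rho> (objects H)))"
  shows "\<rho> = restrict a (units H)"
    "\<mu>G = restrict m (topspace (fibre_product (arrows G) (src G) \<rho> (objects H)))"
    "\<mu>X = restrict n (topspace (corr_domain X \<rho> (objects H)))"
proof -
  interpret actor_setting G X H R \<rho> \<mu>G \<mu>X
    by (rule actor_setting.intro[OF actor_space_axioms data])
  have a: "a = restrict (\<rho> \<circ> rng H) HA"
    and m: "m = restrict (\<lambda>(g, h). actor_mult H \<mu>G g h) (topspace (fibre_product (arrows G) (src G) (\<rho> \<circ> rng H) (arrows H)))"
    and n: "n = restrict (\<lambda>(x, h). actor_mult H \<mu>X x h) (topspace (corr_domain X (\<rho> \<circ> rng H) (arrows H)))"
    using ind by (auto simp: induced_action_def)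
  show "\<rho> = restrict a (units H)"
    by (rule extensionalityI[OF ext(1) restrict_extensional]) (simp add: a H.rng_of_unit)
  show "\<mu>G = restrict m (topspace (fibre_product (arrows G) (src G) \<rho> (objects H)))"
  proof (rule extensionalityI[OF ext(2) restrict_extensional])
    fix t assume t: "t \<in> topspace (fibre_product (arrows G) (src G) \<rho> (objects H))"
    then obtain g \<omega> where g: "t = (g, \<omega>)" "g \<in> GA" "\<omega> \<in> units H" "src G g = \<rho> \<omega>"
      by (auto simp: topspace_fibre_product)
    then have "m t = gcomp H (\<mu>G (g, \<omega>)) \<omega>" by (simp add: m topspace_fibre_product actor_mult_def H.rng_of_unit)
    also have "\<dots> = \<mu>G t" using H.right_unit[OF muG_in[OF g(2-4)]] D.src_muG[OF g(2-4)] g(1) by simp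
    finally show "\<mu>G t = restrict m (topspace (fibre_product (arrows G) (src G) \<rho> (objects H))) t" using t by simp
  qed
  show "\<mu>X = restrict n (topspace (corr_domain X \<rho> (objects H)))"
  proof (rule extensionalityI[OF ext(3) restrict_extensional])
    fix t assume t: "t \<in> topspace (corr_domain X \<rho> (objects H))"
    then obtain x \<omega> where x: "t = (x, \<omega>)" "x \<in> XS" "\<omega> \<in> units H" "ranchor X x = \<rho> \<omega>"
      by (auto simp: topspace_corr_domain)
    then have "n t = gcomp H (\<mu>X (x, \<omega>)) \<omega>" by (simp add: n topspace_corr_domain actor_mult_def H.rng_of_unit)
    also have "\<dots> = \<mu>X t" using H.right_unit[OF muX_in[OF x(2-4)]] D.src_muX[OF x(2-4)] x(1) by simp
    finally show "\<mu>X t = restrict n (topspace (corr_domain X \<rho> (objects H))) t" using t by simp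
  qed
qed

text \<open>The bijection provides one action of the correspondence with image \<beta>, and its
  values on units give the triple. Extensionality makes uniqueness an equality of functions.\<close>

theorem actor_unique_data:
  fixes \<Phi> :: "('g, 'x, 'm, 'h) act_bij"
  assumes M: "etale_groupoid M" and bij: "action_bijections G X R M \<Phi>" and nat: "natural_bijections G X R M \<Phi> \<Phi>"
    and \<beta>: "\<beta> \<in> actors M H"
  shows "\<exists>!(\<rho>, \<mu>G, \<mu>X).
        \<rho> \<in> extensional (units H) \<and>
        \<mu>G \<in> extensional (topspace (fibre_product (arrows G) (src G) \<rho> (objects H))) \<and>
        \<mu>X \<in> extensional (topspace (corr_domain X \<rho> (objects H))) \<and>
        actor_data G X H \<rho> \<mu>G \<mu>X \<and>
        defines_actor G X R M \<Phi> H \<rho> \<mu>G \<mu>X \<and>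
        \<Phi> (arrows H) (induced_action G X H \<rho> \<mu>G \<mu>X) = \<beta>"
proof -
  have \<Phi>: "bij_betw (\<Phi> (arrows H)) (corr_actions G X R (arrows H)) (groupoid_actions M (arrows H))"
    using bij by (simp add: action_bijections_def)
  have "\<beta> \<in> groupoid_actions M (arrows H)" using \<beta> by (auto simp: actors_def)
  then obtain \<alpha> where \<alpha>: "\<alpha> \<in> corr_actions G X R (arrows H)" "\<Phi> (arrows H) \<alpha> = \<beta>"
    using \<Phi> by (metis (no_types, lifting) bij_betw_def imageE)
  obtain a m n where amn: "\<alpha> = (a, m, n)" by (cases \<alpha>)
  have act: "(a, m, n) \<in> corr_actions G X R (arrows H)" using \<alpha> amn by simp
  have eq: "translation_equivariant G X H a m n"
    using actor_iff_translation_equivariant[OF M bij nat act] \<alpha>(2) \<beta> amn by simp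
  define \<rho> where "\<rho> = restrict a (units H)"
  define \<mu>G where "\<mu>G = restrict m (topspace (fibre_product (arrows G) (src G) \<rho> (objects H)))"
  define \<mu>X where "\<mu>X = restrict n (topspace (corr_domain X \<rho> (objects H)))"
  have data: "actor_data G X H \<rho> \<mu>G \<mu>X" and ind: "induced_action G X H \<rho> \<mu>G \<mu>X = (a, m, n)"
    unfolding \<rho>_def \<mu>G_def \<mu>X_def using actor_data_of_action[OF act eq] by simp_all
  show ?thesis
  proof (rule ex1I[of _ "(\<rho>, \<mu>G, \<mu>X)"], goal_cases)
    case 1
    show ?case using data ind act \<alpha>(2) amn \<beta> by (simp add: defines_actor_def \<rho>_def \<mu>G_def \<mu>X_def)
  next
    case (2 t)
    obtain \<rho>' \<mu>G' \<mu>X' where t: "t = (\<rho>', \<mu>G', \<mu>X')" by (cases t)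
    have ext: "\<rho>' \<in> extensional (units H)"
      "\<mu>G' \<in> extensional (topspace (fibre_product (arrows G) (src G) \<rho>' (objects H)))"
      "\<mu>X' \<in> extensional (topspace (corr_domain X \<rho>' (objects H)))"
      and data': "actor_data G X H \<rho>' \<mu>G' \<mu>X'" and def': "defines_actor G X R M \<Phi> H \<rho>' \<mu>G' \<mu>X'"
      and \<Phi>': "\<Phi> (arrows H) (induced_action G X H \<rho>' \<mu>G' \<mu>X') = \<beta>"
      using 2 t by auto
    have "induced_action G X H \<rho>' \<mu>G' \<mu>X' = (a, m, n)"
      using def' \<Phi>' \<alpha> amn \<Phi> by (auto simp: defines_actor_def bij_betw_def dest: inj_onD)
    from actor_data_determined[OF data' this ext]
    show ?case unfolding t \<rho>_def \<mu>G_def \<mu>X_def by simp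
  qed
qed

text \<open>The anchor map \<open>f\<close> of the actor composed with the proper map
  \<open>r\<close> is \<rho> on objects. Properness passes to the composite, and back to
  \<open>f\<close> because the object space of \<open>M\<close> is Hausdorff.\<close>

theorem proper_actor_iff:
  fixes \<Phi> :: "('g, 'x, 'm, 'h) act_bij" and \<Psi> :: "('g, 'x, 'm, 'z) act_bij"
    and e :: "'m \<Rightarrow> 'z" and e' :: "'g \<times> (nat \<Rightarrow> 'x option) \<Rightarrow> 'z"
  assumes R: "openin (objects G) R" "invariant_set G R" "regular_on G X R"
    and M: "groupoid_model G X R M \<Phi> \<Psi>" and e: "inj e" and e': "inj e'"
    and data: "actor_data G X H \<rho> \<mu>G \<mu>X" and def: "defines_actor G X R M \<Phi> H \<rho> \<mu>G \<mu>X"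
  shows "proper_actor M H (\<Phi> (arrows H) (induced_action G X H \<rho> \<mu>G \<mu>X)) \<longleftrightarrow>
    proper_map (objects H) (objects G) \<rho>"
proof -
  interpret M: etale_groupoid M using M by (simp add: groupoid_model_def)
  obtain r where r: "continuous_map (objects M) (objects G) r" "proper_map (objects M) (objects G) r"
    "\<And>a m n h. \<lbrakk>(a, m, n) \<in> corr_actions G X R (arrows H); h \<in> HA\<rbrakk> \<Longrightarrow> r (fst (\<Phi> (arrows H) (a, m, n)) h) = a h"
    using model_anchor_proper[OF R M e e'] by metis
  define f where "f = fst (\<Phi> (arrows H) (induced_action G X H \<rho> \<mu>G \<mu>X))"
  have actor: "\<Phi> (arrows H) (induced_action G X H \<rho> \<mu>G \<mu>X) \<in> actors M H" using def by (simp add: defines_actor_def)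
  have "left_action M (arrows H) f (snd (\<Phi> (arrows H) (induced_action G X H \<rho> \<mu>G \<mu>X)))"
    using actor by (auto simp: actors_def groupoid_actions_def f_def)
  then have f: "continuous_map (objects H) (objects M) f"
    using left_action.continuous_anchor H.continuous_map_from_objects by blast
  have rf: "(r \<circ> f) \<omega> = \<rho> \<omega>" if "\<omega> \<in> topspace (objects H)" for \<omega>
    using r(3)[of "restrict (\<rho> \<circ> rng H) HA" _ _ \<omega>] def that
    by (simp add: f_def induced_action_def defines_actor_def H.rng_of_unit)
  have "proper_map (objects H) (objects M) f \<longleftrightarrow> proper_map (objects H) (objects G) (r \<circ> f)"
  proof
    assume "proper_map (objects H) (objects M) f"
    then show "proper_map (objects H) (objects G) (r \<circ> f)" using r(2) by (rule proper_map_compose)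
  next
    assume "proper_map (objects H) (objects G) (r \<circ> f)"
    with M.Hausdorff_objects show "proper_map (objects H) (objects M) f" using f r(1)
      by (rule proper_map_from_composition_right)
  qed
  also have "\<dots> \<longleftrightarrow> proper_map (objects H) (objects G) \<rho>" using rf by (rule proper_map_cong)
  finally show ?thesis using actor by (simp add: proper_actor_def f_def)
qed

end

text \<open>Paths may be infinite, so they are coded as sets of finite lists. The length of a list
  records the position of its letter, and the final \<open>Inr\<close> keeps letters apart from the
  list that holds the first vertex. The outer singleton only matches the type.\<close>

definition path_code :: "'g \<times> (nat \<Rightarrow> 'x option) \<Rightarrow> ('g + 'x + 'b) list set set" where
  "path_code p = {insert [Inl (fst p)] {replicate i (Inl undefined) @ [Inr (Inl x)] |i x. snd p i = Some x}}"

lemma inj_path_code: "inj (path_code :: 'g \<times> (nat \<Rightarrow> 'x option) \<Rightarrow> ('g + 'x + 'b) list set set)"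
proof (rule injI)
  fix p q :: "'g \<times> (nat \<Rightarrow> 'x option)"
  define S :: "(nat \<Rightarrow> 'x option) \<Rightarrow> ('g + 'x + 'b) list set"
    where "S = (\<lambda>\<sigma>. {replicate i (Inl undefined) @ [Inr (Inl x)] |i x. \<sigma> i = Some x})"
  assume "(path_code p :: ('g + 'x + 'b) list set set) = path_code q"
  then have eq: "insert [Inl (fst p)] (S (snd p)) = insert [Inl (fst q)] (S (snd q))"
    by (simp add: path_code_def S_def)
  have no: "[Inl c] \<notin> S \<tau>" for c \<tau> by (auto simp: S_def append_eq_Cons_conv)
  have "[Inl (fst p)] = ([Inl (fst q)] :: ('g + 'x + 'b) list)"
    using eq no by (metis insert_iff)
  then have z: "fst p = fst q" by simp
  then have S: "S (snd p) = S (snd q)" using eq no by (metis insert_ident)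
  have iff: "replicate i (Inl undefined) @ [Inr (Inl x)] \<in> S \<tau> \<longleftrightarrow> \<tau> i = Some x" for i x \<tau>
  proof
    assume "replicate i (Inl undefined) @ [Inr (Inl x)] \<in> S \<tau>"
    then obtain j y where j: "replicate i (Inl undefined) @ [Inr (Inl x)] =
        (replicate j (Inl undefined) @ [Inr (Inl y)] :: ('g + 'x + 'b) list)" "\<tau> j = Some y"
      unfolding S_def by blast
    from j(1) have "x = y" by simp
    moreover from j(1) have "i = j" by (metis append1_eq_conv length_replicate)
    ultimately show "\<tau> i = Some x" using j(2) by simp
  qed (auto simp: S_def)
  have "snd p i = Some x \<longleftrightarrow> snd q i = Some x" for i x
    using iff[of i x "snd p"] iff[of i x "snd q"] S by simp
  then have "snd p i = snd q i" for i by (metis not_Some_eq)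
  then show "p = q" using z by (simp add: prod_eq_iff fun_eq_iff)
qed

theorem theorem4p2:
  fixes G :: "'g tgroupoid" and H :: "'h tgroupoid" and R :: "'g set"
    and X :: "('g, 'x) correspondence" and M :: "'m tgroupoid"
    and \<Phi> :: "('g, 'x, 'm, 'h) act_bij"
    and \<Psi> :: "('g, 'x, 'm, ('g, 'x, 'm, 'h) universe) act_bij"
  assumes G: "etale_groupoid G"
    and H: "etale_groupoid H"
    and R_open: "openin (objects G) R"
    and R_invariant: "invariant_set G R"
    and X: "groupoid_correspondence G X"
    and X_regular: "regular_on G X R"
    and M: "groupoid_model G X R M \<Phi> \<Psi>"
  shows
    "(\<forall>\<rho> \<mu>G \<mu>X. actor_data G X H \<rho> \<mu>G \<mu>X \<longrightarrow>
        (defines_actor G X R M \<Phi> H \<rho> \<mu>G \<mu>X \<longleftrightarrow>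
           actor_associative G X H \<rho> \<mu>G \<mu>X \<and>
           actor_unital H \<rho> \<mu>G \<and>
           actor_cancellative G X H \<rho> \<mu>G \<mu>X \<and>
           actor_covering X R H \<rho> \<mu>X \<and>
           actor_closed G X H \<rho> \<mu>X)) \<and>
     (\<forall>\<beta> \<in> actors M H. \<exists>!(\<rho>, \<mu>G, \<mu>X).
        \<rho> \<in> extensional (units H) \<and>
        \<mu>G \<in> extensional (topspace (fibre_product (arrows G) (src G) \<rho> (objects H))) \<and>
        \<mu>X \<in> extensional (topspace (corr_domain X \<rho> (objects H))) \<and>
        actor_data G X H \<rho> \<mu>G \<mu>X \<and>
        defines_actor G X R M \<Phi> H \<rho> \<mu>G \<mu>X \<and>
        \<Phi> (arrows H) (induced_action G X H \<rho> \<mu>G \<mu>X) = \<beta>) \<and>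
     (\<forall>\<rho> \<mu>G \<mu>X. actor_data G X H \<rho> \<mu>G \<mu>X \<and> defines_actor G X R M \<Phi> H \<rho> \<mu>G \<mu>X \<longrightarrow>
        (proper_actor M H (\<Phi> (arrows H) (induced_action G X H \<rho> \<mu>G \<mu>X)) \<longleftrightarrow>
           proper_map (objects H) (objects G) \<rho>)) \<and>
     (\<forall>\<rho> \<mu>G \<mu>X. actor_data G X H \<rho> \<mu>G \<mu>X \<and> proper_map (objects H) (objects G) \<rho> \<and>
        actor_associative G X H \<rho> \<mu>G \<mu>X \<and>
        actor_unital H \<rho> \<mu>G \<and>
        actor_cancellative G X H \<rho> \<mu>G \<mu>X \<and>
        actor_covering X R H \<rho> \<mu>X \<longrightarrow>
        actor_closed G X H \<rho> \<mu>X)"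
proof -
  interpret actor_space G X H R
    by (intro actor_space.intro correspondence_setting.intro G X H)
  have mod: "etale_groupoid M" "action_bijections G X R M \<Phi>" "natural_bijections G X R M \<Phi> \<Phi>"
    using M by (auto simp: groupoid_model_def)
  have setting: "actor_setting G X H \<rho> \<mu>G \<mu>X" if "actor_data G X H \<rho> \<mu>G \<mu>X" for \<rho> \<mu>G \<mu>X
    using actor_space_axioms that by (rule actor_setting.intro)
  \<comment> \<open>The embedding of the objects of \<open>M\<close>; together with
    \<open>path_code\<close> it shows that the auxiliary type is large enough.\<close>
  have e: "inj (\<lambda>u. {{[Inr (Inr (Inl u))]}} :: ('g, 'x, 'm, 'h) universe)" by (rule injI) simp
  show ?thesis
  proof (intro conjI allI impI ballI; (elim conjE)?)
    fix \<rho> \<mu>G \<mu>X assume "actor_data G X H \<rho> \<mu>G \<mu>X"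
    then show "defines_actor G X R M \<Phi> H \<rho> \<mu>G \<mu>X \<longleftrightarrow>
           actor_associative G X H \<rho> \<mu>G \<mu>X \<and> actor_unital H \<rho> \<mu>G \<and> actor_cancellative G X H \<rho> \<mu>G \<mu>X \<and>
           actor_covering X R H \<rho> \<mu>X \<and> actor_closed G X H \<rho> \<mu>X"
      by (rule actor_setting.defines_actor_iff[OF setting mod])
  next
    fix \<beta> assume "\<beta> \<in> actors M H"
    with mod show "\<exists>!(\<rho>, \<mu>G, \<mu>X).
        \<rho> \<in> extensional (units H) \<and>
        \<mu>G \<in> extensional (topspace (fibre_product (arrows G) (src G) \<rho> (objects H))) \<and>
        \<mu>X \<in> extensional (topspace (corr_domain X \<rho> (objects H))) \<and>
        actor_data G X H \<rho> \<mu>G \<mu>X \<and>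
        defines_actor G X R M \<Phi> H \<rho> \<mu>G \<mu>X \<and>
        \<Phi> (arrows H) (induced_action G X H \<rho> \<mu>G \<mu>X) = \<beta>"
      by (rule actor_unique_data)
  next
    fix \<rho> \<mu>G \<mu>X assume "actor_data G X H \<rho> \<mu>G \<mu>X" "defines_actor G X R M \<Phi> H \<rho> \<mu>G \<mu>X"
    then show "proper_actor M H (\<Phi> (arrows H) (induced_action G X H \<rho> \<mu>G \<mu>X)) \<longleftrightarrow>
        proper_map (objects H) (objects G) \<rho>"
      by (rule proper_actor_iff[OF R_open R_invariant X_regular M e inj_path_code])
  next
    fix \<rho> \<mu>G \<mu>X assume "actor_data G X H \<rho> \<mu>G \<mu>X" "proper_map (objects H) (objects G) \<rho>"
      "actor_associative G X H \<rho> \<mu>G \<mu>X"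
    then show "actor_closed G X H \<rho> \<mu>X" using actor_setting.proper_imp_closed[OF setting] by blast
  qed
qed

end
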